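(* Let $G$ be an abelian group with a character $\sigma:G\to\mathbb C^\times$. Then $M$ is a representation of the Lie algebra $\widehat{\mathfrak u}_\nu(\mathcal R_\sigma,\bar{\ })$ with the action given by $$2e_{ij}(m,\alpha)\mapsto x_{ij}(\tilde\alpha,m)+\delta_{m,0}\,\delta_{ij}(1-\delta_{\tilde\alpha,1})\frac{1+\tilde\alpha}{1-\tilde\alpha},\qquad c\mapsto\frac12,$$ for $1\le i,j\le\nu$, $m\in\mathbb Z$, $\alpha\in G$ (the term containing $(1-\delta_{\tilde\alpha,1})$ being $0$ when $\tilde\alpha=1$).
   Context: Fix an integer $\nu\ge2$; $\mathbb N=\{0,1,2,\dots\}$. Fock space and vertex operators. Let $\Gamma=\bigoplus_{i=1}^{\nu}\mathbb{Z}\epsilon_i$ with $(\epsilon_i,\epsilon_j)=\delta_{ij}$. Let $\mathcal H$ be the complex Lie algebra spanned by $\epsilon_i(n)$ ($1\le i\le\nu$, $n\in2\mathbb Z+1$) and a central element $1$, with $[\alpha(m),\beta(n)]=\frac m2(\alpha,\beta)\delta_{m+n,0}\,1$, where $\alpha(n)=\sum_i c_i\epsilon_i(n)$ for $\alpha=\sum_i c_i\epsilon_i\in\Gamma$. Let $\varepsilon:\Gamma\times\Gamma\to\{\pm1\}$ be bimultiplicative with $\varepsilon(\epsilon_i,\epsilon_j)=1$ if $i\le j$ and $-1$ if $i>j$. Let $\bar\Gamma=\Gamma/2\Gamma$ and let $\mathbb C[\bar\Gamma]$ be the twisted group algebra with basis $e^{\bar\alpha}$ and product $e^{\bar\alpha}e^{\bar\beta}=\varepsilon(\alpha,\beta)e^{\overline{\alpha+\beta}}$.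 Let $\mathcal H^-$ be the span of $\epsilon_i(n)$, $n\in-(2\mathbb N+1)$, and $M=\mathbb C[\bar\Gamma]\otimes\mathcal S(\mathcal H^-)$: $e^{\bar\alpha}$ acts by left multiplication on the first factor; on the symmetric algebra $\mathcal S(\mathcal H^-)$, $\epsilon_i(n)$ acts by multiplication if $n<0$ and, if $n>0$, as the derivation with $\epsilon_i(n)\cdot\epsilon_j(m)=\frac n2\delta_{ij}\delta_{m+n,0}$; $1$ acts as identity. Put $E_{\pm}(\alpha,z)=\exp\big(-2\sum_{n\in\pm(2\mathbb N+1)}\frac{\alpha(n)}{n}z^{-n}\big)$, $\epsilon_i(z)=\sum_{n\in2\mathbb Z+1}\epsilon_i(n)z^{-n}$. For $a\in\mathbb C^\times$ define $X_{ij}(a,z)=\varepsilon(\epsilon_i,\epsilon_j)e^{\overline{\epsilon_i-\epsilon_j}}E_-(\epsilon_i,z)E_-(-\epsilon_j,az)E_+(\epsilon_i,z)E_+(-\epsilon_j,az)$ if $i\ne j$; $X_{ii}(1,z)=4\epsilon_i(z)$; $X_{ii}(a,z)=\frac{1+a}{1-a}\big(E_-(\epsilon_i,z)E_-(-\epsilon_i,az)E_+(\epsilon_i,z)E_+(-\epsilon_i,az)-1\big)$ if $a\ne1$. Operators $x_{ij}(a,n)$ on $M$ are defined by $X_{ij}(a,z)=\sum_{n\in\mathbb Z}x_{ij}(a,n)z^{-n}$. Unitary Lie algebra. Write $G$ additively and $\tilde\alpha=\sigma(\alpha)$. $\mathcal R_\sigma$ is the associative $\mathbb C$-algebra with basis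 $t^me^\alpha$ ($m\in\mathbb Z,\alpha\in G$), where $e^\alpha e^\beta=e^{\alpha+\beta}$ and $e^\alpha t^m=\tilde\alpha^m t^me^\alpha$. The anti-involution $\bar{\ }$ of $\mathcal R_\sigma$ is given by $\bar t=-t$, $\overline{e^\alpha}=e^{-\alpha}$. For a matrix $X\in M_\nu(\mathcal R_\sigma)$ put $X^*=\overline X^{\,t}$ (apply $\bar{\ }$ to the entries and transpose). $\mathfrak u_\nu(\mathcal R_\sigma,\bar{\ })=\{X\in M_\nu(\mathcal R_\sigma):X^*=-X\}$, a Lie algebra under the commutator, spanned by $e_{ij}(m,\alpha)=E_{ij}t^me^\alpha-E_{ji}\overline{t^me^\alpha}$. Let $\widehat{gl}_\nu(\mathcal R_\sigma)=gl_\nu(\mathcal R_\sigma)\oplus\mathbb Cc$ with $c$ central and $[E_{ij}t^me^\alpha,E_{kl}t^ne^\beta]=\delta_{jk}\tilde\alpha^nE_{il}t^{m+n}e^{\alpha+\beta}-\delta_{il}\tilde\beta^mE_{kj}t^{m+n}e^{\alpha+\beta}+m\delta_{il}\delta_{jk}\delta_{m+n,0}\delta_{\tilde\alpha\tilde\beta,1}\tilde\alpha^nc$. Then $\widehat{\mathfrak u}_\nu(\mathcal R_\sigma,\bar{\ })=\mathfrak u_\nu(\mathcal R_\sigma,\bar{\ })\oplus\mathbb Cc$ with the bracket inherited from $\widehat{gl}_\nu(\mathcal R_\sigma)$. *)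

theory Defs
  imports
    "HOL-Analysis.Finite_Cartesian_Product"
    "HOL-Library.Poly_Mapping"
    "HOL-Library.Groups_Big_Fun"
    "HOL-Library.Z2"
begin

text \<open>
  The rank \<open>\<nu>\<close> is the cardinality of a finite linearly ordered index type \<open>'n\<close>, which stands for
  the index set \<open>1 < \<dots> < \<nu>\<close>; the order matters only for the cocycle \<open>\<epsilon>\<close>.
\<close>

section \<open>Linear extension from a basis\<close>

text \<open>
  An element of \<open>'k \<Rightarrow>\<^sub>0 'c\<close> is a finite combination of the basis elements \<open>k\<close> with coefficients in \<open>'c\<close>.
  \<open>lin_ext F\<close> is the additive map that sends \<open>c\<close> times the basis element \<open>k\<close> to \<open>F k c\<close>.
\<close>

definition lin_ext :: "('k \<Rightarrow> 'c::zero \<Rightarrow> 'b::comm_monoid_add) \<Rightarrow> ('k \<Rightarrow>\<^sub>0 'c) \<Rightarrow> 'b" where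
  "lin_ext F f = (\<Sum>k\<in>Poly_Mapping.keys f. F k (Poly_Mapping.lookup f k))"

definition pm_scale :: "complex \<Rightarrow> ('k \<Rightarrow>\<^sub>0 complex) \<Rightarrow> ('k \<Rightarrow>\<^sub>0 complex)" where
  "pm_scale c = Poly_Mapping.map ((*) c)"


section \<open>Lie algebras and representations\<close>

text \<open>The Lie algebra is a subspace \<open>L\<close> of an ambient complex vector space.\<close>

locale lie_algebra = vector_space scale
  for scale :: "complex \<Rightarrow> 'l::ab_group_add \<Rightarrow> 'l" +
  fixes L :: "'l set" and br :: "'l \<Rightarrow> 'l \<Rightarrow> 'l"
  assumes L_subspace: "subspace L"
    and br_closed: "\<And>x y. x \<in> L \<Longrightarrow> y \<in> L \<Longrightarrow> br x y \<in> L"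
    and br_add_left: "\<And>x y z. x \<in> L \<Longrightarrow> y \<in> L \<Longrightarrow> z \<in> L \<Longrightarrow> br (x + y) z = br x z + br y z"
    and br_add_right: "\<And>x y z. x \<in> L \<Longrightarrow> y \<in> L \<Longrightarrow> z \<in> L \<Longrightarrow> br z (x + y) = br z x + br z y"
    and br_scale_left: "\<And>c x y. x \<in> L \<Longrightarrow> y \<in> L \<Longrightarrow> br (scale c x) y = scale c (br x y)"
    and br_scale_right: "\<And>c x y. x \<in> L \<Longrightarrow> y \<in> L \<Longrightarrow> br x (scale c y) = scale c (br x y)"
    and br_self: "\<And>x. x \<in> L \<Longrightarrow> br x x = 0"
    and br_jacobi: "\<And>x y z. x \<in> L \<Longrightarrow> y \<in> L \<Longrightarrow> z \<in> L \<Longrightarrow>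
          br (br x y) z + br (br y z) x + br (br z x) y = 0"

locale lie_representation = lie_algebra scale L br + V: vector_space scaleV
  for scale :: "complex \<Rightarrow> 'l::ab_group_add \<Rightarrow> 'l" and L br
    and scaleV :: "complex \<Rightarrow> 'v::ab_group_add \<Rightarrow> 'v" +
  fixes \<rho> :: "'l \<Rightarrow> 'v \<Rightarrow> 'v"
  assumes rep_linear: "\<And>x. x \<in> L \<Longrightarrow> Vector_Spaces.linear scaleV scaleV (\<rho> x)"
    and rep_add: "\<And>x y v. x \<in> L \<Longrightarrow> y \<in> L \<Longrightarrow> \<rho> (x + y) v = \<rho> x v + \<rho> y v"
    and rep_scale: "\<And>c x v. x \<in> L \<Longrightarrow> \<rho> (scale c x) v = scaleV c (\<rho> x v)"
    and rep_bracket: "\<And>x y v. x \<in> L \<Longrightarrow> y \<in> L \<Longrightarrow> \<rho> (br x y) v = \<rho> x (\<rho> y v) - \<rho> y (\<rho> x v)"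


section \<open>The unitary Lie algebra\<close>

definition is_character :: "('g::ab_group_add \<Rightarrow> complex) \<Rightarrow> bool" where
  "is_character \<sigma> \<longleftrightarrow> (\<forall>\<alpha>. \<sigma> \<alpha> \<noteq> 0) \<and> (\<forall>\<alpha> \<beta>. \<sigma> (\<alpha> + \<beta>) = \<sigma> \<alpha> * \<sigma> \<beta>)"

text \<open>The basis element \<open>t\<^sup>m e\<^sup>\<alpha>\<close> is indexed by \<open>(m, \<alpha>)\<close>.\<close>

type_synonym 'g ralg = "(int \<times> 'g) \<Rightarrow>\<^sub>0 complex"

abbreviation rmon :: "int \<Rightarrow> 'g \<Rightarrow> 'g ralg" where
  "rmon m \<alpha> \<equiv> Poly_Mapping.single (m, \<alpha>) 1"

text \<open>\<open>(t\<^sup>m e\<^sup>\<alpha>) (t\<^sup>n e\<^sup>\<beta>) = \<sigma>(\<alpha>)\<^sup>n t\<^sup>m\<^sup>+\<^sup>n e\<^sup>\<alpha>\<^sup>+\<^sup>\<beta>\<close>\<close>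

definition rmult :: "('g::ab_group_add \<Rightarrow> complex) \<Rightarrow> 'g ralg \<Rightarrow> 'g ralg \<Rightarrow> 'g ralg" where
  "rmult \<sigma> f g = lin_ext (\<lambda>(m, \<alpha>) c. lin_ext (\<lambda>(n, \<beta>) d.
     Poly_Mapping.single (m + n, \<alpha> + \<beta>) (c * d * \<sigma> \<alpha> powi n)) g) f"

text \<open>
  The complex-linear anti-involution with \<open>t \<mapsto> -t\<close>, \<open>e\<^sup>\<alpha> \<mapsto> e\<^sup>-\<^sup>\<alpha>\<close>; hence
  \<open>t\<^sup>m e\<^sup>\<alpha> \<mapsto> e\<^sup>-\<^sup>\<alpha> (-t)\<^sup>m = (-1)\<^sup>m \<sigma>(-\<alpha>)\<^sup>m t\<^sup>m e\<^sup>-\<^sup>\<alpha>\<close>.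
\<close>

definition rbar :: "('g::ab_group_add \<Rightarrow> complex) \<Rightarrow> 'g ralg \<Rightarrow> 'g ralg" where
  "rbar \<sigma> f = lin_ext (\<lambda>(m, \<alpha>) c.
     Poly_Mapping.single (m, - \<alpha>) (c * (-1) powi m * \<sigma> (- \<alpha>) powi m)) f"

type_synonym ('g, 'n) rmat = "'g ralg ^ 'n ^ 'n"

definition mat_mult :: "('g::ab_group_add \<Rightarrow> complex) \<Rightarrow> ('g, 'n::finite) rmat \<Rightarrow> ('g, 'n) rmat \<Rightarrow> ('g, 'n) rmat" where
  "mat_mult \<sigma> X Y = (\<chi> i j. \<Sum>k\<in>UNIV. rmult \<sigma> (X $ i $ k) (Y $ k $ j))"

definition mat_star :: "('g::ab_group_add \<Rightarrow> complex) \<Rightarrow> ('g, 'n::finite) rmat \<Rightarrow> ('g, 'n) rmat" where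
  "mat_star \<sigma> X = (\<chi> i j. rbar \<sigma> (X $ j $ i))"

definition mat_unit :: "'n::finite \<Rightarrow> 'n \<Rightarrow> 'g ralg \<Rightarrow> ('g, 'n) rmat" where
  "mat_unit i j r = (\<chi> k l. if k = i \<and> l = j then r else 0)"

text \<open>
  A pair \<open>(X, a)\<close> stands for \<open>X + a c\<close> with \<open>c\<close> the central element. \<open>gl_cocycle\<close> is the coefficient
  of \<open>c\<close> in the bracket of two matrices, and \<open>gl_bracket_basis\<close> below recovers the bracket of
  \<open>E\<^sub>i\<^sub>j t\<^sup>m e\<^sup>\<alpha>\<close> and \<open>E\<^sub>k\<^sub>l t\<^sup>n e\<^sup>\<beta>\<close>. Its condition is \<open>\<sigma>(\<alpha>) \<sigma>(\<beta>) = 1\<close>, not \<open>\<alpha> + \<beta> = 0\<close>.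
\<close>

type_synonym ('g, 'n) glhat = "('g, 'n) rmat \<times> complex"

definition rcocycle :: "('g::ab_group_add \<Rightarrow> complex) \<Rightarrow> 'g ralg \<Rightarrow> 'g ralg \<Rightarrow> complex" where
  "rcocycle \<sigma> f g = lin_ext (\<lambda>(m, \<alpha>) c. lin_ext (\<lambda>(n, \<beta>) d.
     c * d * (of_int m * of_bool (m + n = 0) * of_bool (\<sigma> \<alpha> * \<sigma> \<beta> = 1) * \<sigma> \<alpha> powi n)) g) f"

definition gl_cocycle :: "('g::ab_group_add \<Rightarrow> complex) \<Rightarrow> ('g, 'n::finite) rmat \<Rightarrow> ('g, 'n) rmat \<Rightarrow> complex" where
  "gl_cocycle \<sigma> X Y = (\<Sum>i\<in>UNIV. \<Sum>j\<in>UNIV. rcocycle \<sigma> (X $ i $ j) (Y $ j $ i))"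

definition gl_bracket :: "('g::ab_group_add \<Rightarrow> complex) \<Rightarrow> ('g, 'n::finite) glhat \<Rightarrow> ('g, 'n) glhat \<Rightarrow> ('g, 'n) glhat" where
  "gl_bracket \<sigma> x y =
     (mat_mult \<sigma> (fst x) (fst y) - mat_mult \<sigma> (fst y) (fst x), gl_cocycle \<sigma> (fst x) (fst y))"

definition gl_scale :: "complex \<Rightarrow> ('g, 'n::finite) glhat \<Rightarrow> ('g, 'n) glhat" where
  "gl_scale c x = ((\<chi> i j. pm_scale c (fst x $ i $ j)), c * snd x)"

definition gl_central :: "('g, 'n::finite) glhat" where
  "gl_central = (0, 1)"

definition unitary_mats :: "('g::ab_group_add \<Rightarrow> complex) \<Rightarrow> ('g, 'n::finite) rmat set" where
  "unitary_mats \<sigma> = {X. mat_star \<sigma> X = - X}"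

definition unitary_hat :: "('g::ab_group_add \<Rightarrow> complex) \<Rightarrow> ('g, 'n::finite) glhat set" where
  "unitary_hat \<sigma> = unitary_mats \<sigma> \<times> UNIV"

definition unitary_e :: "('g::ab_group_add \<Rightarrow> complex) \<Rightarrow> 'n::finite \<Rightarrow> 'n \<Rightarrow> int \<Rightarrow> 'g \<Rightarrow> ('g, 'n) glhat" where
  "unitary_e \<sigma> i j m \<alpha> =
     (mat_unit i j (rmon m \<alpha>) - mat_unit j i (rbar \<sigma> (rmon m \<alpha>)), 0)"


section \<open>The lattice and its twisted group algebra\<close>

type_synonym 'n lattice = "int ^ 'n"

text \<open>\<open>'n lattice2\<close> is the lattice modulo 2, with \<open>red2\<close> as quotient map.\<close>

type_synonym 'n lattice2 = "bit ^ 'n"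

definition eps_vec :: "'n::finite \<Rightarrow> 'n lattice" where
  "eps_vec i = axis i 1"

definition red2 :: "'n::finite lattice \<Rightarrow> 'n lattice2" where
  "red2 \<alpha> = (\<chi> i. of_int (\<alpha> $ i))"

text \<open>
  The bimultiplicative \<open>\<epsilon>\<close> is determined by its values on basis vectors: \<open>\<epsilon>(\<alpha>, \<beta>)\<close> is the product of
  \<open>(-1)\<^bsup>\<alpha>\<^sub>i \<beta>\<^sub>j\<^esup>\<close> over all \<open>i > j\<close>.
\<close>

definition cocyc :: "'n::{finite,linorder} lattice \<Rightarrow> 'n lattice \<Rightarrow> complex" where
  "cocyc \<alpha> \<beta> = (\<Prod>i\<in>UNIV. \<Prod>j\<in>{j. j < i}. (-1) powi (\<alpha> $ i * \<beta> $ j))"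

text \<open>
  \<open>cocyc\<close> depends only on the classes modulo 2 (\<open>cocyc2_red2\<close> below), so it may be evaluated on the
  representatives with coordinates in \<open>{0, 1}\<close>.
\<close>

definition lift2 :: "'n::finite lattice2 \<Rightarrow> 'n lattice" where
  "lift2 a = (\<chi> i. of_bool (a $ i = 1))"

definition cocyc2 :: "'n::{finite,linorder} lattice2 \<Rightarrow> 'n lattice2 \<Rightarrow> complex" where
  "cocyc2 a b = cocyc (lift2 a) (lift2 b)"


section \<open>Fock space\<close>

text \<open>
  The variable \<open>(i, k)\<close> stands for \<open>\<epsilon>\<^sub>i(-(2k+1))\<close>, so that the symmetric algebra is the polynomial
  algebra in these variables. In the Fock space, \<open>single b p\<close> is the tensor of \<open>e\<^sup>b\<close> and \<open>p\<close>.
\<close>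

type_synonym 'n symalg = "(('n \<times> nat) \<Rightarrow>\<^sub>0 nat) \<Rightarrow>\<^sub>0 complex"

type_synonym 'n fock = "'n lattice2 \<Rightarrow>\<^sub>0 'n symalg"

abbreviation sym_var :: "'n \<times> nat \<Rightarrow> 'n symalg" where
  "sym_var x \<equiv> Poly_Mapping.single (Poly_Mapping.single x 1) 1"

definition sym_deriv :: "'n \<times> nat \<Rightarrow> 'n symalg \<Rightarrow> 'n symalg" where
  "sym_deriv x p = lin_ext (\<lambda>u c.
     Poly_Mapping.single (u - Poly_Mapping.single x 1) (of_nat (Poly_Mapping.lookup u x) * c)) p"

definition fock_scale :: "complex \<Rightarrow> 'n::finite fock \<Rightarrow> 'n fock" where
  "fock_scale c = Poly_Mapping.map (pm_scale c)"

definition sym_act :: "('n symalg \<Rightarrow> 'n symalg) \<Rightarrow> 'n::finite fock \<Rightarrow> 'n fock" where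
  "sym_act D v = lin_ext (\<lambda>b p. Poly_Mapping.single b (D p)) v"

text \<open>Left multiplication by \<open>e\<^sup>a\<close> on the first tensor factor.\<close>

definition group_act :: "'n::{finite,linorder} lattice2 \<Rightarrow> 'n fock \<Rightarrow> 'n fock" where
  "group_act a v = lin_ext (\<lambda>b p. Poly_Mapping.single (a + b) (pm_scale (cocyc2 a b) p)) v"

text \<open>
  The action of \<open>\<epsilon>\<^sub>i(n)\<close>, meaningful for odd \<open>n\<close> only: for \<open>n = -(2k+1)\<close> multiplication by the variable
  \<open>(i, k)\<close>, for \<open>n = 2k+1\<close> the derivation sending this variable to \<open>n/2\<close> and the others to \<open>0\<close>.
\<close>

definition heis_sym :: "'n \<Rightarrow> int \<Rightarrow> 'n symalg \<Rightarrow> 'n symalg" where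
  "heis_sym i n p =
     (if n < 0 then sym_var (i, nat ((- n - 1) div 2)) * p
      else pm_scale (of_int n / 2) (sym_deriv (i, nat ((n - 1) div 2)) p))"

definition heis :: "'n::finite lattice \<Rightarrow> int \<Rightarrow> 'n fock \<Rightarrow> 'n fock" where
  "heis \<alpha> n v = (\<Sum>i\<in>UNIV. fock_scale (of_int (\<alpha> $ i)) (sym_act (heis_sym i n) v))"


section \<open>Formal series of operators\<close>

text \<open>
  A formal series \<open>\<Sum>\<^sub>n A\<^sub>n z\<^sup>-\<^sup>n\<close> of operators is the family of its coefficients \<open>n \<mapsto> A\<^sub>n\<close>.
  \<open>Sum_any\<close> sums over the indices with nonzero summand and is \<open>0\<close> if there are infinitely many of them.
  This never happens below: the exponents have only terms \<open>n > 0\<close> or only terms \<open>n < 0\<close>,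
  and for fixed \<open>v\<close> the coefficients of \<open>E\<^sub>+\<close> with large \<open>n\<close> annihilate \<open>v\<close>, since they lower the degree.
\<close>

type_synonym 'v op_series = "int \<Rightarrow> 'v \<Rightarrow> 'v"

definition ser_one :: "'v::zero op_series" where
  "ser_one n v = (if n = 0 then v else 0)"

definition ser_mult :: "'v::comm_monoid_add op_series \<Rightarrow> 'v op_series \<Rightarrow> 'v op_series" where
  "ser_mult A B n v = Sum_any (\<lambda>k. A k (B (n - k) v))"

primrec ser_pow :: "'v::comm_monoid_add op_series \<Rightarrow> nat \<Rightarrow> 'v op_series" where
  "ser_pow A 0 = ser_one"
| "ser_pow A (Suc r) = ser_mult A (ser_pow A r)"

definition ser_exp :: "'n::finite fock op_series \<Rightarrow> 'n fock op_series" where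
  "ser_exp A n v = Sum_any (\<lambda>r. fock_scale (1 / fact r) (ser_pow A r n v))"

text \<open>Replaces \<open>z\<close> by \<open>a z\<close>.\<close>

definition ser_dilate :: "complex \<Rightarrow> 'n::finite fock op_series \<Rightarrow> 'n fock op_series" where
  "ser_dilate a A n v = fock_scale (a powi (- n)) (A n v)"

definition E_plus :: "'n::finite lattice \<Rightarrow> 'n fock op_series" where
  "E_plus \<alpha> = ser_exp (\<lambda>n v. if odd n \<and> n > 0 then fock_scale (- 2 / of_int n) (heis \<alpha> n v) else 0)"

definition E_minus :: "'n::finite lattice \<Rightarrow> 'n fock op_series" where
  "E_minus \<alpha> = ser_exp (\<lambda>n v. if odd n \<and> n < 0 then fock_scale (- 2 / of_int n) (heis \<alpha> n v) else 0)"

text \<open>\<open>E\<^sub>-(\<epsilon>\<^sub>i, z) E\<^sub>-(-\<epsilon>\<^sub>j, a z) E\<^sub>+(\<epsilon>\<^sub>i, z) E\<^sub>+(-\<epsilon>\<^sub>j, a z)\<close>\<close>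

definition E_prod :: "'n::finite \<Rightarrow> 'n \<Rightarrow> complex \<Rightarrow> 'n fock op_series" where
  "E_prod i j a =
     ser_mult (E_minus (eps_vec i)) (ser_mult (ser_dilate a (E_minus (- eps_vec j)))
       (ser_mult (E_plus (eps_vec i)) (ser_dilate a (E_plus (- eps_vec j)))))"

text \<open>The coefficient of \<open>z\<^sup>-\<^sup>n\<close> in \<open>X\<^sub>i\<^sub>j(a, z)\<close>.\<close>

definition x_op :: "'n::{finite,linorder} \<Rightarrow> 'n \<Rightarrow> complex \<Rightarrow> int \<Rightarrow> 'n fock \<Rightarrow> 'n fock" where
  "x_op i j a n v =
     (if i \<noteq> j then
        fock_scale (cocyc (eps_vec i) (eps_vec j))
          (group_act (red2 (eps_vec i - eps_vec j)) (E_prod i j a n v))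
      else if a = 1 then
        (if odd n then fock_scale 4 (heis (eps_vec i) n v) else 0)
      else
        fock_scale ((1 + a) / (1 - a)) (E_prod i i a n v - ser_one n v))"


section \<open>Basic properties of the definitions\<close>

lemma lin_ext_superset:
  assumes "finite A" "Poly_Mapping.keys f \<subseteq> A" "\<And>k. F k 0 = 0"
  shows "lin_ext F f = (\<Sum>k\<in>A. F k (Poly_Mapping.lookup f k))"
  unfolding lin_ext_def using assms
  by (intro sum.mono_neutral_left) (auto simp: in_keys_iff)

lemma lin_ext_zero [simp]: "lin_ext F 0 = 0"
  by (simp add: lin_ext_def)

lemma lin_ext_single:
  assumes "\<And>k. F k 0 = 0"
  shows "lin_ext F (Poly_Mapping.single k c) = F k c"
  using assms by (simp add: lin_ext_def)

lemma lin_ext_add: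
  assumes "\<And>k. F k 0 = 0" "\<And>k a b. F k (a + b) = F k a + F k b"
  shows "lin_ext F (f + g) = lin_ext F f + lin_ext F g"
proof -
  let ?A = "Poly_Mapping.keys f \<union> Poly_Mapping.keys g"
  have "lin_ext F h = (\<Sum>k\<in>?A. F k (Poly_Mapping.lookup h k))" if "Poly_Mapping.keys h \<subseteq> ?A" for h
    using that assms(1) by (intro lin_ext_superset) auto
  then show ?thesis
    using Poly_Mapping.keys_add[of f g]
    by (simp add: lookup_add assms(2) sum.distrib)
qed

lemma poly_mapping_add_induct [case_names zero single add]:
  fixes f :: "'k \<Rightarrow>\<^sub>0 'c::comm_monoid_add"
  assumes "P 0" "\<And>k c. P (Poly_Mapping.single k c)" "\<And>f g. P f \<Longrightarrow> P g \<Longrightarrow> P (f + g)"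
  shows "P f"
proof (induction f rule: update_induct)
  case const
  then show ?case by (rule assms(1))
next
  case (update f a b)
  have "Poly_Mapping.update a b f = Poly_Mapping.single a b + f"
    using update.hyps
    by (intro poly_mapping_eqI) (auto simp: lookup_update lookup_add lookup_single when_def in_keys_iff)
  then show ?case using assms(2,3) update.IH by simp
qed

lemma lookup_pm_scale [simp]: "Poly_Mapping.lookup (pm_scale c f) k = c * Poly_Mapping.lookup f k"
  unfolding pm_scale_def by transfer (simp add: when_def)

lemma lookup_fock_scale [simp]:
  "Poly_Mapping.lookup (fock_scale c f) k = pm_scale c (Poly_Mapping.lookup f k)"
proof -
  have "pm_scale c 0 = 0" by (rule poly_mapping_eqI) simp
  then show ?thesis unfolding fock_scale_def
    by (cases "Poly_Mapping.lookup f k = 0") (simp_all add: map.rep_eq)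
qed

lemma lin_ext_rmult_aux:
  fixes c :: complex
  shows "lin_ext (\<lambda>(n, \<beta>) d. Poly_Mapping.single (m + n, \<alpha> + \<beta>) (c * d * \<sigma> \<alpha> powi n)) (g + h) =
  lin_ext (\<lambda>(n, \<beta>) d. Poly_Mapping.single (m + n, \<alpha> + \<beta>) (c * d * \<sigma> \<alpha> powi n)) g +
  lin_ext (\<lambda>(n, \<beta>) d. Poly_Mapping.single (m + n, \<alpha> + \<beta>) (c * d * \<sigma> \<alpha> powi n)) h"
  by (rule lin_ext_add) (auto simp: distrib_left distrib_right single_add)

lemma lin_ext_plus_fun: "lin_ext (\<lambda>k c. F k c + G k c) f = lin_ext F f + lin_ext G f"
  by (simp add: lin_ext_def sum.distrib)

lemma lin_ext_zero_fun: "(\<And>k c. F k c = 0) \<Longrightarrow> lin_ext F f = 0"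
  by (simp add: lin_ext_def)

lemma rmult_add_left: "rmult \<sigma> (f + g) h = rmult \<sigma> f h + rmult \<sigma> g h"
  unfolding rmult_def
  apply (rule lin_ext_add)
   apply (clarsimp intro!: lin_ext_zero_fun)
  apply (clarsimp simp flip: lin_ext_plus_fun)
  apply (rule arg_cong[where f = "\<lambda>F. lin_ext F h"])
  apply (auto simp: fun_eq_iff algebra_simps single_add)
  done

lemma rmult_add_right: "rmult \<sigma> h (f + g) = rmult \<sigma> h f + rmult \<sigma> h g"
  unfolding rmult_def lin_ext_rmult_aux
  by (simp add: lin_ext_def sum.distrib split_def)

lemma rmult_zero [simp]: "rmult \<sigma> 0 h = 0" "rmult \<sigma> h 0 = 0"
  by (simp_all add: rmult_def lin_ext_zero_fun split_def)

lemma rmult_single: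
  "rmult \<sigma> (Poly_Mapping.single (m, \<alpha>) c) (Poly_Mapping.single (n, \<beta>) d) =
   Poly_Mapping.single (m + n, \<alpha> + \<beta>) (c * d * \<sigma> \<alpha> powi n)"
  unfolding rmult_def by (subst lin_ext_single; simp add: lin_ext_single lin_ext_zero_fun split_def)+

lemma rbar_add: "rbar \<sigma> (f + g) = rbar \<sigma> f + rbar \<sigma> g"
  unfolding rbar_def by (rule lin_ext_add) (auto simp: algebra_simps single_add)

lemma rbar_zero [simp]: "rbar \<sigma> 0 = 0"
  by (simp add: rbar_def)

lemma rbar_single:
  "rbar \<sigma> (Poly_Mapping.single (m, \<alpha>) c) =
     Poly_Mapping.single (m, - \<alpha>) (c * (-1) powi m * \<sigma> (- \<alpha>) powi m)"
  unfolding rbar_def by (subst lin_ext_single) auto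

lemma is_character_props:
  assumes "is_character \<sigma>"
  shows "\<sigma> \<alpha> \<noteq> 0" "\<sigma> (\<alpha> + \<beta>) = \<sigma> \<alpha> * \<sigma> \<beta>" "\<sigma> 0 = 1" "\<sigma> (- \<alpha>) = inverse (\<sigma> \<alpha>)"
proof -
  show 1: "\<sigma> \<alpha> \<noteq> 0" and 2: "\<sigma> (\<alpha> + \<beta>) = \<sigma> \<alpha> * \<sigma> \<beta>" for \<alpha> \<beta>
    using assms by (auto simp: is_character_def)
  show 3: "\<sigma> 0 = 1" using 1[of 0] 2[of 0 0] by simp
  show "\<sigma> (- \<alpha>) = inverse (\<sigma> \<alpha>)"
    using 1[of \<alpha>] 2[of "- \<alpha>" \<alpha>] 3 by (simp add: field_simps)
qed

lemma rmult_assoc: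
  assumes "is_character \<sigma>"
  shows "rmult \<sigma> (rmult \<sigma> f g) h = rmult \<sigma> f (rmult \<sigma> g h)"
proof (induction f rule: poly_mapping_add_induct)
  case (single k c)
  show ?case
  proof (induction g rule: poly_mapping_add_induct)
    case (single l d)
    show ?case
    proof (induction h rule: poly_mapping_add_induct)
      case (single p e)
      obtain m \<alpha> n \<beta> r \<gamma> where "k = (m, \<alpha>)" "l = (n, \<beta>)" "p = (r, \<gamma>)"
        by (cases k, cases l, cases p)
      then show ?case
        by (simp add: rmult_single is_character_props[OF assms] power_int_add power_int_mult_distrib
            algebra_simps)
    qed (simp_all add: rmult_add_right)
  qed (simp_all add: rmult_add_left rmult_add_right)
qed (simp_all add: rmult_add_left)

lemma rbar_rmult:
  assumes "is_character \<sigma>"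
  shows "rbar \<sigma> (rmult \<sigma> f g) = rmult \<sigma> (rbar \<sigma> g) (rbar \<sigma> f)"
proof (induction f rule: poly_mapping_add_induct)
  case (single k c)
  show ?case
  proof (induction g rule: poly_mapping_add_induct)
    case (single l d)
    obtain m \<alpha> n \<beta> where "k = (m, \<alpha>)" "l = (n, \<beta>)"
      by (cases k, cases l)
    then show ?case
      by (simp add: rmult_single rbar_single is_character_props(1,2,3)[OF assms] power_int_add
          power_int_mult_distrib power_int_inverse is_character_props(4)[OF assms]
          is_character_props(4)[OF assms, of "\<alpha> + \<beta>"] field_simps del: minus_add_distrib)
        simp
  qed (simp_all add: rmult_add_left rmult_add_right rbar_add)
qed (simp_all add: rmult_add_left rmult_add_right rbar_add)

lemma rbar_rbar:
  assumes "is_character \<sigma>"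
  shows "rbar \<sigma> (rbar \<sigma> f) = f"
proof (induction f rule: poly_mapping_add_induct)
  case (single k c)
  obtain m \<alpha> where "k = (m, \<alpha>)" by (cases k)
  then show ?case
    using is_character_props(1)[OF assms, of \<alpha>]
    by (simp add: rbar_single is_character_props(2-)[OF assms] power_int_inverse power_int_minus_left
        field_simps split: if_splits)
qed (simp_all add: rbar_add)

lemma rbar_t: "is_character \<sigma> \<Longrightarrow> rbar \<sigma> (rmon 1 0) = - rmon 1 0"
  by (simp add: rbar_single is_character_props single_uminus)

lemma rbar_e: "rbar \<sigma> (rmon 0 \<alpha>) = rmon 0 (- \<alpha>)"
  by (simp add: rbar_single)

lemma minus_one_powi: "(-1 :: complex) powi k = (if even k then 1 else - 1)"
  by (simp add: power_int_minus_left)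

lemma cocyc_range: "cocyc \<alpha> \<beta> \<in> {1, -1}"
proof -
  have *: "prod f A \<in> {1, -1 :: complex}" if "\<And>i. i \<in> A \<Longrightarrow> f i \<in> {1, -1}" for f and A :: "'a set"
    using that by (induction A rule: infinite_finite_induct) fastforce+
  show ?thesis unfolding cocyc_def by (intro *) (simp add: minus_one_powi)
qed

lemma cocyc_add_left: "cocyc (\<alpha> + \<beta>) \<gamma> = cocyc \<alpha> \<gamma> * cocyc \<beta> \<gamma>"
  by (simp add: cocyc_def distrib_right power_int_add prod.distrib)

lemma cocyc_add_right: "cocyc \<gamma> (\<alpha> + \<beta>) = cocyc \<gamma> \<alpha> * cocyc \<gamma> \<beta>"
  by (simp add: cocyc_def distrib_left power_int_add prod.distrib)

lemma cocyc_eps_vec: "cocyc (eps_vec i) (eps_vec j) = (if i \<le> j then 1 else - 1)"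
proof -
  have "cocyc (eps_vec i) (eps_vec j) =
      (\<Prod>k\<in>UNIV. if k = i then (\<Prod>l\<in>{l. l < i}. if l = j then - 1 else 1) else 1)"
    unfolding cocyc_def
    by (intro prod.cong refl) (auto simp: eps_vec_def axis_def if_distrib cong: if_cong intro!: prod.cong)
  also have "\<dots> = (if j < i then - 1 else 1)"
    by (simp add: prod.delta)
  finally show ?thesis by (auto simp: not_le)
qed

lemma bit_of_int_eq_1: "(of_int k :: bit) = 1 \<longleftrightarrow> odd k"
  by (metis bit_not_one_iff of_int_1 of_int_eq_0_iff even_of_int_iff bit_2_eq_0 dvd_0_left odd_one dvd_0_right)

lemma cocyc2_red2: "cocyc2 (red2 \<alpha>) (red2 \<beta>) = cocyc \<alpha> \<beta>"
  unfolding cocyc2_def cocyc_def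
  by (intro prod.cong refl) (auto simp: minus_one_powi lift2_def red2_def bit_of_int_eq_1)

lemma red2_add: "red2 (\<alpha> + \<beta>) = red2 \<alpha> + red2 \<beta>"
  by (simp add: red2_def vec_eq_iff del: add_bit_eq_xor)

lemma red2_lift2: "red2 (lift2 a) = a"
  by (simp add: red2_def lift2_def vec_eq_iff)

lemma red2_eq_0_iff: "red2 \<alpha> = 0 \<longleftrightarrow> (\<exists>\<beta>. \<alpha> = \<beta> + \<beta>)"
proof
  assume "red2 \<alpha> = 0"
  then have "even (\<alpha> $ i)" for i
    using bit_of_int_eq_1[of "\<alpha> $ i"] by (auto simp: red2_def vec_eq_iff)
  then have "\<alpha> = (\<chi> i. \<alpha> $ i div 2) + (\<chi> i. \<alpha> $ i div 2)"
    by (simp add: vec_eq_iff)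
  then show "\<exists>\<beta>. \<alpha> = \<beta> + \<beta>" by blast
qed (auto simp: red2_def vec_eq_iff)

lemma sym_deriv_add: "sym_deriv x (p + q) = sym_deriv x p + sym_deriv x q"
  unfolding sym_deriv_def by (rule lin_ext_add) (auto simp: algebra_simps single_add)

lemma sym_deriv_single:
  "sym_deriv x (Poly_Mapping.single u c) =
    Poly_Mapping.single (u - Poly_Mapping.single x 1) (of_nat (Poly_Mapping.lookup u x) * c)"
  unfolding sym_deriv_def by (rule lin_ext_single) simp

lemma sym_deriv_var: "sym_deriv x (sym_var y) = of_bool (x = y)"
  by (auto simp: sym_deriv_single lookup_single when_def)

lemma sym_deriv_scale: "sym_deriv x (pm_scale c p) = pm_scale c (sym_deriv x p)"
proof -
  have scale0: "pm_scale c 0 = 0" for c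
    by (rule poly_mapping_eqI) simp
  have scale_single: "pm_scale c (Poly_Mapping.single k d) = Poly_Mapping.single k (c * d)" for c k d
    by (rule poly_mapping_eqI) (simp add: lookup_single when_def)
  have scale_add: "pm_scale c (f + g) = pm_scale c f + pm_scale c g" for c f g
    by (rule poly_mapping_eqI) (simp add: lookup_add distrib_left)
  show ?thesis
    by (induction p rule: poly_mapping_add_induct)
      (simp_all add: sym_deriv_add sym_deriv_single scale0 scale_single scale_add
        sym_deriv_def[of _ 0] algebra_simps)
qed

lemma monom_minus_var:
  fixes u v :: "'a \<Rightarrow>\<^sub>0 nat"
  assumes "Poly_Mapping.lookup u x \<noteq> 0"
  shows "u - Poly_Mapping.single x 1 + v = u + v - Poly_Mapping.single x 1"
  using assms
  by (intro poly_mapping_eqI) (auto simp: lookup_add lookup_minus lookup_single when_def)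

lemma sym_deriv_mult: "sym_deriv x (p * q) = sym_deriv x p * q + p * sym_deriv x q"
proof (induction p rule: poly_mapping_add_induct)
  case (single u c)
  show ?case
  proof (induction q rule: poly_mapping_add_induct)
    case (single v d)
    show ?case
    proof (cases "Poly_Mapping.lookup u x = 0"; cases "Poly_Mapping.lookup v x = 0")
    qed (use monom_minus_var[of u x v] monom_minus_var[of v x u] in
      \<open>simp_all add: mult_single sym_deriv_single lookup_add algebra_simps flip: single_add\<close>)
  qed (simp_all add: sym_deriv_add distrib_left sym_deriv_def[of _ 0])
qed (simp_all add: sym_deriv_add distrib_right sym_deriv_def[of _ 0])


lemma rcocycle_add_left: "rcocycle \<sigma> (f + g) h = rcocycle \<sigma> f h + rcocycle \<sigma> g h"
  unfolding rcocycle_def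
  apply (rule lin_ext_add)
   apply (clarsimp intro!: lin_ext_zero_fun)
  apply (clarsimp simp flip: lin_ext_plus_fun)
  apply (rule arg_cong[where f = "\<lambda>F. lin_ext F h"])
  apply (auto simp: fun_eq_iff distrib_left distrib_right)
  done

lemma rcocycle_add_right: "rcocycle \<sigma> h (f + g) = rcocycle \<sigma> h f + rcocycle \<sigma> h g"
proof -
  have *: "lin_ext (\<lambda>(n, \<beta>) d. c * d * F n \<beta>) (f + g) =
      lin_ext (\<lambda>(n, \<beta>) d. c * d * F n \<beta>) f + lin_ext (\<lambda>(n, \<beta>) d. c * d * F n \<beta>) g"
    for c :: complex and F
    by (rule lin_ext_add) (auto simp: distrib_left distrib_right)
  show ?thesis
    unfolding rcocycle_def * by (simp add: lin_ext_def sum.distrib split_def)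
qed

lemma rcocycle_zero [simp]: "rcocycle \<sigma> 0 h = 0" "rcocycle \<sigma> h 0 = 0"
  by (simp_all add: rcocycle_def lin_ext_zero_fun split_def)

lemma rcocycle_single:
  "rcocycle \<sigma> (Poly_Mapping.single (m, \<alpha>) c) (Poly_Mapping.single (n, \<beta>) d) =
   c * d * (of_int m * of_bool (m + n = 0) * of_bool (\<sigma> \<alpha> * \<sigma> \<beta> = 1) * \<sigma> \<alpha> powi n)"
  unfolding rcocycle_def by (subst lin_ext_single; simp add: lin_ext_single lin_ext_zero_fun split_def)+

lemma rcocycle_swap:
  assumes "is_character \<sigma>"
  shows "rcocycle \<sigma> g f = - rcocycle \<sigma> f g"
proof (induction f rule: poly_mapping_add_induct)
  case (single k c)
  show ?case
  proof (induction g rule: poly_mapping_add_induct)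
    case (single l d)
    obtain m \<alpha> n \<beta> where kl: "k = (m, \<alpha>)" "l = (n, \<beta>)"
      by (cases k, cases l)
    show ?case
    proof (cases "m + n = 0 \<and> \<sigma> \<alpha> * \<sigma> \<beta> = 1")
      case True
      then have "n = - m" "\<sigma> \<beta> = inverse (\<sigma> \<alpha>)"
        using is_character_props(1)[OF assms, of \<alpha>] by (auto simp: field_simps)
      then show ?thesis
        using kl is_character_props(1)[OF assms, of \<alpha>]
        by (simp add: rcocycle_single power_int_inverse power_int_minus)
    qed (auto simp: kl rcocycle_single add.commute mult.commute)
  qed (simp_all add: rcocycle_add_left rcocycle_add_right)
qed (simp_all add: rcocycle_add_left rcocycle_add_right)

lemma rcocycle_cyclic:
  assumes "is_character \<sigma>"
  shows "rcocycle \<sigma> (rmult \<sigma> f g) h + rcocycle \<sigma> (rmult \<sigma> g h) f + rcocycle \<sigma> (rmult \<sigma> h f) g = 0"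
proof -
  have add0: "a + a' + (b + b') + (c + c') = 0" if "a + b + c = 0" "a' + b' + c' = 0"
    for a b c a' b' c' :: complex
    using that by algebra
  show ?thesis
proof (induction f rule: poly_mapping_add_induct)
  case (single k c)
  show ?case
  proof (induction g rule: poly_mapping_add_induct)
    case (single l d)
    show ?case
    proof (induction h rule: poly_mapping_add_induct)
      case (single p e)
      obtain m \<alpha> n \<beta> r \<gamma> where klp: "k = (m, \<alpha>)" "l = (n, \<beta>)" "p = (r, \<gamma>)"
        by (cases k, cases l, cases p)
      show ?case
      proof (cases "m + n + r = 0 \<and> \<sigma> \<alpha> * \<sigma> \<beta> * \<sigma> \<gamma> = 1")
        case True
        note nz = is_character_props(1)[OF assms, of \<alpha>] is_character_props(1)[OF assms, of \<beta>]
        have g: "\<sigma> \<gamma> = inverse (\<sigma> \<alpha> * \<sigma> \<beta>)" and r: "m = - n - r"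
          using True nz by (auto simp: field_simps)
        have z: "c' * X + c' * Y + c' * Z = 0" if "X + Y + Z = 0" for c' X Y Z :: complex
          using that by (metis distrib_left mult_zero_right)
        show ?thesis
          using nz
          by (simp add: klp rmult_single rcocycle_single is_character_props(2)[OF assms] g r
              power_int_add power_int_diff power_int_minus power_int_mult_distrib power_int_inverse)
            (simp add: field_simps)
      next
        case False
        then show ?thesis
          by (auto simp: klp rmult_single rcocycle_single is_character_props(2)[OF assms] ac_simps)
      qed
    qed (simp_all add: rmult_add_left rmult_add_right rcocycle_add_left rcocycle_add_right add0)
  qed (simp_all add: rmult_add_left rmult_add_right rcocycle_add_left rcocycle_add_right add0)
qed (simp_all add: rmult_add_left rmult_add_right rcocycle_add_left rcocycle_add_right add0)

qed

lemma pm_scale_zero [simp]: "pm_scale c 0 = 0" "pm_scale 0 f = 0"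
  by (rule poly_mapping_eqI; simp)+

lemma pm_scale_one [simp]: "pm_scale 1 f = f"
  by (rule poly_mapping_eqI) simp

lemma pm_scale_scale [simp]: "pm_scale c (pm_scale d f) = pm_scale (c * d) f"
  by (rule poly_mapping_eqI) simp

lemma pm_scale_single [simp]: "pm_scale c (Poly_Mapping.single k d) = Poly_Mapping.single k (c * d)"
  by (rule poly_mapping_eqI) (simp add: lookup_single when_def)

lemma pm_scale_add: "pm_scale c (f + g) = pm_scale c f + pm_scale c g"
  by (rule poly_mapping_eqI) (simp add: lookup_add distrib_left)

lemma pm_scale_add_left: "pm_scale (c + d) f = pm_scale c f + pm_scale d f"
  by (rule poly_mapping_eqI) (simp add: lookup_add distrib_right)

lemma pm_scale_uminus: "pm_scale c (- f) = - pm_scale c f"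
  by (rule poly_mapping_eqI) simp

lemma pm_scale_diff: "pm_scale c (f - g) = pm_scale c f - pm_scale c g"
  by (rule poly_mapping_eqI) (simp add: lookup_minus right_diff_distrib)

lemma pm_scale_sum: "pm_scale c (sum f A) = (\<Sum>i\<in>A. pm_scale c (f i))"
  by (induction A rule: infinite_finite_induct) (simp_all add: pm_scale_add)

lemma rmult_scale:
  "rmult \<sigma> (pm_scale c f) g = pm_scale c (rmult \<sigma> f g)"
  "rmult \<sigma> f (pm_scale c g) = pm_scale c (rmult \<sigma> f g)"
proof -
  have *: "rmult \<sigma> (pm_scale c f) g = pm_scale c (rmult \<sigma> f g) \<and>
    rmult \<sigma> f (pm_scale c g) = pm_scale c (rmult \<sigma> f g)"
  proof (induction f rule: poly_mapping_add_induct)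
    case (single k a)
    show ?case
    proof (induction g rule: poly_mapping_add_induct)
      case (single l b)
      then show ?case by (cases k; cases l) (simp add: rmult_single mult_ac)
    qed (simp_all add: rmult_add_right pm_scale_add)
  qed (simp_all add: rmult_add_left pm_scale_add)
  then show "rmult \<sigma> (pm_scale c f) g = pm_scale c (rmult \<sigma> f g)"
    "rmult \<sigma> f (pm_scale c g) = pm_scale c (rmult \<sigma> f g)" by auto
qed

lemma rcocycle_scale:
  "rcocycle \<sigma> (pm_scale c f) g = c * rcocycle \<sigma> f g"
  "rcocycle \<sigma> f (pm_scale c g) = c * rcocycle \<sigma> f g"
proof -
  have *: "rcocycle \<sigma> (pm_scale c f) g = c * rcocycle \<sigma> f g \<and>
    rcocycle \<sigma> f (pm_scale c g) = c * rcocycle \<sigma> f g"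
  proof (induction f rule: poly_mapping_add_induct)
    case (single k a)
    show ?case
    proof (induction g rule: poly_mapping_add_induct)
      case (single l b)
      then show ?case by (cases k; cases l) (simp add: rcocycle_single)
    qed (simp_all add: rcocycle_add_right distrib_left pm_scale_add)
  qed (simp_all add: rcocycle_add_left distrib_left pm_scale_add)
  then show "rcocycle \<sigma> (pm_scale c f) g = c * rcocycle \<sigma> f g"
    "rcocycle \<sigma> f (pm_scale c g) = c * rcocycle \<sigma> f g" by auto
qed

lemma rbar_scale: "rbar \<sigma> (pm_scale c f) = pm_scale c (rbar \<sigma> f)"
proof (induction f rule: poly_mapping_add_induct)
  case (single k a)
  then show ?case by (cases k) (simp add: rbar_single mult.assoc)
qed (simp_all add: rbar_add pm_scale_add)

lemma rmult_uminus: "rmult \<sigma> (- f) g = - rmult \<sigma> f g" "rmult \<sigma> f (- g) = - rmult \<sigma> f g"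
  using rmult_add_left[of \<sigma> f "- f" g] rmult_add_right[of \<sigma> f g "- g"]
  by (simp_all add: eq_neg_iff_add_eq_0 add.commute)

lemma rbar_uminus: "rbar \<sigma> (- f) = - rbar \<sigma> f"
  using rbar_add[of \<sigma> f "- f"] by (simp add: eq_neg_iff_add_eq_0 add.commute)

lemma rbar_diff: "rbar \<sigma> (f - g) = rbar \<sigma> f - rbar \<sigma> g"
  unfolding diff_conv_add_uminus rbar_add rbar_uminus by simp

lemma rcocycle_uminus: "rcocycle \<sigma> (- f) g = - rcocycle \<sigma> f g" "rcocycle \<sigma> f (- g) = - rcocycle \<sigma> f g"
  using rcocycle_add_left[of \<sigma> f "- f" g] rcocycle_add_right[of \<sigma> f g "- g"]
  by (simp_all add: eq_neg_iff_add_eq_0 add.commute)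

lemma rmult_sum:
  "rmult \<sigma> (sum f A) g = (\<Sum>i\<in>A. rmult \<sigma> (f i) g)"
  "rmult \<sigma> g (sum f A) = (\<Sum>i\<in>A. rmult \<sigma> g (f i))"
  by (induction A rule: infinite_finite_induct) (simp_all add: rmult_add_left rmult_add_right)

lemma rbar_sum: "rbar \<sigma> (sum f A) = (\<Sum>i\<in>A. rbar \<sigma> (f i))"
  by (induction A rule: infinite_finite_induct) (simp_all add: rbar_add)

lemma rcocycle_sum: "rcocycle \<sigma> (sum f A) g = (\<Sum>i\<in>A. rcocycle \<sigma> (f i) g)"
  by (induction A rule: infinite_finite_induct) (simp_all add: rcocycle_add_left)

definition mat_scale :: "complex \<Rightarrow> ('g, 'n::finite) rmat \<Rightarrow> ('g, 'n) rmat" where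
  "mat_scale c X = (\<chi> i j. pm_scale c (X $ i $ j))"

lemma gl_scale_eq: "gl_scale c x = (mat_scale c (fst x), c * snd x)"
  by (simp add: gl_scale_def mat_scale_def)

lemma mat_mult_add:
  "mat_mult \<sigma> (X + Y) Z = mat_mult \<sigma> X Z + mat_mult \<sigma> Y Z"
  "mat_mult \<sigma> Z (X + Y) = mat_mult \<sigma> Z X + mat_mult \<sigma> Z Y"
  by (simp_all add: mat_mult_def vec_eq_iff rmult_add_left rmult_add_right sum.distrib)

lemma mat_mult_uminus:
  "mat_mult \<sigma> (- X) Y = - mat_mult \<sigma> X Y" "mat_mult \<sigma> X (- Y) = - mat_mult \<sigma> X Y"
  by (simp_all add: mat_mult_def vec_eq_iff rmult_uminus sum_negf)

lemma mat_mult_diff: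
  "mat_mult \<sigma> (X - Y) Z = mat_mult \<sigma> X Z - mat_mult \<sigma> Y Z"
  "mat_mult \<sigma> Z (X - Y) = mat_mult \<sigma> Z X - mat_mult \<sigma> Z Y"
  unfolding diff_conv_add_uminus mat_mult_add mat_mult_uminus by simp_all

lemma mat_mult_scale:
  "mat_mult \<sigma> (mat_scale c X) Y = mat_scale c (mat_mult \<sigma> X Y)"
  "mat_mult \<sigma> X (mat_scale c Y) = mat_scale c (mat_mult \<sigma> X Y)"
  by (simp_all add: mat_mult_def mat_scale_def vec_eq_iff rmult_scale pm_scale_sum)

lemma mat_mult_assoc:
  assumes "is_character \<sigma>"
  shows "mat_mult \<sigma> (mat_mult \<sigma> X Y) Z = mat_mult \<sigma> X (mat_mult \<sigma> Y Z)"
  apply (simp add: mat_mult_def vec_eq_iff rmult_sum rmult_assoc[OF assms])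
  apply (intro allI)
  apply (rule sum.swap)
  done

lemma mat_star_mult:
  assumes "is_character \<sigma>"
  shows "mat_star \<sigma> (mat_mult \<sigma> X Y) = mat_mult \<sigma> (mat_star \<sigma> Y) (mat_star \<sigma> X)"
  by (simp add: mat_star_def mat_mult_def vec_eq_iff rbar_sum rbar_rmult[OF assms])

lemma mat_star_simps:
  "mat_star \<sigma> (X + Y) = mat_star \<sigma> X + mat_star \<sigma> Y"
  "mat_star \<sigma> (- X) = - mat_star \<sigma> X"
  "mat_star \<sigma> (X - Y) = mat_star \<sigma> X - mat_star \<sigma> Y"
  "mat_star \<sigma> (mat_scale c X) = mat_scale c (mat_star \<sigma> X)"
  "mat_star \<sigma> 0 = 0"
  by (simp_all add: mat_star_def mat_scale_def vec_eq_iff rbar_add rbar_uminus rbar_diff rbar_scale)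

lemma gl_cocycle_add:
  "gl_cocycle \<sigma> (X + Y) Z = gl_cocycle \<sigma> X Z + gl_cocycle \<sigma> Y Z"
  "gl_cocycle \<sigma> Z (X + Y) = gl_cocycle \<sigma> Z X + gl_cocycle \<sigma> Z Y"
  by (simp_all add: gl_cocycle_def rcocycle_add_left rcocycle_add_right sum.distrib)

lemma gl_cocycle_uminus:
  "gl_cocycle \<sigma> (- X) Y = - gl_cocycle \<sigma> X Y" "gl_cocycle \<sigma> X (- Y) = - gl_cocycle \<sigma> X Y"
  by (simp_all add: gl_cocycle_def rcocycle_uminus sum_negf)

lemma gl_cocycle_diff:
  "gl_cocycle \<sigma> (X - Y) Z = gl_cocycle \<sigma> X Z - gl_cocycle \<sigma> Y Z"
  "gl_cocycle \<sigma> Z (X - Y) = gl_cocycle \<sigma> Z X - gl_cocycle \<sigma> Z Y"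
  unfolding diff_conv_add_uminus gl_cocycle_add gl_cocycle_uminus by simp_all

lemma gl_cocycle_scale:
  "gl_cocycle \<sigma> (mat_scale c X) Y = c * gl_cocycle \<sigma> X Y"
  "gl_cocycle \<sigma> X (mat_scale c Y) = c * gl_cocycle \<sigma> X Y"
  by (simp_all add: gl_cocycle_def mat_scale_def rcocycle_scale sum_distrib_left)

lemma gl_cocycle_swap:
  assumes "is_character \<sigma>"
  shows "gl_cocycle \<sigma> Y X = - gl_cocycle \<sigma> X Y"
proof -
  have "gl_cocycle \<sigma> Y X = (\<Sum>i\<in>UNIV. \<Sum>j\<in>UNIV. - rcocycle \<sigma> (X $ j $ i) (Y $ i $ j))"
    unfolding gl_cocycle_def
    by (intro sum.cong refl) (rule rcocycle_swap[OF assms])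
  also have "\<dots> = - gl_cocycle \<sigma> X Y"
    unfolding gl_cocycle_def by (subst sum.swap) (simp add: sum_negf)
  finally show ?thesis .
qed

lemma gl_cocycle_cyclic:
  fixes X Y Z :: "('g::ab_group_add, 'n::finite) rmat"
  assumes "is_character \<sigma>"
  shows "gl_cocycle \<sigma> (mat_mult \<sigma> X Y) Z + gl_cocycle \<sigma> (mat_mult \<sigma> Y Z) X +
    gl_cocycle \<sigma> (mat_mult \<sigma> Z X) Y = 0"
proof -
  define T where "T = (\<lambda>(X :: ('g, 'n) rmat) (Y :: ('g, 'n) rmat) (Z :: ('g, 'n) rmat) (i :: 'n) (k :: 'n) (j :: 'n).
    rcocycle \<sigma> (rmult \<sigma> (X $ i $ k) (Y $ k $ j)) (Z $ j $ i))"
  have *: "gl_cocycle \<sigma> (mat_mult \<sigma> X Y) Z = (\<Sum>i\<in>UNIV. \<Sum>k\<in>UNIV. \<Sum>j\<in>UNIV. T X Y Z i k j)"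
    for X Y Z :: "('g, 'n) rmat"
    unfolding gl_cocycle_def mat_mult_def T_def
    by (simp add: rcocycle_sum) (intro sum.cong refl sum.swap)
  have 2: "gl_cocycle \<sigma> (mat_mult \<sigma> Y Z) X = (\<Sum>i\<in>UNIV. \<Sum>k\<in>UNIV. \<Sum>j\<in>UNIV. T Y Z X k j i)"
    unfolding * by (subst (2) sum.swap, subst sum.swap) (rule refl)
  have 3: "gl_cocycle \<sigma> (mat_mult \<sigma> Z X) Y = (\<Sum>i\<in>UNIV. \<Sum>k\<in>UNIV. \<Sum>j\<in>UNIV. T Z X Y j i k)"
    unfolding * by (subst sum.swap, subst (2) sum.swap) (rule refl)
  have "T X Y Z i k j + T Y Z X k j i + T Z X Y j i k = 0" for i k j
    unfolding T_def by (rule rcocycle_cyclic[OF assms])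
  then show ?thesis
    unfolding *[of X Y Z] 2 3 by (simp flip: sum.distrib)
qed

lemma vector_space_gl_scale: "vector_space gl_scale"
  by unfold_locales (auto simp: gl_scale_def vec_eq_iff pm_scale_add pm_scale_add_left algebra_simps)

lemma vector_space_fock_scale: "vector_space (fock_scale :: complex \<Rightarrow> 'n::finite fock \<Rightarrow> 'n fock)"
proof -
  have "fock_scale (a * b) x = fock_scale a (fock_scale b x)"
    "fock_scale (a + b) x = fock_scale a x + fock_scale b x"
    "fock_scale a (x + y) = fock_scale a x + fock_scale a y"
    "fock_scale 1 x = x" for a b :: complex and x y :: "'n fock"
    by (rule poly_mapping_eqI; simp add: lookup_add pm_scale_add pm_scale_add_left)+
  then show ?thesis by unfold_locales simp_all
qed

lemma lie_algebra_unitary_hat: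
  fixes \<sigma> :: "'g::ab_group_add \<Rightarrow> complex"
  assumes "is_character \<sigma>"
  shows "lie_algebra gl_scale (unitary_hat \<sigma> :: ('g, 'n::finite) glhat set) (gl_bracket \<sigma>)"
proof -
  interpret vector_space "gl_scale :: complex \<Rightarrow> ('g, 'n) glhat \<Rightarrow> ('g, 'n) glhat"
    by (rule vector_space_gl_scale)
  note star = mat_star_simps mat_star_mult[OF assms] mat_mult_uminus
  have scale_simps: "mat_scale c (X - Y) = mat_scale c X - mat_scale c Y"
    "mat_scale c (- X) = - mat_scale c X" for c and X Y :: "('g, 'n) rmat"
    by (simp_all add: mat_scale_def vec_eq_iff pm_scale_diff pm_scale_uminus)
  have self: "gl_cocycle \<sigma> X X = 0" for X :: "('g, 'n) rmat"
    using gl_cocycle_swap[OF assms, of X X] by simp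
  show ?thesis
  proof
    show "subspace (unitary_hat \<sigma> :: ('g, 'n) glhat set)"
      by (auto simp: subspace_def unitary_hat_def unitary_mats_def gl_scale_eq zero_prod_def
          star scale_simps)
    fix x y z :: "('g, 'n) glhat" and c
    show "gl_bracket \<sigma> x y \<in> unitary_hat \<sigma>" if "x \<in> unitary_hat \<sigma>" "y \<in> unitary_hat \<sigma>"
      using that by (auto simp: unitary_hat_def unitary_mats_def gl_bracket_def star)
    show "gl_bracket \<sigma> (x + y) z = gl_bracket \<sigma> x z + gl_bracket \<sigma> y z"
      "gl_bracket \<sigma> z (x + y) = gl_bracket \<sigma> z x + gl_bracket \<sigma> z y"
      by (simp_all add: gl_bracket_def mat_mult_add gl_cocycle_add)
    show "gl_bracket \<sigma> (gl_scale c x) y = gl_scale c (gl_bracket \<sigma> x y)"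
      "gl_bracket \<sigma> x (gl_scale c y) = gl_scale c (gl_bracket \<sigma> x y)"
      by (simp_all add: gl_bracket_def gl_scale_eq mat_mult_scale gl_cocycle_scale scale_simps)
    show "gl_bracket \<sigma> x x = 0"
      by (simp add: gl_bracket_def self zero_prod_def)
    have "gl_cocycle \<sigma> (mat_mult \<sigma> (fst x) (fst y) - mat_mult \<sigma> (fst y) (fst x)) (fst z) +
        gl_cocycle \<sigma> (mat_mult \<sigma> (fst y) (fst z) - mat_mult \<sigma> (fst z) (fst y)) (fst x) +
        gl_cocycle \<sigma> (mat_mult \<sigma> (fst z) (fst x) - mat_mult \<sigma> (fst x) (fst z)) (fst y) = 0"
      using gl_cocycle_cyclic[OF assms, of "fst x" "fst y" "fst z"]
        gl_cocycle_cyclic[OF assms, of "fst y" "fst x" "fst z"]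
      by (simp add: gl_cocycle_diff) algebra
    then show "gl_bracket \<sigma> (gl_bracket \<sigma> x y) z + gl_bracket \<sigma> (gl_bracket \<sigma> y z) x +
        gl_bracket \<sigma> (gl_bracket \<sigma> z x) y = 0"
      by (simp add: gl_bracket_def mat_mult_diff mat_mult_assoc[OF assms] zero_prod_def)
  qed
qed

lemma gl_bracket_basis:
  fixes i j k l :: "'n::finite"
  assumes "is_character \<sigma>"
  shows "gl_bracket \<sigma> (mat_unit i j (rmon m \<alpha>), 0) (mat_unit k l (rmon n \<beta>), 0) =
      gl_scale (of_bool (j = k) * \<sigma> \<alpha> powi n) (mat_unit i l (rmon (m + n) (\<alpha> + \<beta>)), 0)
    - gl_scale (of_bool (i = l) * \<sigma> \<beta> powi m) (mat_unit k j (rmon (m + n) (\<alpha> + \<beta>)), 0)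
    + gl_scale (of_int m * of_bool (i = l) * of_bool (j = k) * of_bool (m + n = 0) *
        of_bool (\<sigma> \<alpha> * \<sigma> \<beta> = 1) * \<sigma> \<alpha> powi n) gl_central"
proof -
  have mult: "mat_mult \<sigma> (mat_unit i j f) (mat_unit k l g) =
      (if j = k then mat_unit i l (rmult \<sigma> f g) else 0)" for i j k l :: 'n and f g
  proof -
    have "(\<Sum>p\<in>UNIV. rmult \<sigma> (if a = i \<and> p = j then f else 0) (if p = k \<and> b = l then g else 0)) =
       (\<Sum>p\<in>UNIV. if p = j then (if a = i \<and> j = k \<and> b = l then rmult \<sigma> f g else 0) else 0)" for a b
      by (intro sum.cong) auto
    then show ?thesis
      by (auto simp: mat_mult_def mat_unit_def vec_eq_iff)
  qed
  have "gl_cocycle \<sigma> (mat_unit i j f) (mat_unit k l g) =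
      (\<Sum>a\<in>UNIV. \<Sum>b\<in>UNIV. if b = j then (if a = i \<and> i = l \<and> j = k then rcocycle \<sigma> f g else 0) else 0)" for f g
    unfolding gl_cocycle_def by (intro sum.cong) (auto simp: mat_unit_def)
  then have coc: "gl_cocycle \<sigma> (mat_unit i j f) (mat_unit k l g) =
      (if i = l \<and> j = k then rcocycle \<sigma> f g else 0)" for f g
    by (cases "i = l \<and> j = k") auto
  show ?thesis
    unfolding gl_bracket_def fst_conv mult coc rmult_single rcocycle_single
    by (auto simp: gl_scale_def gl_central_def vec_eq_iff mat_unit_def add.commute)
qed

lemma unitary_e_in:
  fixes i j :: "'n::finite"
  assumes "is_character \<sigma>"
  shows "unitary_e \<sigma> i j m \<alpha> \<in> unitary_hat \<sigma>"
proof -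
  have "mat_star \<sigma> (mat_unit i j f) = mat_unit j i (rbar \<sigma> f)" for i j :: 'n and f
    by (simp add: mat_star_def mat_unit_def vec_eq_iff)
  then show ?thesis
    by (simp add: unitary_hat_def unitary_mats_def unitary_e_def mat_star_simps rbar_rbar[OF assms])
qed


lemma heis_sym_commute:
  assumes "odd m" "odd n"
  shows "heis_sym i m (heis_sym j n p) - heis_sym j n (heis_sym i m p) =
    pm_scale (of_int m / 2 * of_bool (i = j \<and> m + n = 0)) p"
proof -
  have swap: "sym_deriv x (sym_deriv y p) = sym_deriv y (sym_deriv x p)" for x y and p :: "'a symalg"
  proof (cases "x = y")
    case False
    show ?thesis
    proof (induction p rule: poly_mapping_add_induct)
      case (single u c)
      have "u - Poly_Mapping.single y 1 - Poly_Mapping.single x 1 =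
        u - Poly_Mapping.single x 1 - Poly_Mapping.single y 1"
        by (rule poly_mapping_eqI) (simp add: lookup_minus)
      with False show ?case
        by (simp add: sym_deriv_single lookup_minus lookup_single mult_ac)
    qed (simp_all add: sym_deriv_add sym_deriv_def[of _ 0])
  qed simp
  have mult_scale: "pm_scale c (p * q) = p * pm_scale c q" for c and p q :: "'a symalg"
  proof -
    have *: "pm_scale c q = Poly_Mapping.single 0 c * q" for q :: "'a symalg"
      by (induction q rule: poly_mapping_add_induct) (simp_all add: pm_scale_add distrib_left mult_single)
    show ?thesis by (simp add: * mult_ac)
  qed
  have pos_neg: "heis_sym i m (heis_sym j n p) - heis_sym j n (heis_sym i m p) =
      pm_scale (of_int m / 2 * of_bool (i = j \<and> m + n = 0)) p"
    if "\<not> m < 0" "n < 0" "odd m" "odd n" for i j :: 'a and m n :: int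
  proof -
    let ?x = "(i, nat ((m - 1) div 2))" and ?y = "(j, nat ((- n - 1) div 2))"
    have "?x = ?y \<longleftrightarrow> i = j \<and> m + n = 0"
      using that by (auto elim!: oddE)
    then have "sym_deriv ?x (sym_var ?y * p) =
        pm_scale (of_bool (i = j \<and> m + n = 0)) p + sym_var ?y * sym_deriv ?x p"
      unfolding sym_deriv_mult sym_deriv_var by auto
    then show ?thesis
      using that by (simp add: heis_sym_def pm_scale_add mult_scale)
  qed
  show ?thesis
  proof (cases "m < 0"; cases "n < 0")
    assume "m < 0" "n < 0"
    then show ?thesis by (simp add: heis_sym_def mult_ac)
  next
    assume "\<not> m < 0" "\<not> n < 0"
    moreover from this have "m + n \<noteq> 0" using assms by (cases "m = 0") auto
    ultimately show ?thesis
      by (simp add: heis_sym_def sym_deriv_scale swap[of _ "(j, _)"] mult_ac)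
  next
    assume "\<not> m < 0" "n < 0"
    then show ?thesis using assms by (rule pos_neg)
  next
    assume "m < 0" "\<not> n < 0"
    then have "heis_sym j n (heis_sym i m p) - heis_sym i m (heis_sym j n p) =
      pm_scale (of_int n / 2 * of_bool (j = i \<and> n + m = 0)) p"
      using assms by (intro pos_neg)
    moreover have "of_int n / 2 * of_bool (j = i \<and> n + m = 0) =
        - (of_int m / 2 * of_bool (i = j \<and> m + n = 0) :: complex)"
      by (auto simp: add_eq_0_iff)
    moreover have "pm_scale (- c) p = - pm_scale c p" for c
      by (rule poly_mapping_eqI) simp
    ultimately show ?thesis by (metis minus_diff_eq minus_minus)
  qed
qed

end

theory Submission
  imports Defs
begin

text \<open>
  The idea is to factor the operators through fermions. Put
  \<open>\<psi>\<^sub>i(z) = e\<^bsup>\<epsilon>\<^sub>i\<^esup> E\<^sub>-(\<epsilon>\<^sub>i, z) E\<^sub>+(\<epsilon>\<^sub>i, z)\<close>. Only odd modes occur in the exponents, so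
  \<open>E\<^sub>\<plusminus>(- \<epsilon>\<^sub>j, a z) = E\<^sub>\<plusminus>(\<epsilon>\<^sub>j, - a z)\<close>, and \<open>X\<^sub>i\<^sub>j(a, z) = \<psi>\<^sub>i(z) \<psi>\<^sub>j(- a z)\<close> for \<open>i \<noteq> j\<close>. From
  \<open>E\<^sub>+(\<epsilon>\<^sub>i, z) E\<^sub>-(\<epsilon>\<^sub>i, w) = ((1 - w/z) / (1 + w/z)) E\<^sub>-(\<epsilon>\<^sub>i, w) E\<^sub>+(\<epsilon>\<^sub>i, z)\<close> (lemma \<open>A_B_ope\<close>) it follows that
  the modes of the \<open>\<psi>\<^sub>i\<close> are neutral fermions,
  \<open>\<psi>\<^sub>i(p) \<psi>\<^sub>j(q) + \<psi>\<^sub>j(q) \<psi>\<^sub>i(p) = 2 \<delta>\<^sub>i\<^sub>j (-1)\<^sup>q \<delta>\<^bsub>p+q,0\<^esub>\<close>: for \<open>i = j\<close> the expansions of the rational factor in the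
  two directions differ by a delta function supported at \<open>w = - z\<close>, where the normally ordered product
  is the identity; for \<open>i \<noteq> j\<close> the sign comes from the cocycle \<open>\<epsilon>\<close>.

  For all \<open>i\<close>, \<open>j\<close> and \<open>a \<noteq> 0\<close> the operator \<open>x\<^sub>i\<^sub>j(a, m)\<close> is the normally ordered quadratic expression
  \<open>\<Sum>\<^sub>k (- a)\<^sup>-\<^sup>k :\<psi>\<^sub>i(m - k) \<psi>\<^sub>j(k):\<close> (lemma \<open>x_op_eq_quad\<close>). For \<open>i = j\<close> and \<open>a = 1\<close> this says that the Heisenberg
  operator \<open>4 \<epsilon>\<^sub>i(m)\<close> is quadratic in the fermions; for \<open>i = j\<close> and \<open>a \<noteq> 1\<close> the factor \<open>(1 + a) / (1 - a)\<close> and the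
  subtraction of the identity in \<open>X\<^sub>i\<^sub>i(a, z)\<close> come out of the summation of a geometric series.

  Quadratic expressions in fermions are closed under commutators. With \<open>a = \<sigma>(\<alpha>)\<close>, the commutator of
  \<open>x\<^sub>i\<^sub>j(a, m)\<close> with \<open>\<psi>\<^sub>k(n)\<close> is, up to a factor, the action of the unitary matrix \<open>e\<^sub>i\<^sub>j(m, \<alpha>)\<close> on the vector \<open>t\<^sup>n\<close> in position \<open>k\<close>
  (lemma \<open>quad_psi\<close>), and this gives the linear part of all brackets (lemma \<open>quad_commutator\<close>).
  The scalar part arises when the result is normally ordered again; with \<open>b = \<sigma>(\<beta>)\<close>, and
  \<open>x = a b\<close> in one half of the terms and \<open>x = a / b\<close> in the other, it is a multiple of
  \<open>\<Sum>\<^sub>q x\<^sup>-\<^sup>q (sgn(q + m) - sgn q)\<close>, which equals \<open>(1 - x\<^sup>m) (1 + x) / (1 - x)\<close> if \<open>x \<noteq> 1\<close> and \<open>2 m\<close> if \<open>x = 1\<close>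
  (lemma \<open>sgn_sum_closed\<close>). In the first case this is what the scalars added to the \<open>x\<^sub>i\<^sub>i(a, 0)\<close> contribute,
  and in the second case it is the value of the cocycle with \<open>c = 1/2\<close>. This explains both the scalars in the action
  and the condition \<open>\<sigma>(\<alpha>) \<sigma>(\<beta>) = 1\<close> in the central extension.

  The skew-symmetry of normally ordered products says that the operators depend on \<open>E\<^sub>i\<^sub>j t\<^sup>m e\<^sup>\<alpha>\<close> only through its
  unitary part \<open>e\<^sub>i\<^sub>j(m, \<alpha>)\<close>. The representation can therefore be defined on all of the general linear algebra by linear
  extension from matrix units; its restriction to the unitary subalgebra has the required values and respects brackets.
\<close>

section \<open>Sums with finite support\<close>

lemma Sum_any_hom:
  fixes f :: "'b \<Rightarrow> 'a::comm_monoid_add" and h :: "'a \<Rightarrow> 'c::comm_monoid_add"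
  assumes "h 0 = 0" "\<And>x y. h (x + y) = h x + h y" "finite {k. f k \<noteq> 0}"
  shows "h (Sum_any f) = Sum_any (\<lambda>k. h (f k))"
proof -
  have "Sum_any (\<lambda>k. h (f k)) = (\<Sum>k\<in>{k. f k \<noteq> 0}. h (f k))"
    using assms by (intro Sum_any.expand_superset) auto
  moreover have "h (sum f S) = (\<Sum>k\<in>S. h (f k))" if "finite S" for S
    using that by induction (auto simp: assms(1,2))
  ultimately show ?thesis
    using assms(3) by (simp add: Sum_any.expand_set[of f])
qed

text \<open>
  Sums of operators are finite on each vector, but the range of summation depends on the vector. Finiteness
  is shown by confining the indices of the nonzero terms to a box.
\<close>

lemma finite_int_box2:
  fixes K :: int
  assumes "\<And>x y. P x y \<Longrightarrow> \<bar>x\<bar> \<le> K \<and> \<bar>y\<bar> \<le> K"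
  shows "finite {(x, y). P x y}"
  by (rule finite_subset[of _ "{-K..K} \<times> {-K..K}"]) (use assms in \<open>auto simp: abs_le_iff, fastforce+\<close>)

lemma finite_int_box3:
  fixes K :: int
  assumes "\<And>x y z. P x y z \<Longrightarrow> \<bar>x\<bar> \<le> K \<and> \<bar>y\<bar> \<le> K \<and> \<bar>z\<bar> \<le> K"
  shows "finite {(x, y, z). P x y z}"
  by (rule finite_subset[of _ "{-K..K} \<times> {-K..K} \<times> {-K..K}"]) (use assms in \<open>auto simp: abs_le_iff, fastforce+\<close>)

lemma finite_int_box:
  fixes K :: int
  assumes "\<And>x. P x \<Longrightarrow> \<bar>x\<bar> \<le> K"
  shows "finite {x. P x}"
  by (rule finite_subset[of _ "{-K..K}"]) (use assms in \<open>auto simp: abs_le_iff, fastforce+\<close>)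

lemma Sum_any_nest2:
  fixes f :: "'a \<Rightarrow> 'b \<Rightarrow> 'v::comm_monoid_add"
  assumes "finite {(x, y). f x y \<noteq> 0}"
  shows "Sum_any (\<lambda>x. Sum_any (\<lambda>y. f x y)) = Sum_any (\<lambda>(x, y). f x y)"
proof (rule Sum_any.cartesian_product)
  show "finite (fst ` {(x, y). f x y \<noteq> 0} \<times> snd ` {(x, y). f x y \<noteq> 0})"
    using assms by simp
qed force

lemma Sum_any_nest3:
  fixes f :: "'a \<Rightarrow> 'b \<Rightarrow> 'c \<Rightarrow> 'v::comm_monoid_add"
  assumes fin: "finite {(x, y, z). f x y z \<noteq> 0}"
  shows "Sum_any (\<lambda>x. Sum_any (\<lambda>y. Sum_any (\<lambda>z. f x y z))) = Sum_any (\<lambda>(x, y, z). f x y z)"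
proof -
  have "finite {z. f x y z \<noteq> 0}" for x y
    by (rule finite_subset[OF _ finite_imageI[OF fin, of "\<lambda>(x, y, z). z"]]) force
  have "{(y, z). f x y z \<noteq> 0} \<subseteq> snd ` {(x, y, z). f x y z \<noteq> 0}" for x
    by force
  then have "finite {(y, z). f x y z \<noteq> 0}" for x
    using fin finite_subset by blast
  then have "Sum_any (\<lambda>x. Sum_any (\<lambda>y. Sum_any (\<lambda>z. f x y z))) = Sum_any (\<lambda>x. Sum_any (\<lambda>p. f x (fst p) (snd p)))"
    by (simp add: Sum_any_nest2 split_def)
  also have "\<dots> = Sum_any (\<lambda>(x, p). f x (fst p) (snd p))"
    by (rule Sum_any_nest2) (use fin in \<open>simp add: split_def\<close>)
  finally show ?thesis by (simp add: split_def)
qed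

lemma Sum_any_bij:
  assumes "\<And>x. g (f x) = x" "\<And>y. f (g y) = y" "\<And>x. F (f x) = G x"
  shows "Sum_any F = Sum_any G"
proof (rule Sum_any.reindex_cong)
  show "bij f" using assms(1,2) by (intro o_bij[of g]) auto
qed (use assms(3) in auto)

lemma Sum_any_shift: "Sum_any (\<lambda>k::int. f (k + c)) = Sum_any f"
  by (rule Sum_any_bij[symmetric, where f = "\<lambda>k. k + c" and g = "\<lambda>k. k - c"]) auto

lemma Sum_any_flip: "Sum_any (\<lambda>k::int. f (c - k)) = Sum_any f"
  by (rule Sum_any_bij[symmetric, where f = "\<lambda>k. c - k" and g = "\<lambda>k. c - k"]) auto

text \<open>
  A bijection of the index pairs that transforms one double sum into another; this covers at once
  interchanging the sums and shifting one index by the other. Only the first double sum has to be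
  confined to a box, because the bijection transports finiteness of the support.
\<close>

lemma Sum_any_reindex2:
  fixes f f' :: "int \<Rightarrow> int \<Rightarrow> 'v::comm_monoid_add"
  assumes box: "\<And>x y. f x y \<noteq> 0 \<Longrightarrow> \<bar>x\<bar> \<le> K \<and> \<bar>y\<bar> \<le> K"
    and inv: "\<And>p. \<psi> (\<phi> p) = p" "\<And>p. \<phi> (\<psi> p) = p"
    and eq: "\<And>x y. f' (fst (\<phi> (x, y))) (snd (\<phi> (x, y))) = f x y"
  shows "Sum_any (\<lambda>x. Sum_any (\<lambda>y. f x y)) = Sum_any (\<lambda>x. Sum_any (\<lambda>y. f' x y))"
proof -
  have fin: "finite {(x, y). f x y \<noteq> 0}"
    using box by (rule finite_int_box2)
  have "{(x, y). f' x y \<noteq> 0} \<subseteq> \<phi> ` {(x, y). f x y \<noteq> 0}"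
  proof safe
    fix x y assume nz: "f' x y \<noteq> 0"
    obtain a b where ab: "\<psi> (x, y) = (a, b)" by (cases "\<psi> (x, y)")
    then have "\<phi> (a, b) = (x, y)" using inv(2)[of "(x, y)"] by simp
    then show "(x, y) \<in> \<phi> ` {(x, y). f x y \<noteq> 0}"
      using eq[of a b] nz by (intro image_eqI[of _ _ "(a, b)"]) auto
  qed
  then have fin': "finite {(x, y). f' x y \<noteq> 0}"
    using fin finite_subset by blast
  show ?thesis
    unfolding Sum_any_nest2[OF fin] Sum_any_nest2[OF fin']
    by (rule Sum_any_bij[symmetric, where f = \<phi> and g = \<psi>]) (use inv eq in \<open>auto simp: split_def\<close>)
qed

lemma Sum_any_distrib2:
  fixes f g :: "int \<Rightarrow> int \<Rightarrow> 'v::comm_monoid_add"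
  assumes "\<And>x y. f x y \<noteq> 0 \<Longrightarrow> \<bar>x\<bar> \<le> K \<and> \<bar>y\<bar> \<le> K" "\<And>x y. g x y \<noteq> 0 \<Longrightarrow> \<bar>x\<bar> \<le> L \<and> \<bar>y\<bar> \<le> L"
  shows "Sum_any (\<lambda>x. Sum_any (\<lambda>y. f x y + g x y)) =
    Sum_any (\<lambda>x. Sum_any (\<lambda>y. f x y)) + Sum_any (\<lambda>x. Sum_any (\<lambda>y. g x y))"
proof -
  have fin: "finite {(x, y). f x y \<noteq> 0}" "finite {(x, y). g x y \<noteq> 0}"
    using assms by (auto intro!: finite_int_box2)
  then have "finite {(x, y). f x y + g x y \<noteq> 0}"
    by (rule finite_subset[rotated, OF finite_UnI]) auto
  then show ?thesis
    using Sum_any.distrib[of "\<lambda>(x, y). f x y" "\<lambda>(x, y). g x y"] fin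
    by (simp add: Sum_any_nest2 split_def)
qed

lemma Sum_any_reindex3:
  fixes f f' :: "int \<Rightarrow> int \<Rightarrow> int \<Rightarrow> 'v::comm_monoid_add"
  assumes box: "\<And>x y z. f x y z \<noteq> 0 \<Longrightarrow> \<bar>x\<bar> \<le> K \<and> \<bar>y\<bar> \<le> K \<and> \<bar>z\<bar> \<le> K"
    and inv: "\<And>p. \<psi> (\<phi> p) = p" "\<And>p. \<phi> (\<psi> p) = p"
    and eq: "\<And>x y z. (\<lambda>(x, y, z). f' x y z) (\<phi> (x, y, z)) = f x y z"
  shows "Sum_any (\<lambda>x. Sum_any (\<lambda>y. Sum_any (\<lambda>z. f x y z))) =
    Sum_any (\<lambda>x. Sum_any (\<lambda>y. Sum_any (\<lambda>z. f' x y z)))"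
proof -
  have fin: "finite {(x, y, z). f x y z \<noteq> 0}"
    using box by (rule finite_int_box3)
  have "{(x, y, z). f' x y z \<noteq> 0} \<subseteq> \<phi> ` {(x, y, z). f x y z \<noteq> 0}"
  proof safe
    fix x y z assume nz: "f' x y z \<noteq> 0"
    obtain a b c where ab: "\<psi> (x, y, z) = (a, b, c)" by (cases "\<psi> (x, y, z)")
    then have "\<phi> (a, b, c) = (x, y, z)" using inv(2)[of "(x, y, z)"] by simp
    then show "(x, y, z) \<in> \<phi> ` {(x, y, z). f x y z \<noteq> 0}"
      using eq[of a b c] nz by (intro image_eqI[of _ _ "(a, b, c)"]) auto
  qed
  then have fin': "finite {(x, y, z). f' x y z \<noteq> 0}"
    using fin finite_subset by blast
  show ?thesis
    unfolding Sum_any_nest3[OF fin] Sum_any_nest3[OF fin']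
    by (rule Sum_any_bij[symmetric, where f = \<phi> and g = \<psi>]) (use inv eq in auto)
qed

lemma Sum_any_uminus: "Sum_any (\<lambda>x. - f x :: 'v::ab_group_add) = - Sum_any f"
  by (simp add: Sum_any.expand_set sum_negf)

lemma Sum_any_diff:
  assumes "finite {x. f x \<noteq> 0}" "finite {x. g x \<noteq> 0}"
  shows "Sum_any (\<lambda>x. f x - g x :: 'v::ab_group_add) = Sum_any f - Sum_any g"
  using Sum_any.distrib[of f "\<lambda>x. - g x"] assms by (simp add: Sum_any_uminus)

lemma Sum_any_all_zero: "(\<And>x. f x = 0) \<Longrightarrow> Sum_any f = 0"
  by simp

lemma Sum_any_supported_at:
  assumes "\<And>x. x \<noteq> a \<Longrightarrow> f x = 0"
  shows "Sum_any f = f a"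
  using Sum_any.expand_superset[of "{a}" f] assms by auto

section \<open>Exponentials of commuting operators\<close>

text \<open>
  Operators on the Fock space are endomorphisms of a complex vector space. The general theory is developed
  for an abstract complex vector space.
\<close>

abbreviation lin :: "(complex \<Rightarrow> 'v \<Rightarrow> 'v::ab_group_add) \<Rightarrow> ('v \<Rightarrow> 'v) \<Rightarrow> bool" where
  "lin s \<equiv> Vector_Spaces.linear s s"

locale complex_vector_space = vector_space scale
  for scale :: "complex \<Rightarrow> 'v::ab_group_add \<Rightarrow> 'v" (infixr "\<cdot>" 75)
begin

lemma linI:
  assumes "\<And>x y. f (x + y) = f x + f y" "\<And>c x. f (c \<cdot> x) = c \<cdot> f x"
  shows "lin scale f"
  using assms by unfold_locales (auto simp: algebra_simps)

lemma lin_simps: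
  assumes "lin scale f"
  shows "f (x + y) = f x + f y" "f (c \<cdot> x) = c \<cdot> f x" "f 0 = 0"
    "f (x - y) = f x - f y" "f (- x) = - f x"
proof -
  interpret Vector_Spaces.linear scale scale f by (rule assms)
  show "f (x + y) = f x + f y" "f (c \<cdot> x) = c \<cdot> f x" "f 0 = 0"
    "f (x - y) = f x - f y" "f (- x) = - f x"
    by (simp_all add: add scale neg diff)
qed

lemma lin_Sum_any:
  assumes "lin scale f" "finite {k. g k \<noteq> 0}"
  shows "f (Sum_any g) = Sum_any (\<lambda>k. f (g k))"
  by (rule Sum_any_hom) (use assms in \<open>auto simp: lin_simps\<close>)

lemma scale_Sum_any: "c \<cdot> Sum_any g = Sum_any (\<lambda>k. c \<cdot> g k)"
proof (cases "c = 0 \<or> infinite {k. g k \<noteq> 0}")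
  case False
  then show ?thesis by (intro Sum_any_hom) (auto simp: scale_right_distrib)
next
  case True
  then show ?thesis by (cases "c = 0") auto
qed

end

text \<open>
  The recursion is the coefficientwise form of the differential equation satisfied by
  \<open>V(z) = \<Sum>\<^sub>n V\<^sub>n z\<^sup>n = exp(- 2 \<Sum>\<^sub>k e\<^sub>k z\<^sup>k / k)\<close>, and it determines \<open>V\<close>. The properties of the exponential series are
  derived from it by induction on the degree of the coefficient.
\<close>

locale exp_family = complex_vector_space scale
  for scale :: "complex \<Rightarrow> 'v::ab_group_add \<Rightarrow> 'v" (infixr "\<cdot>" 75) +
  fixes e V :: "int \<Rightarrow> 'v \<Rightarrow> 'v"
  assumes e_lin: "lin scale (e k)" and V_lin: "lin scale (V n)"
    and e_zero: "even k \<or> k \<le> 0 \<Longrightarrow> e k v = 0"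
    and e_comm: "e k (e l v) = e l (e k v)"
    and V_neg: "n < 0 \<Longrightarrow> V n v = 0"
    and V_0: "V 0 v = v"
    and V_rec: "of_int n \<cdot> V n v = (- 2) \<cdot> Sum_any (\<lambda>k. e k (V (n - k) v))"
begin

lemmas e_simps = lin_simps[OF e_lin] and V_simps = lin_simps[OF V_lin]

lemma e_nonzero: "e k v \<noteq> 0 \<Longrightarrow> odd k \<and> 0 < k"
  using e_zero by (meson not_less)

lemma V_nonzero: "V n v \<noteq> 0 \<Longrightarrow> 0 \<le> n"
  using V_neg by (meson not_less)

lemma rec_finite: "finite {k. e k (V (n - k) v) \<noteq> 0}"
proof (rule finite_int_box[where K = "\<bar>n\<bar>"])
  fix k assume *: "e k (V (n - k) v) \<noteq> 0"
  then have "V (n - k) v \<noteq> 0" by (auto simp: e_simps)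
  then show "\<bar>k\<bar> \<le> \<bar>n\<bar>" using e_nonzero[OF *] V_nonzero[of "n - k" v] by auto
qed

text \<open>
  Whatever commutes with the exponent commutes with the exponential.
\<close>

lemma commute_V:
  assumes T: "lin scale T" and comm: "\<And>k v. T (e k v) = e k (T v)"
  shows "T (V n v) = V n (T v)"
proof (cases "n < 0")
  case True
  then show ?thesis by (simp add: V_neg lin_simps[OF T])
next
  case False
  then show ?thesis
  proof (induction "nat n" arbitrary: n rule: less_induct)
    case less
    show ?case
    proof (cases "n = 0")
      case False
      have "e k (T (V (n - k) v)) = e k (V (n - k) (T v))" for k
      proof (cases "even k \<or> k \<le> 0 \<or> n < k")
        case True
        then show ?thesis by (auto simp: e_zero V_neg e_simps lin_simps[OF T])
      next
        case False
        then show ?thesis using less by simp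
      qed
      then have "of_int n \<cdot> T (V n v) = of_int n \<cdot> V n (T v)"
        unfolding V_rec lin_simps(2)[OF T, symmetric]
        by (simp add: lin_simps[OF T] lin_Sum_any[OF T rec_finite] comm)
      then show ?thesis using False by simp
    qed (simp add: V_0)
  qed
qed

lemma e_V_commute: "e k (V n v) = V n (e k v)"
  by (rule commute_V[OF e_lin e_comm])

lemma VV_nonzero: "V m (V n v) \<noteq> 0 \<Longrightarrow> 0 \<le> m \<and> 0 \<le> n"
  by (metis V_nonzero V_simps(3))

lemma VV_finite: "finite {r. f r \<cdot> V (m - r) (V r v) \<noteq> 0}"
  by (rule finite_int_box[where K = "\<bar>m\<bar>"]) (use VV_nonzero[of "m - _"] in force)

lemma eVV_nonzero: "e k (V m (V n v)) \<noteq> 0 \<Longrightarrow> 0 < k \<and> odd k \<and> 0 \<le> m \<and> 0 \<le> n"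
  by (metis e_nonzero VV_nonzero e_simps(3))

text \<open>
  Both weighted sums reduce to \<open>T\<close> by applying the recursion to the right or to the left factor of \<open>V(z) V(- z)\<close>.
  The signs differ because all \<open>k\<close> with \<open>e\<^sub>k \<noteq> 0\<close> are odd.
\<close>

lemma alternating_rec:
  fixes m v
  defines "T \<equiv> Sum_any (\<lambda>k. e k (Sum_any (\<lambda>r. (- 1) powi r \<cdot> V (m - k - r) (V r v))))"
  shows "Sum_any (\<lambda>r. (of_int r * (- 1) powi r) \<cdot> V (m - r) (V r v)) = 2 \<cdot> T" (is "?D = _")
    and "Sum_any (\<lambda>r. (of_int (m - r) * (- 1) powi r) \<cdot> V (m - r) (V r v)) = (- 2) \<cdot> T" (is "?E = _")
proof -
  have T: "T = Sum_any (\<lambda>k. Sum_any (\<lambda>r. (- 1) powi r \<cdot> e k (V (m - k - r) (V r v))))"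
    unfolding T_def by (simp add: lin_Sum_any[OF e_lin VV_finite] e_simps)
  have box: "\<bar>k\<bar> \<le> \<bar>m\<bar> \<and> \<bar>r\<bar> \<le> \<bar>m\<bar>" if "(- 1) powi r \<cdot> e k (V (m - k - r) (V r v)) \<noteq> 0" for k r
    using that eVV_nonzero[of k "m - k - r" r v] by auto
  have "?D = Sum_any (\<lambda>r. (- 1) powi r \<cdot> V (m - r) (of_int r \<cdot> V r v))"
    by (simp add: V_simps mult.commute)
  also have "\<dots> = (- 2) \<cdot> Sum_any (\<lambda>r. Sum_any (\<lambda>k. (- 1) powi r \<cdot> e k (V (m - r) (V (r - k) v))))"
    by (simp only: V_rec V_simps lin_Sum_any[OF V_lin rec_finite])
      (simp only: e_V_commute scale_Sum_any scale_left_commute)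
  also have "Sum_any (\<lambda>r. Sum_any (\<lambda>k. (- 1) powi r \<cdot> e k (V (m - r) (V (r - k) v)))) =
     Sum_any (\<lambda>k. Sum_any (\<lambda>r. - ((- 1) powi r \<cdot> e k (V (m - k - r) (V r v)))))"
  proof (rule Sum_any_reindex2[symmetric, where K = "\<bar>m\<bar>" and \<phi> = "\<lambda>(k, r). (r + k, k)" and \<psi> = "\<lambda>(r, k). (k, r - k)"])
    fix k r :: int
    show "\<bar>k\<bar> \<le> \<bar>m\<bar> \<and> \<bar>r\<bar> \<le> \<bar>m\<bar>" if "- ((- 1) powi r \<cdot> e k (V (m - k - r) (V r v))) \<noteq> 0"
      using that by (intro box) simp
    show "(- 1) powi fst ((\<lambda>(k, r). (r + k, k)) (k, r)) \<cdot> e (snd ((\<lambda>(k, r). (r + k, k)) (k, r)))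
       (V (m - fst ((\<lambda>(k, r). (r + k, k)) (k, r))) (V (fst ((\<lambda>(k, r). (r + k, k)) (k, r)) - snd ((\<lambda>(k, r). (r + k, k)) (k, r))) v)) =
       - ((- 1) powi r \<cdot> e k (V (m - k - r) (V r v)))"
      by (cases "even k") (auto simp: e_zero minus_one_powi algebra_simps)
  qed auto
  finally show "?D = 2 \<cdot> T"
    by (simp add: T Sum_any_uminus)
  have "?E = Sum_any (\<lambda>r. (- 1) powi r \<cdot> of_int (m - r) \<cdot> V (m - r) (V r v))"
    by (simp add: mult.commute)
  also have "\<dots> = (- 2) \<cdot> Sum_any (\<lambda>r. Sum_any (\<lambda>k. (- 1) powi r \<cdot> e k (V (m - r - k) (V r v))))"
    by (simp only: V_rec scale_Sum_any scale_left_commute)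
  also have "Sum_any (\<lambda>r. Sum_any (\<lambda>k. (- 1) powi r \<cdot> e k (V (m - r - k) (V r v)))) = T"
    unfolding T
  proof (rule Sum_any_reindex2[symmetric, where K = "\<bar>m\<bar>" and \<phi> = "\<lambda>(k, r). (r, k)" and \<psi> = "\<lambda>(k, r). (r, k)"])
    fix k r :: int
    show "\<bar>k\<bar> \<le> \<bar>m\<bar> \<and> \<bar>r\<bar> \<le> \<bar>m\<bar>" if "(- 1) powi r \<cdot> e k (V (m - k - r) (V r v)) \<noteq> 0"
      using that by (rule box)
  qed (auto simp: algebra_simps)
  finally show "?E = (- 2) \<cdot> T" .
qed

text \<open>
  The exponent of \<open>V\<close> is odd, so \<open>V(z) V(- z) = 1\<close>. The proof adds the two previous identities, which shows that
  \<open>m\<close> times the sum vanishes; for \<open>m = 0\<close> only the term \<open>r = 0\<close> is present.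
\<close>

lemma alternating_convolution:
  "Sum_any (\<lambda>r. (- 1) powi r \<cdot> V (m - r) (V r v)) = (if m = 0 then v else 0)"
proof (cases "m = 0")
  case True
  have "V (m - r) (V r v) = 0" if "r \<noteq> 0" for r
    using that VV_nonzero[of "m - r" r v] True by fastforce
  then show ?thesis
    using True by (subst Sum_any_supported_at[of 0]) (auto simp: V_0)
next
  case False
  have "of_int m \<cdot> Sum_any (\<lambda>r. (- 1) powi r \<cdot> V (m - r) (V r v)) =
     Sum_any (\<lambda>r. (of_int (m - r) * (- 1) powi r) \<cdot> V (m - r) (V r v) +
       (of_int r * (- 1) powi r) \<cdot> V (m - r) (V r v))"
    unfolding scale_Sum_any by (simp flip: scale_left_distrib distrib_right)
  also have "\<dots> = 0"
    by (subst Sum_any.distrib) (simp_all only: alternating_rec VV_finite, simp flip: scale_left_distrib)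
  finally show ?thesis using False by simp
qed

text \<open>
  The derivative of \<open>V(z) V(- a z)\<close> with respect to \<open>a\<close> at \<open>a = 1\<close>. It recovers the exponent from the exponential, and
  is what produces the Heisenberg operators in the case \<open>a = 1\<close>.
\<close>

lemma alternating_convolution_weighted:
  "Sum_any (\<lambda>r. (of_int r * (- 1) powi r) \<cdot> V (m - r) (V r v)) = 2 \<cdot> e m v"
  unfolding alternating_rec alternating_convolution
  by (subst Sum_any_supported_at[of m]) (auto simp: e_simps)

lemma V_filtered:
  assumes "\<And>d. subspace (F d)" and e: "\<And>k d v. v \<in> F d \<Longrightarrow> e k v \<in> F (d - k)" and v: "v \<in> F d"
  shows "V n v \<in> F (d - n)"
proof (cases "n < 0")
  case True
  then show ?thesis using assms(1) by (simp add: V_neg subspace_0)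
next
  case False
  then show ?thesis
  proof (induction "nat n" arbitrary: n rule: less_induct)
    case less
    show ?case
    proof (cases "n = 0")
      case True
      then show ?thesis using v by (simp add: V_0)
    next
      case False
      have "e k (V (n - k) v) \<in> F (d - n)" for k
      proof (cases "odd k \<and> 0 < k \<and> k \<le> n")
        case True
        then have "V (n - k) v \<in> F (d - (n - k))" using less by simp
        from e[OF this, of k] show ?thesis by simp
      next
        case False
        then have "e k (V (n - k) v) = 0"
          using e_nonzero[of k "V (n - k) v"] V_nonzero[of "n - k" v]
            by (cases "V (n - k) v = 0") (auto simp: e_simps)
        then show ?thesis using assms(1) by (simp add: subspace_0)
      qed
      then have "Sum_any (\<lambda>k. e k (V (n - k) v)) \<in> F (d - n)"
        unfolding Sum_any.expand_set by (rule subspace_sum[OF assms(1)])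
      then have "of_int n \<cdot> V n v \<in> F (d - n)"
        unfolding V_rec by (rule subspace_scale[OF assms(1)])
      from subspace_scale[OF assms(1) this, of "1 / of_int n"] show ?thesis
        using False by simp
    qed
  qed
qed

end

section \<open>Vertex operators\<close>

text \<open>
  The coefficients of \<open>(1 - x) / (1 + x)\<close>, expanded in nonnegative powers of \<open>x\<close>.
\<close>

definition ope_coeff :: "int \<Rightarrow> complex" where
  "ope_coeff t = (- 1) powi t * of_int (1 + sgn t)"

lemma ope_coeff_neg [simp]: "t < 0 \<Longrightarrow> ope_coeff t = 0"
  by (simp add: ope_coeff_def)

lemma ope_coeff_0 [simp]: "ope_coeff 0 = 1"
  by (simp add: ope_coeff_def)

text \<open>
  The expansions of \<open>(1 - x) / (1 + x)\<close> at \<open>0\<close> and at infinity differ by a delta function: this is the source of the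
  anticommutator of the fermions.
\<close>

lemma ope_coeff_sym: "ope_coeff t + ope_coeff (- t) = 2 * (- 1) powi t"
  by (cases t "0 :: int" rule: linorder_cases) (auto simp: ope_coeff_def minus_one_powi)

text \<open>
  The recursion for \<open>(1 - x) / (1 + x) = exp(- 2 \<Sum>\<^sub>k x\<^sup>k / k)\<close>, with \<open>k\<close> running over the odd positive integers.
\<close>

lemma ope_coeff_rec:
  "Sum_any (\<lambda>k. of_bool (odd k \<and> 0 < k) * ope_coeff (s - k)) = - of_int s * ope_coeff s / 2"
proof (cases "s \<le> 0")
  case True
  have "of_bool (odd k \<and> 0 < k) * ope_coeff (s - k) = 0" for k
    using True by (cases "0 < k") auto
  then show ?thesis
    using True by (cases "s = 0") (simp_all only:, simp_all)
next
  case False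
  define P where "P s = Sum_any (\<lambda>k. of_bool (odd k \<and> 0 < k) * ope_coeff (s - k))" for s
  have fin: "finite {k. of_bool (odd k \<and> 0 < k) * ope_coeff (s - k) \<noteq> 0}" for s
  proof (rule finite_int_box[where K = "\<bar>s\<bar>"])
    fix k assume "of_bool (odd k \<and> 0 < k) * ope_coeff (s - k) \<noteq> 0"
    then show "\<bar>k\<bar> \<le> \<bar>s\<bar>" using ope_coeff_neg[of "s - k"] by (cases "s < k") auto
  qed
  have step: "P (s + 2) = ope_coeff (s + 1) + P s" for s
  proof -
    have "P (s + 2) = Sum_any (\<lambda>k. of_bool (odd (k + 2) \<and> 0 < k + 2) * ope_coeff (s + 2 - (k + 2)))"
      unfolding P_def by (rule Sum_any_shift[symmetric])
    also have "\<dots> = Sum_any (\<lambda>k. (if k = - 1 then ope_coeff (s - k) else 0) +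
        of_bool (odd k \<and> 0 < k) * ope_coeff (s - k))"
    proof (intro Sum_any.cong)
      fix k :: int
      have "odd (k + 2) \<and> 0 < k + 2 \<longleftrightarrow> k = - 1 \<or> odd k \<and> 0 < k"
        by presburger
      then show "of_bool (odd (k + 2) \<and> 0 < k + 2) * ope_coeff (s + 2 - (k + 2)) =
        (if k = - 1 then ope_coeff (s - k) else 0) + of_bool (odd k \<and> 0 < k) * ope_coeff (s - k)"
        by auto
    qed
    also have "\<dots> = ope_coeff (s + 1) + P s"
      unfolding P_def by (subst Sum_any.distrib[OF _ fin]) simp_all
    finally show ?thesis .
  qed
  have P_0: "P 0 = 0"
  proof -
    have "of_bool (odd k \<and> 0 < k) * ope_coeff (0 - k) = 0" for k
      by (cases "0 < k") auto
    then show ?thesis unfolding P_def by (simp only: Sum_any.neutral)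
  qed
  have P_m1: "P (- 1) = 0"
  proof -
    have "of_bool (odd k \<and> 0 < k) * ope_coeff (- 1 - k) = 0" for k
      by (cases "0 < k") auto
    then show ?thesis unfolding P_def by (simp only: Sum_any.neutral)
  qed
  have val: "ope_coeff (int n) = (if n = 0 then 1 else if even n then 2 else - 2)" for n
    by (auto simp: ope_coeff_def minus_one_powi)
  have "P (int n) = - of_nat n * ope_coeff (int n) / 2" for n
  proof (induction n rule: nat_induct2)
    case 0
    then show ?case by (simp add: P_0)
  next
    case 1
    then show ?case using step[of "- 1"] val[of 1] by (simp add: P_m1)
  next
    case (step n)
    have "P (int (n + 2)) = ope_coeff (int (n + 1)) + P (int n)"
      using \<open>\<And>s. P (s + 2) = ope_coeff (s + 1) + P s\<close>[of "int n"] by (simp add: add.commute)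
    then show ?case unfolding step val by (cases "n = 0"; cases "even n") (simp_all add: algebra_simps add_divide_distrib diff_divide_distrib)
  qed
  from this[of "nat s"] False show ?thesis
    by (simp add: P_def)
qed

lemma powi_minus_one_add: "(- 1 :: complex) powi (m + n) = (- 1) powi m * (- 1) powi n"
  by (simp add: power_int_add)

text \<open>
  Here \<open>h i n\<close> stands for \<open>\<epsilon>\<^sub>i(n)\<close>, and \<open>A i\<close>, \<open>B i\<close> for the series \<open>E\<^sub>+(\<epsilon>\<^sub>i, z)\<close>, \<open>E\<^sub>-(\<epsilon>\<^sub>i, z)\<close>, whose coefficients live in
  nonnegative and in nonpositive degrees. The filtration \<open>F\<close> by degree is lowered by \<open>A i n\<close> and is trivial in
  negative degrees; it makes all infinite sums of operators finite on each vector.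
\<close>

locale vertex_operators = complex_vector_space scale
  for scale :: "complex \<Rightarrow> 'v::ab_group_add \<Rightarrow> 'v" (infixr "\<cdot>" 75) +
  fixes h A B :: "'n \<Rightarrow> int \<Rightarrow> 'v \<Rightarrow> 'v" and F :: "int \<Rightarrow> 'v set"
  assumes h_lin: "lin scale (h i k)"
    and h_comm: "odd m \<Longrightarrow> odd n \<Longrightarrow>
      h i m (h j n v) = h j n (h i m v) + (of_int m / 2 * of_bool (i = j \<and> m + n = 0)) \<cdot> v"
    and A_exp: "exp_family scale (\<lambda>k v. if odd k \<and> 0 < k then h i k v else 0) (A i)"
    and B_exp: "exp_family scale (\<lambda>k v. if odd k \<and> 0 < k then - h i (- k) v else 0) (\<lambda>n. B i (- n))"
    and F_cover: "\<exists>d. v \<in> F d"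
    and F_neg: "d < 0 \<Longrightarrow> v \<in> F d \<Longrightarrow> v = 0"
    and A_F: "v \<in> F d \<Longrightarrow> A i n v \<in> F (d - n)"
begin

sublocale A: exp_family scale "\<lambda>k v. if odd k \<and> 0 < k then h i k v else 0" "A i" for i
  by (rule A_exp)

sublocale B: exp_family scale "\<lambda>k v. if odd k \<and> 0 < k then - h i (- k) v else 0" "\<lambda>n. B i (- n)" for i
  by (rule B_exp)

lemma B_lin: "lin scale (B i n)"
  using B.V_lin[of i "- n"] by simp

lemmas h_simps = lin_simps[OF h_lin] and A_simps = lin_simps[OF A.V_lin] and B_simps = lin_simps[OF B_lin]

lemma A_nonzero: "A i n v \<noteq> 0 \<Longrightarrow> 0 \<le> n"
  using A.V_nonzero by blast

lemma B_nonzero: "B i n v \<noteq> 0 \<Longrightarrow> n \<le> 0"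
  using B.V_nonzero[of i "- n" v] by simp

lemma A_nonzero_F: "A i n v \<noteq> 0 \<Longrightarrow> v \<in> F d \<Longrightarrow> n \<le> d"
  using A_F[of v d i n] F_neg[of "d - n"] by (meson diff_less_0_iff_less not_less)

lemma AA_nonzero_F: "A i m (A j n v) \<noteq> 0 \<Longrightarrow> v \<in> F d \<Longrightarrow> 0 \<le> m \<and> 0 \<le> n \<and> m + n \<le> d"
  using A_nonzero[of i m "A j n v"] A_nonzero[of j n v] A_nonzero_F[of i m "A j n v" "d - n"] A_F[of v d j n]
  by (cases "A j n v = 0") (auto simp: A_simps algebra_simps)

lemma A_annihilation_commute:
  assumes "odd k" "0 < k"
  shows "h j k (A i m v) = A i m (h j k v)"
proof (rule A.commute_V[OF h_lin])
  show "h j k (if odd l \<and> 0 < l then h i l v else 0) = (if odd l \<and> 0 < l then h i l (h j k v) else 0)" for l v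
    using assms h_comm[of k l j i v] by (simp add: h_simps)
qed

lemma B_creation_commute:
  assumes "odd k" "k < 0"
  shows "h j k (B i m v) = B i m (h j k v)"
proof -
  have "h j k (if odd l \<and> 0 < l then - h i (- l) v else 0) =
      (if odd l \<and> 0 < l then - h i (- l) (h j k v) else 0)" for l v
    using assms h_comm[of k "- l" j i v] by (simp add: h_simps)
  from B.commute_V[OF h_lin this, where n = "- m" and v = v] show ?thesis by simp
qed

lemma A_A_commute: "A i m (A j n v) = A j n (A i m v)"
proof (rule A.commute_V[OF A.V_lin])
  show "A i m (if odd k \<and> 0 < k then h j k v else 0) = (if odd k \<and> 0 < k then h j k (A i m v) else 0)" for k v
    by (simp add: A_annihilation_commute A_simps)
qed

lemma B_B_commute: "B i m (B j n v) = B j n (B i m v)"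
proof -
  have "B i m (if odd k \<and> 0 < k then - h j (- k) v else 0) =
      (if odd k \<and> 0 < k then - h j (- k) (B i m v) else 0)" for k v
    by (simp add: B_creation_commute B_simps)
  from B.commute_V[OF B_lin this, where n = "- n" and v = v] show ?thesis by simp
qed

text \<open>
  Moving a creation operator through \<open>E\<^sub>+\<close>: the commutator with the exponent is a scalar, so the commutator with
  the exponential is the same series shifted by \<open>k\<close>. With \<open>[h i k, h i (- k)] = k / 2\<close> and the factor \<open>- 2 / k\<close> of
  \<open>h i k\<close> in the exponent, the scalar is \<open>- 1\<close>.
\<close>

lemma A_creation:
  assumes "odd k" "0 < k"
  shows "A i m (h j (- k) v) = h j (- k) (A i m v) - of_bool (i = j) \<cdot> A i (m - k) v"
proof (cases "m < 0")
  case True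
  then show ?thesis using assms by (simp add: A.V_neg h_simps)
next
  case False
  then show ?thesis
  proof (induction "nat m" arbitrary: m rule: less_induct)
    case less
    show ?case
    proof (cases "m = 0")
      case True
      then show ?thesis using assms by (simp add: A.V_0 A.V_neg)
    next
      case False
      let ?e = "\<lambda>l v. if odd l \<and> 0 < l then h i l v else 0"
      have *: "?e l (A i (m - l) (h j (- k) v)) =
         h j (- k) (?e l (A i (m - l) v)) +
         ((if l = k then (of_int k / 2 * of_bool (i = j)) \<cdot> A i (m - l) v else 0) -
           of_bool (i = j) \<cdot> ?e l (A i (m - k - l) v))" for l
      proof (cases "odd l \<and> 0 < l")
        case True
        have "A i (m - l) (h j (- k) v) = h j (- k) (A i (m - l) v) - of_bool (i = j) \<cdot> A i (m - l - k) v"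
        proof (cases "m < l")
          case True
          then show ?thesis using assms by (simp add: A.V_neg h_simps)
        next
          case False
          then show ?thesis using less True by simp
        qed
        moreover have "m - l - k = m - k - l" by simp
        ultimately show ?thesis
          using True assms h_comm[of l "- k" i j] by (auto simp: h_simps)
      next
        case False
        then show ?thesis using assms by (auto simp: h_simps)
      qed
      have fin: "finite {l. h j (- k) (?e l (A i (m - l) v)) \<noteq> 0}"
        by (rule finite_subset[OF _ A.rec_finite[of i m v]]) (auto simp: h_simps)
      have fin2: "finite {l. of_bool (i = j) \<cdot> ?e l (A i (m - k - l) v) \<noteq> 0}"
        by (rule finite_subset[OF _ A.rec_finite[of i "m - k" v]]) auto
      have fin3: "finite {l. (if l = k then (of_int k / 2 * of_bool (i = j)) \<cdot> A i (m - l) v else 0) \<noteq> 0}"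
        by (rule finite_subset[of _ "{k}"]) auto
      have fin4: "finite {l. (if l = k then (of_int k / 2 * of_bool (i = j)) \<cdot> A i (m - l) v else 0) -
          of_bool (i = j) \<cdot> ?e l (A i (m - k - l) v) \<noteq> 0}"
        by (rule finite_subset[OF _ finite_UnI[OF fin2 fin3]]) force
      have "of_int m \<cdot> A i m (h j (- k) v) = (- 2) \<cdot> (h j (- k) (Sum_any (\<lambda>l. ?e l (A i (m - l) v))) +
          ((of_int k / 2 * of_bool (i = j)) \<cdot> A i (m - k) v -
           of_bool (i = j) \<cdot> Sum_any (\<lambda>l. ?e l (A i (m - k - l) v))))"
        unfolding A.V_rec * Sum_any.distrib[OF fin fin4] Sum_any_diff[OF fin3 fin2]
        by (simp add: lin_Sum_any[OF h_lin A.rec_finite] scale_Sum_any)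
      also have "\<dots> = h j (- k) ((- 2) \<cdot> Sum_any (\<lambda>l. ?e l (A i (m - l) v))) -
           (of_int k * of_bool (i = j)) \<cdot> A i (m - k) v -
           of_bool (i = j) \<cdot> (- 2) \<cdot> Sum_any (\<lambda>l. ?e l (A i (m - k - l) v))"
        by (simp add: h_simps scale_right_distrib scale_right_diff_distrib algebra_simps)
      also have "\<dots> = of_int m \<cdot> (h j (- k) (A i m v) - of_bool (i = j) \<cdot> A i (m - k) v)"
        unfolding A.V_rec[symmetric] by (simp add: h_simps scale_right_diff_distrib algebra_simps)
      finally show ?thesis using False by simp
    qed
  qed
qed

lemma BBAA_nonzero:
  assumes "B i k (B j l (A i' m (A j' n v))) \<noteq> 0" "v \<in> F d"
  shows "k \<le> 0 \<and> l \<le> 0 \<and> 0 \<le> m \<and> 0 \<le> n \<and> m + n \<le> d"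
proof -
  have "A i' m (A j' n v) \<noteq> 0" and l: "B j l (A i' m (A j' n v)) \<noteq> 0"
    using assms(1) by (auto simp: B_simps)
  with assms show ?thesis
    using B_nonzero[OF assms(1)] B_nonzero[OF l] AA_nonzero_F[of i' m j' n v d] by auto
qed

lemma BBA_nonzero:
  assumes "B i k (B j l (A i' m v)) \<noteq> 0" "v \<in> F d"
  shows "k \<le> 0 \<and> l \<le> 0 \<and> 0 \<le> m \<and> m \<le> d"
  using BBAA_nonzero[of i k j l i' m i' 0 v d] assms by (simp add: A.V_0)

lemma BA_finite: "finite {k. B i k (A j (n - k) v) \<noteq> 0}"
proof -
  obtain d where d: "v \<in> F d" using F_cover by blast
  show ?thesis
  proof (rule finite_int_box[where K = "\<bar>n\<bar> + \<bar>d\<bar>"])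
    fix k assume "B i k (A j (n - k) v) \<noteq> 0"
    then have "B i k (B i 0 (A j (n - k) v)) \<noteq> 0"
      using B.V_0[of i] by auto
    from BBA_nonzero[OF this d] show "\<bar>k\<bar> \<le> \<bar>n\<bar> + \<bar>d\<bar>" by auto
  qed
qed

lemma ope_finite: "finite {t. ope_coeff t \<cdot> B i (n + t) (A j (m - t) v) \<noteq> 0}"
proof (rule finite_int_box[where K = "\<bar>n\<bar>"])
  fix t assume "ope_coeff t \<cdot> B i (n + t) (A j (m - t) v) \<noteq> 0"
  then show "\<bar>t\<bar> \<le> \<bar>n\<bar>"
    using ope_coeff_neg[of t] B_nonzero[of i "n + t" "A j (m - t) v"] by (cases "t < 0") auto
qed

text \<open>
  The product \<open>E\<^sub>+(\<epsilon>\<^sub>i, z) E\<^sub>-(\<epsilon>\<^sub>i, w)\<close> equals \<open>(1 - w/z) / (1 + w/z)\<close> times the product in the opposite order. Both sides satisfy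
  the same recursion in the degree of the coefficient of \<open>E\<^sub>-\<close>: on the left by lemma \<open>A_creation\<close>,
  on the right by the recursion of the coefficients of \<open>(1 - x) / (1 + x)\<close>.
\<close>

lemma A_B_ope:
  "A i m (B i n v) = Sum_any (\<lambda>t. ope_coeff t \<cdot> B i (n + t) (A i (m - t) v))"
proof (cases "0 < n")
  case True
  have "ope_coeff t \<cdot> B i (n + t) (A i (m - t) v) = 0" for t
    using ope_coeff_neg[of t] B_nonzero[of i "n + t" "A i (m - t) v"] True by (cases "t < 0") auto
  then have "Sum_any (\<lambda>t. ope_coeff t \<cdot> B i (n + t) (A i (m - t) v)) = 0"
    by (rule Sum_any_all_zero)
  moreover have "B i n v = 0" using True B_nonzero[of i n v] by linarith
  ultimately show ?thesis by (simp add: A_simps)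
next
  case False
  define U where "U N m = Sum_any (\<lambda>t. ope_coeff t \<cdot> B i (- (N - t)) (A i (m - t) v))" for N m
  have U_fin: "finite {t. ope_coeff t \<cdot> B i (- (N - t)) (A i (m - t) v) \<noteq> 0}" for N m
    using ope_finite[of i "- N" i m v] by simp
  let ?o = "\<lambda>k::int. odd k \<and> 0 < k"
  have nz: "0 \<le> t \<and> 0 \<le> N \<and> t \<le> N" if "ope_coeff t \<cdot> B i (- (N - t)) w \<noteq> 0" for t N w
    using that ope_coeff_neg[of t] B_nonzero[of i "- (N - t)" w] by (cases "t < 0") auto
  have U_neg: "U N m = 0" if "N < 0" for N m
    unfolding U_def using that nz[of _ N "A i (m - _) v"] by (intro Sum_any_all_zero) force
  \<comment> \<open>Differentiating \<open>\<Sum>\<^sub>t c\<^sub>t B\<^bsub>t-N\<^esub> A\<^bsub>m-t\<^esub>\<close> gives \<open>f1\<close> from \<open>B\<close> and \<open>f2\<close> from the coefficients \<open>c\<^sub>t\<close>; their weights \<open>N - t\<close> and \<open>t\<close> add up to \<open>N\<close>.\<close>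
  have U_rec: "of_int N \<cdot> U N m =
      2 \<cdot> Sum_any (\<lambda>k. if ?o k then h i (- k) (U (N - k) m) - U (N - k) (m - k) else 0)" for N m
  proof -
    let ?T = "\<lambda>t. B i (- (N - t)) (A i (m - t) v)"
    define f1 where "f1 k t = (if ?o k then ope_coeff t \<cdot> h i (- k) (B i (- (N - k - t)) (A i (m - t) v)) else 0)" for k t
    define f2 where "f2 k t = (of_bool (?o k) * ope_coeff t) \<cdot> ?T (k + t)" for k t
    have f1_box: "\<bar>k\<bar> \<le> \<bar>N\<bar> \<and> \<bar>t\<bar> \<le> \<bar>N\<bar>" if "f1 k t \<noteq> 0" for k t
    proof -
      have "ope_coeff t \<cdot> B i (- (N - k - t)) (A i (m - t) v) \<noteq> 0" "0 < k"
        using that by (auto simp: f1_def h_simps split: if_splits)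
      then show ?thesis using nz[of t "N - k" "A i (m - t) v"] by auto
    qed
    have f2_box: "\<bar>k\<bar> \<le> \<bar>N\<bar> \<and> \<bar>t\<bar> \<le> \<bar>N\<bar>" if "f2 k t \<noteq> 0" for k t
    proof -
      have "ope_coeff t \<cdot> B i (- (N - k - t)) (A i (m - k - t) v) \<noteq> 0" "0 < k"
        using that by (auto simp: f2_def algebra_simps)
      then show ?thesis using nz[of t "N - k" "A i (m - k - t) v"] by auto
    qed
    have outer: "finite {k. Sum_any (f k) \<noteq> 0}" if "\<And>k t. f k t \<noteq> 0 \<Longrightarrow> \<bar>k\<bar> \<le> \<bar>N\<bar> \<and> \<bar>t\<bar> \<le> \<bar>N\<bar>"
      for f :: "int \<Rightarrow> int \<Rightarrow> 'v"
      by (rule finite_int_box[where K = "\<bar>N\<bar>"]) (metis that Sum_any.not_neutral_obtains_not_neutral)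
    have "Sum_any (\<lambda>k. Sum_any (f1 k)) = Sum_any (\<lambda>t. Sum_any (\<lambda>k. f1 k t))"
      by (rule Sum_any_reindex2[where \<phi> = "\<lambda>(k, t). (t, k)" and \<psi> = "\<lambda>(k, t). (t, k)", OF f1_box]) auto
    also have "\<dots> = Sum_any (\<lambda>t. (ope_coeff t * of_int (N - t) / 2) \<cdot> ?T t)"
    proof (intro Sum_any.cong)
      fix t
      have "of_int (N - t) \<cdot> ?T t = 2 \<cdot> Sum_any (\<lambda>k. if ?o k then h i (- k) (B i (- (N - k - t)) (A i (m - t) v)) else 0)"
      proof -
        have "(if ?o k then - h i (- k) (B i (- (N - t - k)) w) else 0) =
          - (if ?o k then h i (- k) (B i (- (N - k - t)) w) else 0)" for k w
          by (simp add: algebra_simps)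
        then show ?thesis unfolding B.V_rec by (simp only: Sum_any_uminus) simp
      qed
      then have "(1 / 2) \<cdot> of_int (N - t) \<cdot> ?T t =
         Sum_any (\<lambda>k. if ?o k then h i (- k) (B i (- (N - k - t)) (A i (m - t) v)) else 0)"
        by (simp only: scale_scale) simp
      moreover have "Sum_any (\<lambda>k. f1 k t) =
          ope_coeff t \<cdot> Sum_any (\<lambda>k. if ?o k then h i (- k) (B i (- (N - k - t)) (A i (m - t) v)) else 0)"
        unfolding scale_Sum_any f1_def by (intro Sum_any.cong) simp
      ultimately show "Sum_any (\<lambda>k. f1 k t) = (ope_coeff t * of_int (N - t) / 2) \<cdot> ?T t"
        by (simp flip: \<open>(1 / 2) \<cdot> of_int (N - t) \<cdot> ?T t = _\<close>)
    qed
    finally have 1: "Sum_any (\<lambda>k. Sum_any (f1 k)) = Sum_any (\<lambda>t. (ope_coeff t * of_int (N - t) / 2) \<cdot> ?T t)" .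
    have "Sum_any (\<lambda>k. Sum_any (f2 k)) = Sum_any (\<lambda>s. Sum_any (\<lambda>k. (of_bool (?o k) * ope_coeff (s - k)) \<cdot> ?T s))"
      by (rule Sum_any_reindex2[where \<phi> = "\<lambda>(k, t). (k + t, k)" and \<psi> = "\<lambda>(s, k). (k, s - k)", OF f2_box])
        (auto simp: f2_def)
    also have "\<dots> = Sum_any (\<lambda>s. - ((ope_coeff s * of_int s / 2) \<cdot> ?T s))"
    proof (intro Sum_any.cong)
      fix s
      have "finite {k. of_bool (?o k) * ope_coeff (s - k) \<noteq> 0}"
      proof (rule finite_int_box[where K = "\<bar>s\<bar>"])
        fix k assume "of_bool (odd k \<and> 0 < k) * ope_coeff (s - k) \<noteq> 0"
        then show "\<bar>k\<bar> \<le> \<bar>s\<bar>" using ope_coeff_neg[of "s - k"] by (cases "s < k") auto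
      qed
      then have "Sum_any (\<lambda>k. (of_bool (?o k) * ope_coeff (s - k)) \<cdot> ?T s) =
         Sum_any (\<lambda>k. of_bool (?o k) * ope_coeff (s - k)) \<cdot> ?T s"
        by (intro Sum_any_hom[symmetric]) (auto simp: scale_left_distrib)
      then show "Sum_any (\<lambda>k. (of_bool (?o k) * ope_coeff (s - k)) \<cdot> ?T s) = - ((ope_coeff s * of_int s / 2) \<cdot> ?T s)"
        unfolding ope_coeff_rec by (simp add: mult.commute)
    qed
    finally have 2: "Sum_any (\<lambda>k. Sum_any (f2 k)) = Sum_any (\<lambda>s. - ((ope_coeff s * of_int s / 2) \<cdot> ?T s))" .
    have T_fin: "finite {t. (ope_coeff t * c t) \<cdot> ?T t \<noteq> 0}" for c
      by (rule finite_subset[OF _ U_fin[of N m]]) auto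
    have "Sum_any (\<lambda>k. if ?o k then h i (- k) (U (N - k) m) - U (N - k) (m - k) else 0) =
       Sum_any (\<lambda>k. Sum_any (f1 k) - Sum_any (f2 k))"
    proof (intro Sum_any.cong)
      fix k
      show "(if ?o k then h i (- k) (U (N - k) m) - U (N - k) (m - k) else 0) = Sum_any (f1 k) - Sum_any (f2 k)"
      proof (cases "?o k")
        case True
        then show ?thesis
          unfolding U_def lin_Sum_any[OF h_lin U_fin]
          by (simp add: f1_def f2_def h_simps algebra_simps)
      next
        case False
        then have "f1 k t = 0" "f2 k t = 0" for t by (auto simp: f1_def f2_def)
        then have "Sum_any (f1 k) = 0" "Sum_any (f2 k) = 0" by (simp_all add: Sum_any_all_zero)
        then show ?thesis using False by auto
      qed
    qed
    also have "\<dots> = Sum_any (\<lambda>k. Sum_any (f1 k)) - Sum_any (\<lambda>k. Sum_any (f2 k))"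
      by (rule Sum_any_diff) (auto intro!: outer dest: f1_box f2_box)
    also have "2 \<cdot> \<dots> = Sum_any (\<lambda>t. (ope_coeff t * of_int (N - t)) \<cdot> ?T t) + Sum_any (\<lambda>t. (ope_coeff t * of_int t) \<cdot> ?T t)"
      unfolding 1 2 Sum_any_uminus diff_minus_eq_add scale_right_distrib scale_Sum_any scale_scale by simp
    also have "\<dots> = Sum_any (\<lambda>t. (ope_coeff t * of_int (N - t)) \<cdot> ?T t + (ope_coeff t * of_int t) \<cdot> ?T t)"
      by (rule Sum_any.distrib[symmetric]) (rule T_fin)+
    also have "\<dots> = Sum_any (\<lambda>t. (ope_coeff t * of_int N) \<cdot> ?T t)"
      by (simp flip: scale_left_distrib distrib_left)
    also have "\<dots> = of_int N \<cdot> U N m"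
      unfolding U_def scale_Sum_any by (simp add: mult.commute)
    finally show ?thesis by simp
  qed
  have "A i m (B i (- N) v) = U N m" for N m
  proof (cases "N < 0")
    case True
    then show ?thesis using B.V_neg[of N i v] U_neg by (simp add: A_simps)
  next
    case False
    then show ?thesis
    proof (induction "nat N" arbitrary: N m rule: less_induct)
      case less
      show ?case
      proof (cases "N = 0")
        case True
        have "ope_coeff t \<cdot> B i (- (N - t)) (A i (m - t) v) = 0" if "t \<noteq> 0" for t
          using nz[of t N "A i (m - t) v"] that True by force
        then have "U N m = ope_coeff 0 \<cdot> B i (- (N - 0)) (A i (m - 0) v)"
          unfolding U_def by (rule Sum_any_supported_at)
        then show ?thesis using True B.V_0[of i] by (simp add: ope_coeff_def)
      next
        case False
        let ?f = "\<lambda>k v. if ?o k then - h i (- k) v else 0"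
        have IH: "A i m (B i (- (N - k)) v) = U (N - k) m" if "0 < k" for k m
        proof (cases "N < k")
          case True
          then show ?thesis using U_neg[of "N - k"] B.V_neg[of "N - k" i v] by (simp add: A_simps)
        next
          case False
          then show ?thesis using less.hyps[of "N - k" m] \<open>N \<noteq> 0\<close> that by simp
        qed
        have "A i m (?f k (B i (- (N - k)) v)) =
          - (if ?o k then h i (- k) (U (N - k) m) - U (N - k) (m - k) else 0)" for k
          using A_creation[of k i m i "B i (- (N - k)) v"] IH[of k m] IH[of k "m - k"]
          by (auto simp: A_simps)
        then have "of_int N \<cdot> A i m (B i (- N) v) = of_int N \<cdot> U N m"
          using A_simps(2)[of i m "of_int N" "B i (- N) v"]
          unfolding U_rec B.V_rec by (simp add: A_simps lin_Sum_any[OF A.V_lin B.rec_finite] Sum_any_uminus)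
        then show ?thesis using False by simp
      qed
    qed
  qed
  from this[of m "- n"] show ?thesis by (simp add: U_def add.commute)
qed

lemma A_B_commute:
  assumes "i \<noteq> j"
  shows "A i m (B j n v) = B j n (A i m v)"
proof -
  have "A i m (if odd k \<and> 0 < k then - h j (- k) v else 0) =
      (if odd k \<and> 0 < k then - h j (- k) (A i m v) else 0)" for k v
    using assms by (simp add: A_creation A_simps)
  from B.commute_V[OF A.V_lin this, where n = "- n" and v = v] show ?thesis by simp
qed

text \<open>
  The coefficients of \<open>E\<^sub>-(\<epsilon>\<^sub>i, z) E\<^sub>+(\<epsilon>\<^sub>i, z)\<close> and of the normally ordered product
  \<open>E\<^sub>-(\<epsilon>\<^sub>i, z) E\<^sub>-(\<epsilon>\<^sub>j, w) E\<^sub>+(\<epsilon>\<^sub>i, z) E\<^sub>+(\<epsilon>\<^sub>j, w)\<close>.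
\<close>

definition vertex_op :: "'n \<Rightarrow> int \<Rightarrow> 'v \<Rightarrow> 'v" where
  "vertex_op i n v = Sum_any (\<lambda>k. B i k (A i (n - k) v))"

definition vertex_pair :: "'n \<Rightarrow> 'n \<Rightarrow> int \<Rightarrow> int \<Rightarrow> 'v \<Rightarrow> 'v" where
  "vertex_pair i j p q v = Sum_any (\<lambda>k. Sum_any (\<lambda>l. B i k (B j l (A i (p - k) (A j (q - l) v)))))"

lemma vertex_op_lin: "lin scale (vertex_op i n)"
proof (rule linI)
  show "vertex_op i n (x + y) = vertex_op i n x + vertex_op i n y" for x y
    unfolding vertex_op_def by (simp add: A_simps B_simps Sum_any.distrib BA_finite)
  show "vertex_op i n (c \<cdot> x) = c \<cdot> vertex_op i n x" for c x
    unfolding vertex_op_def by (simp add: A_simps B_simps scale_Sum_any)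
qed

lemma vertex_op_vanishes:
  assumes "v \<in> F d" "d < n"
  shows "vertex_op i n v = 0"
  unfolding vertex_op_def
proof (rule Sum_any_all_zero)
  fix k
  show "B i k (A i (n - k) v) = 0"
    using BBA_nonzero[of i k i 0 i "n - k" v d] assms B.V_0[of i]
    by (cases "B i k (A i (n - k) v) = 0") auto
qed

lemma vertex_pair_box:
  assumes "v \<in> F d" "B i k (B j l (A i (p - k) (A j (q - l) v))) \<noteq> 0"
  shows "\<bar>k\<bar> \<le> \<bar>p\<bar> + \<bar>q\<bar> + \<bar>d\<bar> \<and> \<bar>l\<bar> \<le> \<bar>p\<bar> + \<bar>q\<bar> + \<bar>d\<bar>"
  using BBAA_nonzero[OF assms(2,1)] by auto

lemma vertex_pair_vanishes:
  assumes "v \<in> F d" "d < p \<or> d < q"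
  shows "vertex_pair i j p q v = 0"
proof -
  have "B i k (B j l (A i (p - k) (A j (q - l) v))) = 0" for k l
    using BBAA_nonzero[OF _ assms(1), of i k j l i "p - k" j "q - l"] assms(2) by force
  then show ?thesis unfolding vertex_pair_def by simp
qed

lemma vertex_pair_swap: "vertex_pair i j p q v = vertex_pair j i q p v"
proof -
  obtain d where d: "v \<in> F d" using F_cover by blast
  show ?thesis
    unfolding vertex_pair_def
  proof (rule Sum_any_reindex2[where \<phi> = "\<lambda>(k, l). (l, k)" and \<psi> = "\<lambda>(k, l). (l, k)"])
    fix k l assume "B i k (B j l (A i (p - k) (A j (q - l) v))) \<noteq> 0"
    then show "\<bar>k\<bar> \<le> \<bar>p\<bar> + \<bar>q\<bar> + \<bar>d\<bar> \<and> \<bar>l\<bar> \<le> \<bar>p\<bar> + \<bar>q\<bar> + \<bar>d\<bar>"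
      by (rule vertex_pair_box[OF d])
  qed (auto simp: B_B_commute[of i _ j] A_A_commute[of i _ j])
qed

text \<open>
  With the total degree \<open>m\<close> fixed, the contributions of the two series \<open>E\<^sub>+\<close> form an inner sum. For the weights \<open>f\<close> used below
  it can be evaluated before the series \<open>E\<^sub>-\<close> act.
\<close>

lemma vertex_pair_sum:
  "Sum_any (\<lambda>q. f q \<cdot> vertex_pair i j (m - q) q v) =
   Sum_any (\<lambda>k. Sum_any (\<lambda>l. B i k (B j l (Sum_any (\<lambda>r. f (l + r) \<cdot> A i (m - k - l - r) (A j r v))))))"
proof -
  obtain d where d: "v \<in> F d" using F_cover by blast
  have box: "\<bar>q\<bar> \<le> \<bar>m\<bar> + \<bar>d\<bar> \<and> \<bar>k\<bar> \<le> \<bar>m\<bar> + \<bar>d\<bar> \<and> \<bar>l\<bar> \<le> \<bar>m\<bar> + \<bar>d\<bar>"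
    if "f q \<cdot> B i k (B j l (A i (m - q - k) (A j (q - l) v))) \<noteq> 0" for q k l
    using BBAA_nonzero[OF _ d, of i k j l i "m - q - k" j "q - l"] that by auto
  have "Sum_any (\<lambda>q. f q \<cdot> vertex_pair i j (m - q) q v) =
    Sum_any (\<lambda>q. Sum_any (\<lambda>k. Sum_any (\<lambda>l. f q \<cdot> B i k (B j l (A i (m - q - k) (A j (q - l) v))))))"
    unfolding vertex_pair_def scale_Sum_any ..
  also have "\<dots> = Sum_any (\<lambda>k. Sum_any (\<lambda>l. Sum_any (\<lambda>r. f (l + r) \<cdot> B i k (B j l (A i (m - k - l - r) (A j r v))))))"
    by (rule Sum_any_reindex3[where \<phi> = "\<lambda>(q, k, l). (k, l, q - l)" and \<psi> = "\<lambda>(k, l, r). (l + r, k, l)", OF box])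
      (auto simp: algebra_simps)
  also have "\<dots> = Sum_any (\<lambda>k. Sum_any (\<lambda>l. B i k (B j l (Sum_any (\<lambda>r. f (l + r) \<cdot> A i (m - k - l - r) (A j r v))))))"
  proof (intro Sum_any.cong)
    fix k l
    have fin: "finite {r. f (l + r) \<cdot> A i (m - k - l - r) (A j r v) \<noteq> 0}"
    proof (rule finite_int_box[where K = "\<bar>d\<bar> + \<bar>m\<bar> + \<bar>k\<bar> + \<bar>l\<bar>"])
      fix r assume "f (l + r) \<cdot> A i (m - k - l - r) (A j r v) \<noteq> 0"
      then show "\<bar>r\<bar> \<le> \<bar>d\<bar> + \<bar>m\<bar> + \<bar>k\<bar> + \<bar>l\<bar>" using AA_nonzero_F[OF _ d, of i "m - k - l - r" j r] by auto
    qed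
    have fin': "finite {r. B j l (f (l + r) \<cdot> A i (m - k - l - r) (A j r v)) \<noteq> 0}"
      by (rule finite_subset[OF _ fin]) (auto simp: B_simps)
    show "Sum_any (\<lambda>r. f (l + r) \<cdot> B i k (B j l (A i (m - k - l - r) (A j r v)))) =
      B i k (B j l (Sum_any (\<lambda>r. f (l + r) \<cdot> A i (m - k - l - r) (A j r v))))"
      unfolding lin_Sum_any[OF B_lin fin] lin_Sum_any[OF B_lin fin'] by (simp add: B_simps)
  qed
  finally show ?thesis .
qed

text \<open>
  The left-hand side is the order in which the four series are multiplied in \<open>E_prod\<close>; the multiplicative weight \<open>f\<close>
  is the power of \<open>- a\<close> that comes from the second argument \<open>a z\<close>.
\<close>

lemma vertex_pair_series:
  assumes f: "\<And>l r. f (l + r) = f l * f r"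
  shows "Sum_any (\<lambda>k. B i k (Sum_any (\<lambda>l. f l \<cdot> B j l (Sum_any (\<lambda>r. A i r (f (n - k - l - r) \<cdot> A j (n - k - l - r) v)))))) =
    Sum_any (\<lambda>q. f q \<cdot> vertex_pair i j (n - q) q v)"
proof -
  obtain d where d: "v \<in> F d" using F_cover by blast
  define s where "s m = Sum_any (\<lambda>r. f r \<cdot> A i (m - r) (A j r v))" for m
  have s_zero: "s m = 0" if "d < m" for m
    unfolding s_def
  proof (rule Sum_any_all_zero)
    show "f r \<cdot> A i (m - r) (A j r v) = 0" for r
      using AA_nonzero_F[OF _ d, of i "m - r" j r] that by auto
  qed
  have s: "Sum_any (\<lambda>r. A i r (f (m - r) \<cdot> A j (m - r) v)) = s m" for m
    unfolding s_def A_simps by (subst Sum_any_flip[symmetric, of _ m]) simp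
  have fin: "finite {l. f l \<cdot> B j l (s (n - k - l)) \<noteq> 0}" for k
  proof (rule finite_int_box[where K = "\<bar>n\<bar> + \<bar>k\<bar> + \<bar>d\<bar>"])
    fix l assume "f l \<cdot> B j l (s (n - k - l)) \<noteq> 0"
    then have "l \<le> 0" "\<not> d < n - k - l"
      using B_nonzero[of j l "s (n - k - l)"] s_zero[of "n - k - l"] by (auto simp: B_simps)
    then show "\<bar>l\<bar> \<le> \<bar>n\<bar> + \<bar>k\<bar> + \<bar>d\<bar>" by auto
  qed
  have "Sum_any (\<lambda>r. f (l + r) \<cdot> A i (n - k - l - r) (A j r v)) = f l \<cdot> s (n - k - l)" for k l
    unfolding s_def scale_Sum_any by (simp add: f)
  then show ?thesis
    unfolding vertex_pair_sum s by (simp add: lin_Sum_any[OF B_lin fin] B_simps)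
qed

lemma vertex_op_product_distinct:
  assumes "i \<noteq> j"
  shows "vertex_op i p (vertex_op j q v) = vertex_pair i j p q v"
  unfolding vertex_op_def vertex_pair_def
proof (intro Sum_any.cong)
  fix k
  have fin: "finite {l. A i (p - k) (B j l (A j (q - l) v)) \<noteq> 0}"
    by (rule finite_subset[OF _ BA_finite[of j j q v]]) (auto simp: A_simps)
  show "B i k (A i (p - k) (Sum_any (\<lambda>l. B j l (A j (q - l) v)))) =
    Sum_any (\<lambda>l. B i k (B j l (A i (p - k) (A j (q - l) v))))"
    unfolding lin_Sum_any[OF A.V_lin BA_finite] lin_Sum_any[OF B_lin fin]
    by (simp add: A_B_commute[OF assms])
qed

lemma vertex_op_product_same:
  "vertex_op i p (vertex_op i q v) = Sum_any (\<lambda>t. ope_coeff t \<cdot> vertex_pair i i (p - t) (q + t) v)"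
proof -
  obtain d where d: "v \<in> F d" using F_cover by blast
  let ?K = "\<bar>p\<bar> + \<bar>q\<bar> + \<bar>d\<bar>"
  have box: "\<bar>k\<bar> \<le> ?K \<and> \<bar>l\<bar> \<le> ?K \<and> \<bar>t\<bar> \<le> ?K"
    if "ope_coeff t \<cdot> B i k (B i (l + t) (A i (p - k - t) (A i (q - l) v))) \<noteq> 0" for k l t
  proof -
    have "0 \<le> t" using that ope_coeff_neg[of t] by (cases "t < 0") auto
    then show ?thesis
      using BBAA_nonzero[OF _ d, of i k i "l + t" i "p - k - t" i "q - l"] that by auto
  qed
  have "vertex_op i p (vertex_op i q v) =
    Sum_any (\<lambda>k. Sum_any (\<lambda>l. Sum_any (\<lambda>t. ope_coeff t \<cdot> B i k (B i (l + t) (A i (p - k - t) (A i (q - l) v))))))"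
    unfolding vertex_op_def
  proof (intro Sum_any.cong)
    fix k
    have fin: "finite {l. A i (p - k) (B i l (A i (q - l) v)) \<noteq> 0}"
      by (rule finite_subset[OF _ BA_finite[of i i q v]]) (auto simp: A_simps)
    show "B i k (A i (p - k) (Sum_any (\<lambda>l. B i l (A i (q - l) v)))) =
      Sum_any (\<lambda>l. Sum_any (\<lambda>t. ope_coeff t \<cdot> B i k (B i (l + t) (A i (p - k - t) (A i (q - l) v)))))"
      unfolding lin_Sum_any[OF A.V_lin BA_finite] lin_Sum_any[OF B_lin fin]
      by (intro Sum_any.cong) (simp add: A_B_ope lin_Sum_any[OF B_lin ope_finite] B_simps)
  qed
  also have "\<dots> = Sum_any (\<lambda>t. Sum_any (\<lambda>k. Sum_any (\<lambda>l. ope_coeff t \<cdot> B i k (B i l (A i (p - t - k) (A i (q + t - l) v))))))"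
    by (rule Sum_any_reindex3[where \<phi> = "\<lambda>(k, l, t). (t, k, l + t)" and \<psi> = "\<lambda>(t, k, l). (k, l - t, t)", OF box])
      (auto simp: algebra_simps)
  finally show ?thesis unfolding vertex_pair_def scale_Sum_any .
qed

lemma B_alternating:
  "Sum_any (\<lambda>r. (- 1) powi r \<cdot> B i (m - r) (B i r v)) = (if m = 0 then v else 0)"
proof -
  have "Sum_any (\<lambda>r. (- 1) powi r \<cdot> B i (m - r) (B i r v)) =
      Sum_any (\<lambda>r. (- 1) powi r \<cdot> B i (- (- m - r)) (B i (- r) v))"
    by (rule Sum_any_bij[where f = uminus and g = uminus]) (auto simp: minus_one_powi add.commute)
  then show ?thesis unfolding B.alternating_convolution by simp
qed

lemma B_alternating_weighted:
  "Sum_any (\<lambda>r. (of_int r * (- 1) powi r) \<cdot> B i (m - r) (B i r v)) = 2 \<cdot> (if odd m \<and> m < 0 then h i m v else 0)"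
proof -
  have "Sum_any (\<lambda>r. (of_int r * (- 1) powi r) \<cdot> B i (m - r) (B i r v)) =
      Sum_any (\<lambda>r. - ((of_int r * (- 1) powi r) \<cdot> B i (- (- m - r)) (B i (- r) v)))"
    by (rule Sum_any_bij[where f = uminus and g = uminus]) (auto simp: minus_one_powi add.commute)
  then show ?thesis
    unfolding Sum_any_uminus B.alternating_convolution_weighted by auto
qed

text \<open>
  By lemma \<open>alternating_convolution_weighted\<close>, annihilation operators are polynomials in the \<open>A i n\<close> and lower the degree
  as these do.
\<close>

lemma h_vanishes:
  assumes "v \<in> F d" "odd n" "0 < n" "d < n"
  shows "h i n v = 0"
proof -
  have "A i (n - r) (A i r v) = 0" for r
    using AA_nonzero_F[OF _ assms(1), of i "n - r" i r] assms(4) by auto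
  then have "2 \<cdot> h i n v = 0"
    using A.alternating_convolution_weighted[where m = n and i = i and v = v] assms by simp
  then show ?thesis by simp
qed

text \<open>
  At \<open>w = - z\<close> the normally ordered product is the identity, since \<open>E\<^sub>\<plusminus>(\<epsilon>\<^sub>i, z) E\<^sub>\<plusminus>(\<epsilon>\<^sub>i, - z) = 1\<close>.
\<close>

lemma vertex_pair_alternating:
  "Sum_any (\<lambda>q. (- 1) powi q \<cdot> vertex_pair i i (m - q) q v) = (if m = 0 then v else 0)"
proof -
  have "Sum_any (\<lambda>q. (- 1) powi q \<cdot> vertex_pair i i (m - q) q v) =
    Sum_any (\<lambda>k. Sum_any (\<lambda>l. (- 1) powi l \<cdot> B i k (B i l (if l = m - k then v else 0))))"
    unfolding vertex_pair_sum powi_minus_one_add scale_scale[symmetric] scale_Sum_any[symmetric] A.alternating_convolution B_simps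
    by (simp only: diff_eq_eq eq_diff_eq add.commute add.left_commute add_0_left add_0_right eq_commute)
  also have "\<dots> = Sum_any (\<lambda>k. (- 1) powi (m - k) \<cdot> B i k (B i (m - k) v))"
  proof (intro Sum_any.cong)
    show "Sum_any (\<lambda>l. (- 1) powi l \<cdot> B i k (B i l (if l = m - k then v else 0))) =
       (- 1) powi (m - k) \<cdot> B i k (B i (m - k) v)" for k
      by (subst Sum_any_supported_at[of "m - k"]) (auto simp: B_simps)
  qed
  also have "\<dots> = Sum_any (\<lambda>r. (- 1) powi r \<cdot> B i (m - r) (B i r v))"
    by (subst Sum_any_flip[symmetric, of _ m]) simp
  finally show ?thesis by (simp only: B_alternating)
qed

text \<open>
  The derivative of the normally ordered product along \<open>w = - a z\<close> at \<open>a = 1\<close>: the creation operators come from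
  \<open>E\<^sub>-\<close>, the annihilation operators from \<open>E\<^sub>+\<close>.
\<close>

lemma vertex_pair_alternating_weighted:
  "Sum_any (\<lambda>q. (of_int q * (- 1) powi q) \<cdot> vertex_pair i i (m - q) q v) = 2 \<cdot> (if odd m then h i m v else 0)"
proof -
  obtain d where d: "v \<in> F d" using F_cover by blast
  let ?e = "\<lambda>n. if odd n \<and> 0 < n then h i n v else 0"
  have Q: "B i k (B i l (Sum_any (\<lambda>r. (of_int (l + r) * (- 1) powi (l + r)) \<cdot> A i (m - k - l - r) (A i r v)))) =
     (of_int l * (- 1) powi l) \<cdot> B i k (B i l (if l = m - k then v else 0)) +
     (2 * (- 1) powi l) \<cdot> B i k (B i l (?e (m - k - l)))" for k l
  proof -
    have "Sum_any (\<lambda>r. (of_int (l + r) * (- 1) powi (l + r)) \<cdot> A i (m - k - l - r) (A i r v)) =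
       Sum_any (\<lambda>r. (of_int l * (- 1) powi l) \<cdot> (- 1) powi r \<cdot> A i (m - k - l - r) (A i r v) +
         (- 1) powi l \<cdot> (of_int r * (- 1) powi r) \<cdot> A i (m - k - l - r) (A i r v))"
      by (simp add: powi_minus_one_add distrib_right distrib_left scale_left_distrib mult_ac)
    also have "\<dots> = (of_int l * (- 1) powi l) \<cdot> (if m - k - l = 0 then v else 0) + (- 1) powi l \<cdot> 2 \<cdot> ?e (m - k - l)"
    proof -
      have "finite {r. (of_int l * (- 1) powi l) \<cdot> (- 1) powi r \<cdot> A i (m - k - l - r) (A i r v) \<noteq> 0}"
        "finite {r. (- 1) powi l \<cdot> (of_int r * (- 1) powi r) \<cdot> A i (m - k - l - r) (A i r v) \<noteq> 0}"
        unfolding scale_scale by (rule A.VV_finite)+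
      then show ?thesis
        by (simp only: Sum_any.distrib scale_Sum_any[symmetric, of "of_int l * (- 1) powi l"]
            scale_Sum_any[symmetric, of "(- 1) powi l"] A.alternating_convolution A.alternating_convolution_weighted)
    qed
    finally show ?thesis
      by (simp only: B_simps) (auto simp: B_simps mult.commute)
  qed
  have box1: "\<bar>k\<bar> \<le> \<bar>m\<bar> \<and> \<bar>l\<bar> \<le> \<bar>m\<bar>" if "c \<cdot> B i k (B i l (if l = m - k then v else 0)) \<noteq> 0" for c k l
  proof -
    have "l = m - k" using that by (auto simp: B_simps split: if_splits)
    moreover have "l \<le> 0" "k \<le> 0"
      using that BBA_nonzero[OF _ d, of i k i l i 0] A.V_0[of i v] by (auto simp: B_simps split: if_splits)
    ultimately show ?thesis by auto
  qed
  have box2: "\<bar>k\<bar> \<le> \<bar>m\<bar> + \<bar>d\<bar> \<and> \<bar>l\<bar> \<le> \<bar>m\<bar> + \<bar>d\<bar>" if "c \<cdot> B i k (B i l (?e (m - k - l))) \<noteq> 0" for c k l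
  proof -
    have "?e (m - k - l) \<noteq> 0" using that by (auto simp: B_simps split: if_splits)
    then have "m - k - l \<le> d" using h_vanishes[OF d, of "m - k - l" i]
      by (cases "d < m - k - l") (auto split: if_splits)
    moreover obtain d' where "?e (m - k - l) \<in> F d'" using F_cover by blast
    then have "k \<le> 0" "l \<le> 0"
      using that BBA_nonzero[of i k i l i 0 "?e (m - k - l)" d'] A.V_0[of i "?e (m - k - l)"] by auto
    ultimately show ?thesis by auto
  qed
  have X: "Sum_any (\<lambda>k. Sum_any (\<lambda>l. (of_int l * (- 1) powi l) \<cdot> B i k (B i l (if l = m - k then v else 0)))) =
     2 \<cdot> (if odd m \<and> m < 0 then h i m v else 0)"
  proof -
    have "Sum_any (\<lambda>l. (of_int l * (- 1) powi l) \<cdot> B i k (B i l (if l = m - k then v else 0))) =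
       (of_int (m - k) * (- 1) powi (m - k)) \<cdot> B i k (B i (m - k) v)" for k
      by (subst Sum_any_supported_at[of "m - k"]) (auto simp: B_simps)
    then show ?thesis
      unfolding B_alternating_weighted[symmetric] by (subst Sum_any_flip[symmetric, of _ m]) simp
  qed
  have "Sum_any (\<lambda>k. Sum_any (\<lambda>l. (2 * (- 1) powi l) \<cdot> B i k (B i l (?e (m - k - l))))) =
      Sum_any (\<lambda>s. Sum_any (\<lambda>l. (2 * (- 1) powi l) \<cdot> B i (s - l) (B i l (?e (m - s)))))"
  proof (rule Sum_any_reindex2[where \<phi> = "\<lambda>(k, l). (k + l, l)" and \<psi> = "\<lambda>(s, l). (s - l, l)"])
    fix k l assume "(2 * (- 1) powi l) \<cdot> B i k (B i l (?e (m - k - l))) \<noteq> 0"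
    then show "\<bar>k\<bar> \<le> \<bar>m\<bar> + \<bar>d\<bar> \<and> \<bar>l\<bar> \<le> \<bar>m\<bar> + \<bar>d\<bar>" by (rule box2)
  qed (auto simp: diff_diff_eq)
  also have "\<dots> = Sum_any (\<lambda>s. if s = 0 then 2 \<cdot> ?e (m - s) else 0)"
  proof (intro Sum_any.cong)
    show "Sum_any (\<lambda>l. (2 * (- 1) powi l) \<cdot> B i (s - l) (B i l (?e (m - s)))) = (if s = 0 then 2 \<cdot> ?e (m - s) else 0)" for s
      unfolding scale_scale[symmetric] scale_Sum_any[symmetric] B_alternating by simp
  qed
  finally have Y: "Sum_any (\<lambda>k. Sum_any (\<lambda>l. (2 * (- 1) powi l) \<cdot> B i k (B i l (?e (m - k - l))))) = 2 \<cdot> ?e m"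
    by simp
  have "Sum_any (\<lambda>q. (of_int q * (- 1) powi q) \<cdot> vertex_pair i i (m - q) q v) =
     2 \<cdot> (if odd m \<and> m < 0 then h i m v else 0) + 2 \<cdot> ?e m"
    unfolding vertex_pair_sum Q X[symmetric] Y[symmetric]
    by (rule Sum_any_distrib2) (rule box1 box2, assumption)+
  also have "\<dots> = 2 \<cdot> (if odd m then h i m v else 0)"
    by (cases "m = 0") auto
  finally show ?thesis .
qed

end

section \<open>Quadratic expressions in neutral fermions\<close>

text \<open>
  Up to sign, the numbers \<open>1 - sgn q\<close> are the vacuum expectation values of products of two fermions. Differences of them
  appear when products are normally ordered again.
\<close>

definition sgn_sum :: "complex \<Rightarrow> int \<Rightarrow> complex" where
  "sgn_sum x m = Sum_any (\<lambda>q::int. x powi (- q) * of_int (sgn (q + m) - sgn q))"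

lemma sgn_diff_nonzero: "sgn (q + m) - sgn q \<noteq> 0 \<Longrightarrow> \<bar>q\<bar> \<le> \<bar>m\<bar>" for q m :: int
  by (auto simp: sgn_if split: if_splits)

lemma sgn_sum_finite: "finite {q::int. f q * of_int (sgn (q + m) - sgn q) \<noteq> (0::complex)}"
  by (rule finite_int_box[where K = "\<bar>m\<bar>"]) (rule sgn_diff_nonzero, auto)

lemma sgn_sum_Suc:
  assumes "x \<noteq> 0"
  shows "sgn_sum x (m + 1) = sgn_sum x m + x powi m * (1 + x)"
proof -
  have delta: "of_int (sgn (q + (m + 1)) - sgn q) = of_int (sgn (q + m) - sgn q) +
     (of_bool (q = - m) + of_bool (q = - m - 1) :: complex)" for q
    by (cases "q + m" "0 :: int" rule: linorder_cases; cases "q + m = - 1") (auto simp: sgn_if)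
  have "sgn_sum x (m + 1) = Sum_any (\<lambda>q. x powi (- q) * of_int (sgn (q + m) - sgn q) +
      ((if q = - m then x powi (- q) else 0) + (if q = - m - 1 then x powi (- q) else 0)))"
    unfolding sgn_sum_def delta by (intro Sum_any.cong) (simp add: distrib_left)
  also have "\<dots> = sgn_sum x m + (x powi m + x powi (m + 1))"
  proof (subst Sum_any.distrib)
    show "finite {q. (if q = - m then x powi (- q) else 0) + (if q = - m - 1 then x powi (- q) else 0) \<noteq> 0}"
      by (rule finite_subset[of _ "{- m, - m - 1}"]) auto
    show "Sum_any (\<lambda>q. x powi (- q) * of_int (sgn (q + m) - sgn q)) +
       Sum_any (\<lambda>q. (if q = - m then x powi (- q) else 0) + (if q = - m - 1 then x powi (- q) else 0)) =
       sgn_sum x m + (x powi m + x powi (m + 1))"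
      by (subst Sum_any.distrib) (simp_all add: sgn_sum_def add.commute)
  qed (rule sgn_sum_finite)
  finally show ?thesis
    using assms by (simp add: power_int_add distrib_left)
qed

text \<open>
  Induction on \<open>m\<close>: raising \<open>m\<close> by one changes two terms of the sum and adds \<open>x\<^sup>m (1 + x)\<close>. The value at \<open>x = 1\<close> is the
  limit of the other one.
\<close>

lemma sgn_sum_closed:
  assumes "x \<noteq> 0"
  shows "sgn_sum x m = (if x = 1 then 2 * of_int m else (1 - x powi m) * ((1 + x) / (1 - x)))"
proof -
  define g where "g m = (if x = 1 then 2 * of_int m else (1 - x powi m) * ((1 + x) / (1 - x)))" for m
  have g: "g (m + 1) = g m + x powi m * (1 + x)" for m
    using assms by (auto simp: g_def power_int_add field_simps)
  have "sgn_sum x m = g m"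
  proof (induction m rule: int_induct[where k = 0])
    case base
    then show ?case by (simp add: sgn_sum_def g_def)
  next
    case (step1 i)
    then show ?case using g[of i] sgn_sum_Suc[OF assms, of i] by simp
  next
    case (step2 i)
    then show ?case using g[of "i - 1"] sgn_sum_Suc[OF assms, of "i - 1"] by simp
  qed
  then show ?thesis by (simp add: g_def)
qed

text \<open>
  The family \<open>psi i\<close> is a twisted neutral fermion: the sign \<open>(-1)\<^sup>q\<close> reflects that the anticommutator of the generating
  series is supported at \<open>w = - z\<close>.
\<close>

locale fermions = complex_vector_space scale
  for scale :: "complex \<Rightarrow> 'v::ab_group_add \<Rightarrow> 'v" (infixr "\<cdot>" 75) +
  fixes psi :: "'n \<Rightarrow> int \<Rightarrow> 'v \<Rightarrow> 'v"
  assumes psi_lin: "lin scale (psi i n)"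
    and anticommutator: "psi i p (psi j q v) + psi j q (psi i p v) =
      (2 * of_bool (i = j \<and> p + q = 0) * (- 1) powi q) \<cdot> v"
    and psi_truncated: "\<exists>d. \<forall>i n. d < n \<longrightarrow> psi i n v = 0"
begin

lemmas psi_simps = lin_simps[OF psi_lin]

text \<open>
  The scalar subtracted in the normal ordering: it is the whole anticommutator if \<open>q < 0\<close>, half of it
  if \<open>q = 0\<close> and zero if \<open>q > 0\<close>. The symmetric choice at \<open>q = 0\<close> makes normally ordered products skew-symmetric.
\<close>

definition contraction :: "'n \<Rightarrow> 'n \<Rightarrow> int \<Rightarrow> int \<Rightarrow> complex" where
  "contraction i j p q = of_bool (i = j \<and> p + q = 0) * (- 1) powi q * of_int (1 - sgn q)"

definition normal_prod :: "'n \<Rightarrow> 'n \<Rightarrow> int \<Rightarrow> int \<Rightarrow> 'v \<Rightarrow> 'v" where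
  "normal_prod i j p q v = psi i p (psi j q v) - contraction i j p q \<cdot> v"

text \<open>
  The coefficient of \<open>z\<^sup>-\<^sup>m\<close> in the normally ordered product of \<open>\<psi>\<^sub>i(z)\<close> and \<open>\<psi>\<^sub>j(- a z)\<close>.
\<close>

definition quad :: "'n \<Rightarrow> 'n \<Rightarrow> complex \<Rightarrow> int \<Rightarrow> 'v \<Rightarrow> 'v" where
  "quad i j a m v = Sum_any (\<lambda>k. (- a) powi (- k) \<cdot> normal_prod i j (m - k) k v)"

lemma psi_swap: "psi i p (psi j q v) = (2 * of_bool (i = j \<and> p + q = 0) * (- 1) powi q) \<cdot> v - psi j q (psi i p v)"
  using anticommutator[of i p j q v] by (simp add: eq_diff_eq)

lemma normal_prod_skew: "normal_prod j i q p v = - normal_prod i j p q v"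
proof -
  have "contraction i j p q + contraction j i q p = 2 * of_bool (i = j \<and> p + q = 0) * (- 1) powi q"
  proof (cases "i = j \<and> p + q = 0")
    case True
    then have "p = - q" "i = j" by auto
    then show ?thesis by (auto simp: contraction_def minus_one_powi sgn_minus)
  qed (auto simp: contraction_def)
  then show ?thesis
    unfolding normal_prod_def psi_swap[of i p] by (simp add: algebra_simps flip: scale_left_distrib)
qed

lemma normal_prod_lin: "lin scale (normal_prod i j p q)"
  by (rule linI) (simp_all add: normal_prod_def psi_simps scale_right_distrib scale_right_diff_distrib algebra_simps)

lemmas normal_prod_simps = lin_simps[OF normal_prod_lin]

lemma normal_prod_box: "\<exists>K. \<forall>k. normal_prod i j (m - k) k v \<noteq> 0 \<longrightarrow> \<bar>k\<bar> \<le> K"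
proof -
  obtain d where d: "\<And>i n. d < n \<Longrightarrow> psi i n v = 0" using psi_truncated by blast
  have 1: "normal_prod i j p q v = 0" if "\<bar>d\<bar> < q" for i j p q
    using that d[of q] by (simp add: normal_prod_def contraction_def psi_simps)
  have 2: "normal_prod i j (m - k) k v = 0" if "\<bar>d\<bar> < m - k" for k
    using 1[OF that, of j i k] normal_prod_skew[of j i k "m - k" v] by simp
  have "\<bar>k\<bar> \<le> \<bar>m\<bar> + \<bar>d\<bar>" if "normal_prod i j (m - k) k v \<noteq> 0" for k
    using that 1[of k i j "m - k"] 2[of k] by (cases "\<bar>d\<bar> < k"; cases "\<bar>d\<bar> < m - k") auto
  then show ?thesis by blast
qed

lemma quad_finite: "finite {k. c k \<cdot> normal_prod i j (m - k) k v \<noteq> 0}"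
proof -
  obtain K where "\<And>k. normal_prod i j (m - k) k v \<noteq> 0 \<Longrightarrow> \<bar>k\<bar> \<le> K" using normal_prod_box by blast
  then show ?thesis by (intro finite_int_box[where K = K]) auto
qed

lemma quad_lin: "lin scale (quad i j a m)"
proof (rule linI)
  show "quad i j a m (x + y) = quad i j a m x + quad i j a m y" for x y
    unfolding quad_def normal_prod_simps scale_right_distrib by (rule Sum_any.distrib) (rule quad_finite)+
  show "quad i j a m (c \<cdot> x) = c \<cdot> quad i j a m x" for c x
    unfolding quad_def scale_Sum_any by (simp add: normal_prod_simps mult.commute)
qed

lemmas quad_simps = lin_simps[OF quad_lin]

text \<open>
  Exchanging the factors of \<open>:\<psi>\<^sub>j(z) \<psi>\<^sub>i(- a z):\<close> gives \<open>- :\<psi>\<^sub>i(w) \<psi>\<^sub>j(- w / a):\<close> with \<open>w = - a z\<close>. This mirrors the identity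
  \<open>X\<^sup>* = - X\<close> of unitary matrices.
\<close>

lemma quad_skew:
  assumes "a \<noteq> 0"
  shows "quad j i a m v = - ((- a) powi (- m) \<cdot> quad i j (1 / a) m v)"
proof -
  have "quad j i a m v = Sum_any (\<lambda>k. (- a) powi (- (m - k)) \<cdot> normal_prod j i (m - (m - k)) (m - k) v)"
    unfolding quad_def by (rule Sum_any_flip[symmetric])
  also have "\<dots> = Sum_any (\<lambda>k. - ((- a) powi (- m) \<cdot> (- (1 / a)) powi (- k) \<cdot> normal_prod i j (m - k) k v))"
  proof (intro Sum_any.cong)
    fix k
    have "(- a) powi (- (m - k)) = (- a) powi (- m) * (- a) powi k"
      using assms power_int_add[of "- a" "- m" k] by simp
    moreover have "(- (1 / a)) powi (- k) = (- a) powi k"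
      using assms by (simp add: power_int_minus power_int_divide_distrib inverse_eq_divide flip: divide_minus_right)
    ultimately show "(- a) powi (- (m - k)) \<cdot> normal_prod j i (m - (m - k)) (m - k) v =
       - ((- a) powi (- m) \<cdot> (- (1 / a)) powi (- k) \<cdot> normal_prod i j (m - k) k v)"
      by (simp add: normal_prod_skew[of j i])
  qed
  finally show ?thesis unfolding Sum_any_uminus scale_Sum_any quad_def .
qed

text \<open>
  The two terms come from contracting \<open>\<psi>\<^sub>k(n)\<close> with the right and with the left factor; the scalars subtracted in the normal ordering
  do not contribute to a commutator.
\<close>

lemma quad_psi:
  assumes "a \<noteq> 0"
  shows "quad i j a m (psi k n v) = psi k n (quad i j a m v) +
    ((2 * of_bool (j = k) * a powi n) \<cdot> psi i (m + n) v -
     (2 * of_bool (i = k) * (- 1) powi m * a powi (- m - n)) \<cdot> psi j (m + n) v)"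
proof -
  have *: "c \<cdot> normal_prod i j (m - r) r (psi k n v) = psi k n (c \<cdot> normal_prod i j (m - r) r v) +
      ((if r = - n then (c * (2 * of_bool (j = k) * (- 1) powi n)) \<cdot> psi i (m + n) v else 0) -
       (if r = m + n then (c * (2 * of_bool (i = k) * (- 1) powi n)) \<cdot> psi j (m + n) v else 0))" for c r
  proof -
    have "psi i (m - r) (psi j r (psi k n v)) =
        (2 * of_bool (j = k \<and> r + n = 0) * (- 1) powi n) \<cdot> psi i (m - r) v -
        ((2 * of_bool (i = k \<and> m - r + n = 0) * (- 1) powi n) \<cdot> psi j r v - psi k n (psi i (m - r) (psi j r v)))"
      by (simp only: psi_swap[of j r k n] psi_swap[of i "m - r" k n] psi_simps)
    moreover have "r + n = 0 \<longleftrightarrow> r = - n" "m - r + n = 0 \<longleftrightarrow> r = m + n" by auto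
    ultimately show ?thesis
      by (auto simp: normal_prod_def psi_simps scale_right_diff_distrib scale_right_distrib mult.commute)
  qed
  have fin: "finite {r. psi k n ((- a) powi (- r) \<cdot> normal_prod i j (m - r) r v) \<noteq> 0}"
    by (rule finite_subset[OF _ quad_finite[of "\<lambda>r. (- a) powi (- r)" i j m v]]) (auto simp: psi_simps)
  let ?X = "\<lambda>r. if r = - n then ((- a) powi (- r) * (2 * of_bool (j = k) * (- 1) powi n)) \<cdot> psi i (m + n) v else 0"
  let ?Y = "\<lambda>r. if r = m + n then ((- a) powi (- r) * (2 * of_bool (i = k) * (- 1) powi n)) \<cdot> psi j (m + n) v else 0"
  have finX: "finite {r. ?X r \<noteq> 0}" and finY: "finite {r. ?Y r \<noteq> 0}"
    subgoal by (rule finite_subset[of _ "{- n}"]) (auto split: if_splits)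
    subgoal by (rule finite_subset[of _ "{m + n}"]) (auto split: if_splits)
    done
  have finXY: "finite {r. ?X r - ?Y r \<noteq> 0}"
    by (rule finite_subset[OF _ finite_UnI[OF finX finY]]) auto
  have "quad i j a m (psi k n v) = psi k n (quad i j a m v) + (Sum_any ?X - Sum_any ?Y)"
    unfolding quad_def * lin_Sum_any[OF psi_lin quad_finite]
    by (simp only: Sum_any.distrib[OF fin finXY] Sum_any_diff[OF finX finY])
  moreover have "Sum_any ?X = (2 * of_bool (j = k) * a powi n) \<cdot> psi i (m + n) v"
  proof -
    have "(- a) powi n * (2 * of_bool (j = k) * (- 1) powi n) = 2 * of_bool (j = k) * ((- a) powi n * (- 1) powi n)"
      by (simp only: mult_ac)
    also have "(- a) powi n * (- 1) powi n = a powi n"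
      by (simp flip: power_int_mult_distrib)
    finally show ?thesis
      by (subst Sum_any_supported_at[of "- n"]) simp_all
  qed
  moreover have "Sum_any ?Y = (2 * of_bool (i = k) * (- 1) powi m * a powi (- m - n)) \<cdot> psi j (m + n) v"
  proof -
    have "(- a) powi (- (m + n)) = (- 1) powi (- (m + n)) * a powi (- (m + n))"
      by (simp flip: power_int_mult_distrib)
    then have "(- a) powi (- (m + n)) * (2 * of_bool (i = k) * (- 1) powi n) =
        2 * of_bool (i = k) * (- 1) powi m * a powi (- m - n)"
      by (simp add: minus_one_powi)
    then show ?thesis
      by (subst Sum_any_supported_at[of "m + n"]) simp_all
  qed
  ultimately show ?thesis by (simp only:)
qed

text \<open>
  The part of the commutator of two quadratic expressions in which \<open>j\<close> is contracted with \<open>k\<close> and \<open>i\<close> with \<open>l\<close>. It corresponds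
  to the bracket of two matrix units in the centrally extended general linear algebra.
\<close>

definition quad_bracket ::
    "'n \<Rightarrow> 'n \<Rightarrow> complex \<Rightarrow> int \<Rightarrow> 'n \<Rightarrow> 'n \<Rightarrow> complex \<Rightarrow> int \<Rightarrow> 'v \<Rightarrow> 'v" where
  "quad_bracket i j a m k l b n v =
    (2 * of_bool (j = k) * a powi n) \<cdot> quad i l (a * b) (m + n) v
    - (2 * of_bool (i = l) * b powi m) \<cdot> quad k j (a * b) (m + n) v
    + (2 * of_bool (j = k \<and> i = l \<and> m + n = 0) * a powi n * sgn_sum (a * b) m) \<cdot> v"

text \<open>
  By lemma \<open>quad_psi\<close> the commutator of \<open>quad i j a m\<close> with \<open>\<psi>\<^sub>k(p) \<psi>\<^sub>l(q)\<close> has four terms. The two collected here contract \<open>j\<close> with \<open>k\<close>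
  and \<open>i\<close> with \<open>l\<close>; the other two contract \<open>j\<close> with \<open>l\<close> and \<open>i\<close> with \<open>k\<close>.
\<close>

definition half_bracket ::
    "'n \<Rightarrow> 'n \<Rightarrow> complex \<Rightarrow> int \<Rightarrow> 'n \<Rightarrow> 'n \<Rightarrow> int \<Rightarrow> int \<Rightarrow> 'v \<Rightarrow> 'v" where
  "half_bracket i j a m k l p q v =
    (2 * of_bool (j = k) * a powi p) \<cdot> psi i (m + p) (psi l q v)
    - (2 * of_bool (i = l) * (- 1) powi m * a powi (- m - q)) \<cdot> psi k p (psi j (m + q) v)"

text \<open>
  The remaining two terms have the same form with the roles of \<open>k\<close> and \<open>l\<close> exchanged: reversing the order of the two
  fermions produces one scalar in each term, and these scalars cancel.
\<close>

lemma half_bracket_swap: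
  "(2 * of_bool (j = l) * a powi q) \<cdot> psi k p (psi i (m + q) v) -
   (2 * of_bool (i = k) * (- 1) powi m * a powi (- m - p)) \<cdot> psi j (m + p) (psi l q v) =
   - half_bracket i j a m l k q p v"
proof -
  have *: "(2 * of_bool (j = l) * a powi q) * (2 * of_bool (k = i \<and> p + (m + q) = 0) * (- 1) powi (m + q)) =
    (2 * of_bool (i = k) * (- 1) powi m * a powi (- m - p)) * (2 * of_bool (j = l \<and> m + p + q = 0) * (- 1) powi q)"
  proof (cases "p + (m + q) = 0")
    case True
    then have "- m - p = q" by simp
    then have "a powi (- m - p) = a powi q" by (simp only:)
    then show ?thesis using True by (auto simp: powi_minus_one_add)
  qed auto
  show ?thesis
    unfolding half_bracket_def psi_swap[of k p i] psi_swap[of j "m + p" l] scale_right_diff_distrib scale_scale *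
    by simp
qed

text \<open>
  Each of the two terms becomes a normally ordered product with coefficient a power of \<open>a b\<close>. The second one is
  indexed by \<open>q + m\<close>, so the difference of the two contractions is \<open>sgn (q + m) - sgn q\<close> up to a factor.
\<close>

lemma half_bracket_normal:
  assumes "a \<noteq> 0" "b \<noteq> 0"
  shows "(- b) powi (- q) \<cdot> half_bracket i j a m k l (n - q) q v =
    (2 * of_bool (j = k) * a powi n) \<cdot> (- (a * b)) powi (- q) \<cdot> normal_prod i l (m + n - q) q v
    - (2 * of_bool (i = l) * b powi m) \<cdot> (- (a * b)) powi (- (q + m)) \<cdot> normal_prod k j (m + n - (q + m)) (q + m) v
    + (2 * of_bool (j = k \<and> i = l \<and> m + n = 0) * a powi n * ((a * b) powi (- q) * of_int (sgn (q + m) - sgn q))) \<cdot> v"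
proof -
  have ab: "- (a * b) = (- 1) * (a * b)" and mb: "- b = (- 1) * b" by simp_all
  have c1: "(- b) powi (- q) * a powi (n - q) = a powi n * (- (a * b)) powi (- q)"
  proof -
    have "(- (a * b)) powi (- q) = a powi (- q) * (- b) powi (- q)"
      using power_int_mult_distrib[of a "- b" "- q"] by (simp only: mult_minus_right)
    moreover have "a powi (n - q) = a powi n * a powi (- q)"
      using power_int_add[of a n "- q"] assms by simp
    ultimately show ?thesis by (simp only: mult_ac)
  qed
  have c4: "(- b) powi (- q) * ((- 1) powi m * a powi (- m - q)) = b powi m * (- (a * b)) powi (- (q + m))"
  proof -
    have "(- (a * b)) powi (- (q + m)) = (- b) powi (- q) * a powi (- m - q) * (- b) powi (- m)"
      using power_int_mult_distrib[of a "- b" "- (q + m)"] power_int_add[of "- b" "- q" "- m"] assms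
      by (simp only: mult_minus_right) (simp add: algebra_simps)
    moreover have "(- 1) powi m = b powi m * (- b) powi (- m)"
      unfolding mb using assms by (simp add: power_int_mult_distrib power_int_minus minus_one_powi)
    ultimately show ?thesis by (simp only: mult_ac)
  qed
  have con1: "a powi n * (- (a * b)) powi (- q) * ((- 1) powi q * of_int (1 - sgn q)) = a powi n * ((a * b) powi (- q) * of_int (1 - sgn q))"
    unfolding ab using assms
    by (simp add: power_int_mult_distrib power_int_minus minus_one_powi)
  have con4: "b powi m * (- (a * b)) powi (- (q + m)) * ((- 1) powi (q + m) * of_int (1 - sgn (q + m))) =
      a powi n * ((a * b) powi (- q) * of_int (1 - sgn (q + m)))" if "m + n = 0"
  proof -
    have n: "n = - m" using that by simp
    have "(- (a * b)) powi (- (q + m)) * (- 1) powi (q + m) = (a * b) powi (- (q + m))"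
      unfolding ab by (simp add: power_int_mult_distrib minus_one_powi)
    also have "\<dots> = (a * b) powi (- q) * (a powi n * b powi n)"
      using power_int_add[of "a * b" "- q" n] assms n by (simp add: power_int_mult_distrib)
    finally have "b powi m * ((- (a * b)) powi (- (q + m)) * (- 1) powi (q + m)) =
        (b powi m * b powi n) * a powi n * (a * b) powi (- q)"
      by (simp only: mult_ac)
    also have "b powi m * b powi n = 1"
      using assms n by (simp add: power_int_minus)
    finally show ?thesis by (simp add: mult.assoc[symmetric])
  qed
  have con: "2 * of_bool (j = k) * (a powi n * (- (a * b)) powi (- q)) * contraction i l (m + n - q) q -
     2 * of_bool (i = l) * (b powi m * (- (a * b)) powi (- (q + m))) * contraction k j (n - q) (q + m) =
     2 * of_bool (j = k \<and> i = l \<and> m + n = 0) * a powi n * ((a * b) powi (- q) * of_int (sgn (q + m) - sgn q))"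
  proof (cases "j = k \<and> i = l \<and> m + n = 0")
    case True
    have "2 * (a powi n * (- (a * b)) powi (- q) * ((- 1) powi q * of_int (1 - sgn q))) -
      2 * (b powi m * (- (a * b)) powi (- (q + m)) * ((- 1) powi (q + m) * of_int (1 - sgn (q + m)))) =
      2 * a powi n * ((a * b) powi (- q) * of_int (sgn (q + m) - sgn q))"
      using True by (simp only: con1 con4) (simp add: algebra_simps)
    then show ?thesis
      using True by (simp add: contraction_def mult.assoc)
  next
    case False
    then show ?thesis by (auto simp: contraction_def)
  qed
  have np1: "psi i (m + (n - q)) (psi l q v) = normal_prod i l (m + n - q) q v + contraction i l (m + n - q) q \<cdot> v"
    by (simp add: normal_prod_def add_diff_eq)
  have np4: "psi k (n - q) (psi j (m + q) v) =
      normal_prod k j (m + n - (q + m)) (q + m) v + contraction k j (n - q) (q + m) \<cdot> v"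
    by (simp add: normal_prod_def add.commute)
  have "(- b) powi (- q) \<cdot> half_bracket i j a m k l (n - q) q v =
    (2 * of_bool (j = k) * ((- b) powi (- q) * a powi (n - q))) \<cdot> psi i (m + (n - q)) (psi l q v)
    - (2 * of_bool (i = l) * ((- b) powi (- q) * ((- 1) powi m * a powi (- m - q)))) \<cdot> psi k (n - q) (psi j (m + q) v)"
    unfolding half_bracket_def scale_right_diff_distrib scale_scale by (simp only: mult_ac)
  then show ?thesis
    unfolding np1 np4 c1 c4 con[symmetric]
    by (simp add: scale_right_distrib scale_left_diff_distrib mult_ac)
qed

text \<open>
  Each of the two contractions may be nonzero for infinitely many \<open>q\<close>, but they agree for all but finitely many.
  The sum of their differences is \<open>sgn_sum\<close>.
\<close>

lemma half_bracket_sum: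
  assumes "a \<noteq> 0" "b \<noteq> 0"
  shows "finite {q. (- b) powi (- q) \<cdot> half_bracket i j a m k l (n - q) q v \<noteq> 0}"
    and "Sum_any (\<lambda>q. (- b) powi (- q) \<cdot> half_bracket i j a m k l (n - q) q v) = quad_bracket i j a m k l b n v"
proof -
  let ?X = "\<lambda>q. (2 * of_bool (j = k) * a powi n) \<cdot> (- (a * b)) powi (- q) \<cdot> normal_prod i l (m + n - q) q v"
  let ?Y' = "\<lambda>q. (2 * of_bool (i = l) * b powi m) \<cdot> (- (a * b)) powi (- q) \<cdot> normal_prod k j (m + n - q) q v"
  let ?Y = "\<lambda>q. ?Y' (q + m)"
  let ?s = "\<lambda>q. (a * b) powi (- q) * of_int (sgn (q + m) - sgn q)"
  let ?c = "2 * of_bool (j = k \<and> i = l \<and> m + n = 0) * a powi n"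
  let ?Z = "\<lambda>q. (?c * ?s q) \<cdot> v"
  have finX: "finite {q. ?X q \<noteq> 0}" and finY': "finite {q. ?Y' q \<noteq> 0}"
    unfolding scale_scale by (rule quad_finite)+
  have "{q. ?Y q \<noteq> 0} \<subseteq> (\<lambda>q. q - m) ` {q. ?Y' q \<noteq> 0}"
  proof
    fix q assume "q \<in> {q. ?Y q \<noteq> 0}"
    then show "q \<in> (\<lambda>q. q - m) ` {q. ?Y' q \<noteq> 0}"
      using assms by (intro image_eqI[of _ _ "q + m"]) simp_all
  qed
  then have finY: "finite {q. ?Y q \<noteq> 0}"
    using finY' finite_surj by blast
  have finZ: "finite {q. ?Z q \<noteq> 0}"
    by (rule finite_subset[OF _ sgn_sum_finite[of "\<lambda>q. (a * b) powi (- q)" m]]) auto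
  have finXY: "finite {q. ?X q - ?Y q \<noteq> 0}"
    by (rule finite_subset[OF _ finite_UnI[OF finX finY]]) force
  have *: "(- b) powi (- q) \<cdot> half_bracket i j a m k l (n - q) q v = ?X q - ?Y q + ?Z q" for q
    by (rule half_bracket_normal[OF assms])
  show "finite {q. (- b) powi (- q) \<cdot> half_bracket i j a m k l (n - q) q v \<noteq> 0}"
    unfolding * by (rule finite_subset[OF _ finite_UnI[OF finXY finZ]]) force
  have Z: "Sum_any ?Z = (?c * sgn_sum (a * b) m) \<cdot> v"
  proof -
    have "sgn_sum (a * b) m \<cdot> v = Sum_any (\<lambda>q. ?s q \<cdot> v)"
      unfolding sgn_sum_def by (rule Sum_any_hom) (simp_all only: scale_zero_left scale_left_distrib sgn_sum_finite)
    then have "?c \<cdot> sgn_sum (a * b) m \<cdot> v = ?c \<cdot> Sum_any (\<lambda>q. ?s q \<cdot> v)" by simp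
    then show ?thesis unfolding scale_Sum_any scale_scale by simp
  qed
  have Y: "Sum_any ?Y = Sum_any ?Y'"
    by (rule Sum_any_shift)
  show "Sum_any (\<lambda>q. (- b) powi (- q) \<cdot> half_bracket i j a m k l (n - q) q v) = quad_bracket i j a m k l b n v"
    unfolding * Sum_any.distrib[OF finXY finZ] Sum_any_diff[OF finX finY] Y Z
    by (simp only: quad_bracket_def quad_def scale_Sum_any)
qed

lemma quad_commutator:
  assumes "a \<noteq> 0" "b \<noteq> 0"
  shows "quad i j a m (quad k l b n v) - quad k l b n (quad i j a m v) =
    quad_bracket i j a m k l b n v -
    ((- 1) powi n * b powi (- n)) \<cdot> quad_bracket i j a m l k (1 / b) n v"
proof -
  let ?H = "\<lambda>q. (- b) powi (- q) \<cdot> half_bracket i j a m k l (n - q) q v"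
  let ?H' = "\<lambda>q. (- (1 / b)) powi (- q) \<cdot> half_bracket i j a m l k (n - q) q v"
  let ?c = "(- 1) powi n * b powi (- n)"
  have comm: "quad i j a m (normal_prod k l p q v) - normal_prod k l p q (quad i j a m v) =
     half_bracket i j a m k l p q v - half_bracket i j a m l k q p v" for p q
  proof -
    have "quad i j a m (normal_prod k l p q v) - normal_prod k l p q (quad i j a m v) =
       half_bracket i j a m k l p q v + ((2 * of_bool (j = l) * a powi q) \<cdot> psi k p (psi i (m + q) v) -
   (2 * of_bool (i = k) * (- 1) powi m * a powi (- m - p)) \<cdot> psi j (m + p) (psi l q v))"
      unfolding normal_prod_def quad_simps quad_psi[OF assms(1)] psi_simps half_bracket_def
      by (simp add: algebra_simps)
    then show ?thesis unfolding half_bracket_swap by simp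
  qed
  \<comment> \<open>The substitution of \<open>n - q\<close> for \<open>q\<close> turns the weights of \<open>\<psi>\<^sub>k(n - q) \<psi>\<^sub>l(q)\<close> into those of \<open>\<psi>\<^sub>l \<psi>\<^sub>k\<close> with parameter \<open>1 / b\<close>.\<close>
  have scal: "(- b) powi (- q) = ?c * (- (1 / b)) powi (- (n - q))" for q
  proof -
    have "- (1 / b) = inverse (- b)" by (simp add: inverse_eq_divide)
    then have "(- (1 / b)) powi (- (n - q)) = (- b) powi (n - q)"
      by (simp only: power_int_inverse power_int_minus inverse_inverse_eq)
    moreover have "?c = (- b) powi (- n)"
      using power_int_mult_distrib[of "- 1" b "- n"] by (simp add: minus_one_powi)
    moreover have "(- b) powi (- n) * (- b) powi (n - q) = (- b) powi (- q)"
      using assms power_int_add[of "- b" "- n" "n - q"] by simp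
    ultimately show ?thesis by simp
  qed
  have fin1: "finite {q. quad i j a m ((- b) powi (- q) \<cdot> normal_prod k l (n - q) q v) \<noteq> 0}"
    by (rule finite_subset[OF _ quad_finite[of "\<lambda>q. (- b) powi (- q)" k l n v]]) (auto simp: quad_simps)
  have fin': "finite {q. (?c \<cdot> ?H' (n - q)) \<noteq> 0}"
  proof (rule finite_subset)
    show "{q. (?c \<cdot> ?H' (n - q)) \<noteq> 0} \<subseteq> (\<lambda>q. n - q) ` {q. ?H' q \<noteq> 0}"
    proof
      fix q assume "q \<in> {q. (?c \<cdot> ?H' (n - q)) \<noteq> 0}"
      then show "q \<in> (\<lambda>q. n - q) ` {q. ?H' q \<noteq> 0}"
        by (intro image_eqI[of _ _ "n - q"]) auto
    qed
  qed (use assms in \<open>intro finite_imageI half_bracket_sum; simp\<close>)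
  have "quad i j a m (quad k l b n v) - quad k l b n (quad i j a m v) =
     Sum_any (\<lambda>q. quad i j a m ((- b) powi (- q) \<cdot> normal_prod k l (n - q) q v)
       - (- b) powi (- q) \<cdot> normal_prod k l (n - q) q (quad i j a m v))"
    unfolding Sum_any_diff[OF fin1 quad_finite] unfolding quad_def[of k l] lin_Sum_any[OF quad_lin quad_finite] ..
  also have "\<dots> = Sum_any (\<lambda>q. ?H q - ?c \<cdot> ?H' (n - q))"
  proof (intro Sum_any.cong)
    fix q
    have "quad i j a m ((- b) powi (- q) \<cdot> normal_prod k l (n - q) q v)
       - (- b) powi (- q) \<cdot> normal_prod k l (n - q) q (quad i j a m v) =
       (- b) powi (- q) \<cdot> (half_bracket i j a m k l (n - q) q v - half_bracket i j a m l k q (n - q) v)"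
      by (simp only: quad_simps comm flip: scale_right_diff_distrib)
    also have "\<dots> = ?H q - (- b) powi (- q) \<cdot> half_bracket i j a m l k q (n - q) v"
      by (rule scale_right_diff_distrib)
    also have "(- b) powi (- q) \<cdot> half_bracket i j a m l k q (n - q) v = ?c \<cdot> ?H' (n - q)"
      unfolding scale_scale scal[symmetric] by simp
    finally show "quad i j a m ((- b) powi (- q) \<cdot> normal_prod k l (n - q) q v)
       - (- b) powi (- q) \<cdot> normal_prod k l (n - q) q (quad i j a m v) = ?H q - ?c \<cdot> ?H' (n - q)" .
  qed
  also have "\<dots> = Sum_any ?H - ?c \<cdot> Sum_any ?H'"
    unfolding Sum_any_diff[OF half_bracket_sum(1)[OF assms] fin']
    unfolding scale_Sum_any[symmetric] Sum_any_flip[of ?H' n] ..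
  finally show ?thesis
    using assms by (simp add: half_bracket_sum(2))
qed

end

section \<open>Fermions as vertex operators\<close>

text \<open>
  The operators \<open>g i\<close> stand for the multiplication by \<open>e\<^bsup>\<epsilon>\<^sub>i\<^esup>\<close> in the twisted group algebra.
\<close>

locale fermionic_vertex_operators = vertex_operators scale h A B F
  for scale :: "complex \<Rightarrow> 'v::ab_group_add \<Rightarrow> 'v" (infixr "\<cdot>" 75)
    and h A B :: "'n \<Rightarrow> int \<Rightarrow> 'v \<Rightarrow> 'v" and F :: "int \<Rightarrow> 'v set" +
  fixes g :: "'n \<Rightarrow> 'v \<Rightarrow> 'v"
  assumes g_lin: "lin scale (g i)"
    and g_A: "g i (A j n v) = A j n (g i v)"
    and g_B: "g i (B j n v) = B j n (g i v)"
    and g_square: "g i (g i v) = v"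
    and g_anticommute: "i \<noteq> j \<Longrightarrow> g i (g j v) = - g j (g i v)"
begin

lemmas g_simps = lin_simps[OF g_lin]

definition fermion :: "'n \<Rightarrow> int \<Rightarrow> 'v \<Rightarrow> 'v" where
  "fermion i n v = g i (vertex_op i n v)"

lemma g_vertex_op: "g i (vertex_op j n v) = vertex_op j n (g i v)"
  unfolding vertex_op_def lin_Sum_any[OF g_lin BA_finite] by (simp add: g_A g_B)

lemma fermion_fermion: "fermion i p (fermion j q v) = g i (g j (vertex_op i p (vertex_op j q v)))"
  by (simp add: fermion_def g_vertex_op)

lemma vertex_pair_finite: "finite {r. c r \<cdot> vertex_pair i j (m - r) (r + n) v \<noteq> 0}"
proof -
  obtain d where d: "v \<in> F d" using F_cover by blast
  show ?thesis
  proof (rule finite_int_box[where K = "\<bar>m\<bar> + \<bar>n\<bar> + \<bar>d\<bar>"])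
    fix r assume "c r \<cdot> vertex_pair i j (m - r) (r + n) v \<noteq> 0"
    then have "\<not> (d < m - r \<or> d < r + n)" using vertex_pair_vanishes[OF d, of "m - r" "r + n" i j] by auto
    then show "\<bar>r\<bar> \<le> \<bar>m\<bar> + \<bar>n\<bar> + \<bar>d\<bar>" by auto
  qed
qed

text \<open>
  The two operator products are the same normally ordered product times \<open>(1 - w/z) / (1 + w/z)\<close> and times
  \<open>(1 - z/w) / (1 + z/w)\<close>. These are opposite rational functions expanded in opposite directions, so their sum is a delta
  function; it specializes the normally ordered product to \<open>w = - z\<close>, where it is the identity.
\<close>

lemma vertex_op_anticommutator:
  "vertex_op i p (vertex_op i q v) + vertex_op i q (vertex_op i p v) = (2 * of_bool (p + q = 0) * (- 1) powi q) \<cdot> v"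
proof -
  have "vertex_op i q (vertex_op i p v) = Sum_any (\<lambda>t. ope_coeff (- t) \<cdot> vertex_pair i i (q - (- t)) (p + (- t)) v)"
    unfolding vertex_op_product_same by (rule Sum_any_bij[where f = uminus and g = uminus]) auto
  also have "\<dots> = Sum_any (\<lambda>t. ope_coeff (- t) \<cdot> vertex_pair i i (p - t) (t + q) v)"
  proof (intro Sum_any.cong)
    show "ope_coeff (- t) \<cdot> vertex_pair i i (q - (- t)) (p + (- t)) v = ope_coeff (- t) \<cdot> vertex_pair i i (p - t) (t + q) v" for t
      using vertex_pair_swap[of i i "q - (- t)" "p + (- t)" v] by (simp add: add.commute)
  qed
  finally have "vertex_op i p (vertex_op i q v) + vertex_op i q (vertex_op i p v) =
    Sum_any (\<lambda>t. (ope_coeff t + ope_coeff (- t)) \<cdot> vertex_pair i i (p - t) (t + q) v)"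
    unfolding vertex_op_product_same by (simp add: scale_left_distrib Sum_any.distrib[OF vertex_pair_finite vertex_pair_finite] add.commute)
  also have "\<dots> = Sum_any (\<lambda>r. (2 * (- 1) powi q) \<cdot> (- 1) powi r \<cdot> vertex_pair i i (p + q - r) r v)"
    unfolding ope_coeff_sym
    by (rule Sum_any_bij[where f = "\<lambda>r. r - q" and g = "\<lambda>r. r + q"])
      (auto simp: minus_one_powi diff_diff_eq2)
  also have "\<dots> = (2 * of_bool (p + q = 0) * (- 1) powi q) \<cdot> v"
    unfolding scale_Sum_any[symmetric] vertex_pair_alternating by auto
  finally show ?thesis .
qed

sublocale fermions scale fermion
proof (intro fermions.intro fermions_axioms.intro complex_vector_space_axioms)
  fix i j :: 'n and p q n :: int and v :: 'v
  show "lin scale (fermion i n)"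
    by (rule linI) (simp_all add: fermion_def g_simps lin_simps[OF vertex_op_lin])
  show "fermion i p (fermion j q v) + fermion j q (fermion i p v) =
     (2 * of_bool (i = j \<and> p + q = 0) * (- 1) powi q) \<cdot> v"
  proof (cases "i = j")
    case True
    then show ?thesis using vertex_op_anticommutator[of i p q v] by (simp add: fermion_fermion g_square)
  next
    case False
    then show ?thesis
      by (simp add: fermion_fermion vertex_op_product_distinct g_anticommute[of i j] vertex_pair_swap[of i j])
  qed
  obtain d where d: "v \<in> F d" using F_cover by blast
  have "fermion i n v = 0" if "d < n" for i n
    using vertex_op_vanishes[OF d that] by (simp add: fermion_def g_simps)
  then show "\<exists>d. \<forall>i n. d < n \<longrightarrow> fermion i n v = 0" by blast
qed

lemma quad_distinct:
  assumes "i \<noteq> j"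
  shows "quad i j a m v = g i (g j (Sum_any (\<lambda>q. (- a) powi (- q) \<cdot> vertex_pair i j (m - q) q v)))"
proof -
  have fin: "finite {q. (- a) powi (- q) \<cdot> vertex_pair i j (m - q) q v \<noteq> 0}"
    using vertex_pair_finite[of "\<lambda>q. (- a) powi (- q)" i j m 0 v] by simp
  have fin': "finite {q. g j ((- a) powi (- q) \<cdot> vertex_pair i j (m - q) q v) \<noteq> 0}"
    by (rule finite_subset[OF _ fin]) (auto simp: g_simps)
  show ?thesis
    unfolding quad_def lin_Sum_any[OF g_lin fin] lin_Sum_any[OF g_lin fin']
    using assms by (simp add: g_simps normal_prod_def contraction_def fermion_fermion vertex_op_product_distinct)
qed

text \<open>
  The scalar \<open>contraction i i (m - q) q\<close> is itself expanded by lemma \<open>vertex_pair_alternating\<close>. Subtracting it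
  makes the coefficients vanish for all but finitely many \<open>q\<close>, so that the sum over \<open>q\<close> may be carried out first.
\<close>

lemma normal_prod_same:
  "normal_prod i i (m - q) q v =
    Sum_any (\<lambda>r. ((- 1) powi (q + r) * of_int (sgn (r - q) + sgn q)) \<cdot> vertex_pair i i (m - r) r v)"
proof -
  have fin: "finite {r. c r \<cdot> vertex_pair i i (m - r) r v \<noteq> 0}" for c
    using vertex_pair_finite[of c i i m 0 v] by simp
  have "fermion i (m - q) (fermion i q v) = Sum_any (\<lambda>t. ope_coeff t \<cdot> vertex_pair i i (m - q - t) (q + t) v)"
    by (simp add: fermion_fermion g_square vertex_op_product_same)
  also have "\<dots> = Sum_any (\<lambda>r. ope_coeff (r - q) \<cdot> vertex_pair i i (m - r) r v)"
    by (rule Sum_any_bij[where f = "\<lambda>r. r - q" and g = "\<lambda>t. t + q"]) auto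
  moreover have "contraction i i (m - q) q \<cdot> v =
     Sum_any (\<lambda>r. ((- 1) powi q * of_int (1 - sgn q)) \<cdot> (- 1) powi r \<cdot> vertex_pair i i (m - r) r v)"
    unfolding scale_Sum_any[symmetric] vertex_pair_alternating by (auto simp: contraction_def)
  ultimately have "normal_prod i i (m - q) q v = Sum_any (\<lambda>r. ope_coeff (r - q) \<cdot> vertex_pair i i (m - r) r v -
      ((- 1) powi q * of_int (1 - sgn q)) \<cdot> (- 1) powi r \<cdot> vertex_pair i i (m - r) r v)"
    by (simp only: normal_prod_def scale_scale Sum_any_diff[OF fin fin])
  also have "\<dots> = Sum_any (\<lambda>r. ((- 1) powi (q + r) * of_int (sgn (r - q) + sgn q)) \<cdot> vertex_pair i i (m - r) r v)"
  proof (intro Sum_any.cong)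
    fix r
    have "ope_coeff (r - q) - (- 1) powi q * of_int (1 - sgn q) * (- 1) powi r =
      (- 1) powi (q + r) * of_int (sgn (r - q) + sgn q)"
      by (auto simp: ope_coeff_def minus_one_powi)
    then show "ope_coeff (r - q) \<cdot> vertex_pair i i (m - r) r v -
      ((- 1) powi q * of_int (1 - sgn q)) \<cdot> (- 1) powi r \<cdot> vertex_pair i i (m - r) r v =
      ((- 1) powi (q + r) * of_int (sgn (r - q) + sgn q)) \<cdot> vertex_pair i i (m - r) r v"
      by (simp flip: scale_left_diff_distrib)
  qed
  finally show ?thesis .
qed

text \<open>
  Collecting the terms of the quadratic expression by the degree \<open>r\<close> of the second variable of the normally ordered product
  leaves a finite geometric sum as coefficient. Its value distinguishes the cases \<open>a = 1\<close> and \<open>a \<noteq> 1\<close>.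
\<close>

lemma quad_same_sgn_sum:
  "quad i i a m v = Sum_any (\<lambda>r. (- sgn_sum a (- r) * (- 1) powi r) \<cdot> vertex_pair i i (m - r) r v)"
proof -
  obtain d where d: "v \<in> F d" using F_cover by blast
  let ?f = "\<lambda>q r. ((- 1) powi r * (a powi (- q) * of_int (sgn (r - q) + sgn q))) \<cdot> vertex_pair i i (m - r) r v"
  have box: "\<bar>q\<bar> \<le> \<bar>m\<bar> + \<bar>d\<bar> \<and> \<bar>r\<bar> \<le> \<bar>m\<bar> + \<bar>d\<bar>" if "?f q r \<noteq> 0" for q r
  proof -
    have "\<not> (d < m - r \<or> d < r)" using that vertex_pair_vanishes[OF d, of "m - r" r i i] by auto
    moreover have "sgn (q + - r) - sgn q \<noteq> 0"
      using that by (auto simp: sgn_if split: if_splits)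
    then have "\<bar>q\<bar> \<le> \<bar>- r\<bar>" by (rule sgn_diff_nonzero)
    ultimately show ?thesis by auto
  qed
  have "quad i i a m v = Sum_any (\<lambda>q. Sum_any (\<lambda>r. ?f q r))"
  proof -
    have "(- a) powi (- q) * ((- 1) powi (q + r) * s) = (- 1) powi r * (a powi (- q) * s)" for q r :: int and s
    proof -
      have "(- a) powi (- q) = (- 1) powi (- q) * a powi (- q)"
        by (simp flip: power_int_mult_distrib)
      then show ?thesis by (simp add: minus_one_powi)
    qed
    then show ?thesis
      unfolding quad_def normal_prod_same scale_Sum_any scale_scale by (simp only:)
  qed
  also have "\<dots> = Sum_any (\<lambda>r. Sum_any (\<lambda>q. ?f q r))"
    by (rule Sum_any_reindex2[where \<phi> = "\<lambda>(q, r). (r, q)" and \<psi> = "\<lambda>(r, q). (q, r)", OF box]) auto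
  also have "\<dots> = Sum_any (\<lambda>r. (- sgn_sum a (- r) * (- 1) powi r) \<cdot> vertex_pair i i (m - r) r v)"
  proof (intro Sum_any.cong)
    fix r :: int
    have flip: "sgn (r - q) + sgn q = - (sgn (q + - r) - sgn q)" for q
      by (auto simp: sgn_if)
    have "Sum_any (\<lambda>q. (a powi (- q) * of_int (sgn (r - q) + sgn q)) \<cdot> vertex_pair i i (m - r) r v) =
        - Sum_any (\<lambda>q. (a powi (- q) * of_int (sgn (q + - r) - sgn q)) \<cdot> vertex_pair i i (m - r) r v)"
      unfolding flip Sum_any_uminus[symmetric] by (intro Sum_any.cong) (simp only: of_int_minus mult_minus_right scale_minus_left)
    also have "\<dots> = - (sgn_sum a (- r) \<cdot> vertex_pair i i (m - r) r v)"
      unfolding sgn_sum_def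
      by (subst Sum_any_hom[of "\<lambda>c. c \<cdot> vertex_pair i i (m - r) r v"])
        (simp_all only: scale_zero_left scale_left_distrib sgn_sum_finite)
    finally show "Sum_any (\<lambda>q. ?f q r) = (- sgn_sum a (- r) * (- 1) powi r) \<cdot> vertex_pair i i (m - r) r v"
      unfolding scale_scale[symmetric] scale_Sum_any[symmetric] by (simp add: mult.commute)
  qed
  finally show ?thesis .
qed

text \<open>
  The inverse of the boson-fermion correspondence: Heisenberg operators are quadratic in the fermions.
\<close>

lemma quad_same_one: "quad i i 1 m v = 4 \<cdot> (if odd m then h i m v else 0)"
proof -
  have "quad i i 1 m v = 2 \<cdot> Sum_any (\<lambda>r. (of_int r * (- 1) powi r) \<cdot> vertex_pair i i (m - r) r v)"
    unfolding quad_same_sgn_sum scale_Sum_any by (simp add: sgn_sum_closed mult.assoc)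
  then show ?thesis unfolding vertex_pair_alternating_weighted by simp
qed

lemma quad_same:
  assumes "a \<noteq> 0" "a \<noteq> 1"
  shows "quad i i a m v = ((1 + a) / (1 - a)) \<cdot>
    (Sum_any (\<lambda>q. (- a) powi (- q) \<cdot> vertex_pair i i (m - q) q v) - (if m = 0 then v else 0))"
proof -
  have fin: "finite {r. c r \<cdot> vertex_pair i i (m - r) r v \<noteq> 0}" for c
    using vertex_pair_finite[of c i i m 0 v] by simp
  have "- sgn_sum a (- r) * (- 1) powi r = ((1 + a) / (1 - a)) * ((- a) powi (- r) - (- 1) powi r)" for r
  proof -
    have "(- a) powi (- r) = (- 1) powi (- r) * a powi (- r)"
      by (simp flip: power_int_mult_distrib)
    then have "((1 + a) / (1 - a)) * ((- a) powi (- r) - (- 1) powi r) = ((1 + a) / (1 - a)) * ((a powi (- r) - 1) * (- 1) powi r)"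
      by (simp add: minus_one_powi)
    moreover have "- ((1 - x) * K) * s = K * ((x - 1) * s)" for x K s :: complex
      by (simp add: algebra_simps)
    ultimately show ?thesis
      unfolding sgn_sum_closed[OF assms(1)] using assms(2) by (simp only: if_False)
  qed
  then have "quad i i a m v = ((1 + a) / (1 - a)) \<cdot>
      Sum_any (\<lambda>r. (- a) powi (- r) \<cdot> vertex_pair i i (m - r) r v - (- 1) powi r \<cdot> vertex_pair i i (m - r) r v)"
    unfolding quad_same_sgn_sum scale_Sum_any by (simp flip: scale_left_diff_distrib)
  then show ?thesis
    unfolding Sum_any_diff[OF fin fin] vertex_pair_alternating .
qed

end

section \<open>The Fock space\<close>

interpretation fock: complex_vector_space "fock_scale :: complex \<Rightarrow> 'n::finite fock \<Rightarrow> 'n fock"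
  by (intro complex_vector_space.intro vector_space_fock_scale)

subsection \<open>Exponential series\<close>

text \<open>
  A commuting family in positive degrees, to be exponentiated. Positivity of the degrees bounds the number of factors
  that contribute to a given coefficient.
\<close>

locale op_exponent =
  fixes b :: "'n::finite fock op_series"
  assumes b_lin: "lin fock_scale (b k)"
    and b_zero: "k \<le> 0 \<Longrightarrow> b k v = 0"
    and b_comm: "b k (b l v) = b l (b k v)"
begin

lemmas b_simps = fock.lin_simps[OF b_lin]

lemma pow_nonzero: "ser_pow b r n v \<noteq> 0 \<Longrightarrow> int r \<le> n"
proof (induction r arbitrary: n)
  case 0
  then show ?case by (simp add: ser_one_def split: if_splits)
next
  case (Suc r)
  from Suc.prems obtain k where k: "b k (ser_pow b r (n - k) v) \<noteq> 0"
    unfolding ser_pow.simps ser_mult_def by (elim Sum_any.not_neutral_obtains_not_neutral)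
  then have "ser_pow b r (n - k) v \<noteq> 0" "0 < k"
    using b_zero[of k "ser_pow b r (n - k) v"] by (auto simp: b_simps not_less[symmetric])
  then show ?case using Suc.IH[of "n - k"] by simp
qed

lemma b_pow_nonzero: "b k (ser_pow b r n v) \<noteq> 0 \<Longrightarrow> 0 < k \<and> int r \<le> n"
  using b_zero[of k "ser_pow b r n v"] pow_nonzero[of r n v] b_simps(3)[of k]
  by (cases "ser_pow b r n v = 0") (auto simp: not_less[symmetric])

lemma mult_finite: "finite {k. b k (ser_pow b r (n - k) v) \<noteq> 0}"
  by (rule finite_int_box[where K = "\<bar>n\<bar>"]) (use b_pow_nonzero in force)

lemma pow_lin: "lin fock_scale (ser_pow b r n)"
proof (induction r arbitrary: n)
  case 0
  show ?case by (rule fock.linI) (simp_all add: ser_one_def)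
next
  case (Suc r)
  show ?case
  proof (rule fock.linI)
    show "ser_pow b (Suc r) n (x + y) = ser_pow b (Suc r) n x + ser_pow b (Suc r) n y" for x y
      unfolding ser_pow.simps ser_mult_def fock.lin_simps[OF Suc.IH] b_simps
      by (rule Sum_any.distrib) (rule mult_finite)+
    show "ser_pow b (Suc r) n (fock_scale c x) = fock_scale c (ser_pow b (Suc r) n x)" for c x
      unfolding ser_pow.simps ser_mult_def fock.lin_simps[OF Suc.IH] b_simps fock.scale_Sum_any ..
  qed
qed

text \<open>
  The power rule \<open>D (b\<^sup>r\<^sup>+\<^sup>1) = (r + 1) (D b) b\<^sup>r\<close> for the derivation \<open>D\<close> that multiplies the coefficient of degree \<open>n\<close> by \<open>n\<close>.
\<close>

lemma pow_rec:
  "fock_scale (of_int n) (ser_pow b (Suc r) n v) =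
    fock_scale (of_nat (Suc r)) (Sum_any (\<lambda>k. fock_scale (of_int k) (b k (ser_pow b r (n - k) v))))"
proof (induction r arbitrary: n)
  case 0
  have "b k (ser_one (n - k) v) = 0" if "k \<noteq> n" for k
    using that by (simp add: ser_one_def b_simps)
  then have "Sum_any (\<lambda>k. fock_scale (c k) (b k (ser_one (n - k) v))) = fock_scale (c n) (b n v)" for c
    by (subst Sum_any_supported_at[of n]) (auto simp: ser_one_def)
  from this[of "\<lambda>_. 1"] this[of of_int] show ?case
    by (simp add: ser_mult_def)
next
  case (Suc r)
  let ?T = "Sum_any (\<lambda>k. fock_scale (of_int k) (b k (ser_pow b (Suc r) (n - k) v)))"
  have fin: "finite {k. fock_scale (c k) (b k (ser_pow b s (n - k) v)) \<noteq> 0}" for c s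
    by (rule finite_subset[OF _ mult_finite[of s n v]]) auto
  have "fock_scale (of_int n) (ser_pow b (Suc (Suc r)) n v) =
     Sum_any (\<lambda>k. fock_scale (of_int k) (b k (ser_pow b (Suc r) (n - k) v)) +
        fock_scale (of_int (n - k)) (b k (ser_pow b (Suc r) (n - k) v)))"
    unfolding ser_pow.simps(2)[of b "Suc r"] ser_mult_def[of b "ser_pow b (Suc r)"] fock.scale_Sum_any
    by (simp flip: fock.scale_left_distrib)
  also have "\<dots> = ?T + Sum_any (\<lambda>k. fock_scale (of_int (n - k)) (b k (ser_pow b (Suc r) (n - k) v)))"
    by (rule Sum_any.distrib) (rule fin)+
  also have "Sum_any (\<lambda>k. fock_scale (of_int (n - k)) (b k (ser_pow b (Suc r) (n - k) v))) =
      fock_scale (of_nat (Suc r)) (Sum_any (\<lambda>k. Sum_any (\<lambda>j. fock_scale (of_int j) (b k (b j (ser_pow b r (n - k - j) v))))))"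
  proof -
    have fin': "finite {j. fock_scale (of_int j) (b j (ser_pow b r (n - k - j) v)) \<noteq> 0}" for k
      by (rule finite_subset[OF _ mult_finite[of r "n - k" v]]) auto
    have "fock_scale (of_int (n - k)) (b k (ser_pow b (Suc r) (n - k) v)) =
      fock_scale (of_nat (Suc r)) (Sum_any (\<lambda>j. fock_scale (of_int j) (b k (b j (ser_pow b r (n - k - j) v)))))" for k
      unfolding b_simps(2)[symmetric] Suc.IH unfolding b_simps fock.lin_Sum_any[OF b_lin fin'] ..
    then show ?thesis unfolding fock.scale_Sum_any[of "of_nat (Suc r)"] by simp
  qed
  also have "Sum_any (\<lambda>k. Sum_any (\<lambda>j. fock_scale (of_int j) (b k (b j (ser_pow b r (n - k - j) v))))) =
     Sum_any (\<lambda>j. Sum_any (\<lambda>k. fock_scale (of_int j) (b j (b k (ser_pow b r (n - j - k) v)))))"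
  proof (rule Sum_any_reindex2[where K = "\<bar>n\<bar>" and \<phi> = "\<lambda>(k, j). (j, k)" and \<psi> = "\<lambda>(k, j). (j, k)"])
    fix k j assume "fock_scale (of_int j) (b k (b j (ser_pow b r (n - k - j) v))) \<noteq> 0"
    then have "b k (b j (ser_pow b r (n - k - j) v)) \<noteq> 0" by auto
    moreover then have "b j (ser_pow b r (n - k - j) v) \<noteq> 0" "0 < k"
      using b_zero[of k] by (auto simp: b_simps not_less[symmetric])
    ultimately show "\<bar>k\<bar> \<le> \<bar>n\<bar> \<and> \<bar>j\<bar> \<le> \<bar>n\<bar>"
      using b_pow_nonzero[of j r "n - k - j" v] by auto
  qed (auto simp: b_comm algebra_simps)
  also have "\<dots> = ?T"
  proof (intro Sum_any.cong)
    show "Sum_any (\<lambda>k. fock_scale (of_int j) (b j (b k (ser_pow b r (n - j - k) v)))) =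
      fock_scale (of_int j) (b j (ser_pow b (Suc r) (n - j) v))" for j
      unfolding ser_pow.simps ser_mult_def fock.lin_Sum_any[OF b_lin mult_finite] fock.scale_Sum_any ..
  qed
  finally show ?case
    by (simp only: of_nat_Suc[of "Suc r"] fock.scale_left_distrib fock.scale_one)
qed

lemma exp_support: "fock_scale (1 / fact r) (ser_pow b r n v) \<noteq> 0 \<Longrightarrow> r \<le> nat n"
  using pow_nonzero[of r n v] by auto

lemma exp_finite: "finite {r. fock_scale (1 / fact r) (ser_pow b r n v) \<noteq> 0}"
  by (rule finite_subset[of _ "{..nat n}"]) (use exp_support in auto)

lemma exp_lin: "lin fock_scale (ser_exp b n)"
proof (rule fock.linI)
  show "ser_exp b n (x + y) = ser_exp b n x + ser_exp b n y" for x y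
    unfolding ser_exp_def fock.lin_simps[OF pow_lin] fock.scale_right_distrib
    by (rule Sum_any.distrib) (rule exp_finite)+
  show "ser_exp b n (fock_scale c x) = fock_scale c (ser_exp b n x)" for c x
    unfolding ser_exp_def fock.lin_simps[OF pow_lin] fock.scale_Sum_any
    by (simp add: mult.commute)
qed

text \<open>
  The chain rule \<open>D (exp b) = (D b) (exp b)\<close>, obtained from lemma \<open>pow_rec\<close> by summation over the powers.
\<close>

lemma exp_rec:
  "fock_scale (of_int n) (ser_exp b n v) = Sum_any (\<lambda>k. fock_scale (of_int k) (b k (ser_exp b (n - k) v)))"
proof -
  let ?f = "\<lambda>r. fock_scale (of_int n) (fock_scale (1 / fact r) (ser_pow b r n v))"
  let ?g = "\<lambda>r k. fock_scale (of_int k) (b k (fock_scale (1 / fact r) (ser_pow b r (n - k) v)))"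
  have f0: "?f 0 = 0" by (simp add: ser_one_def)
  have fSuc: "?f (Suc r) = Sum_any (\<lambda>k. ?g r k)" for r
  proof -
    have "?f (Suc r) = fock_scale (1 / fact (Suc r)) (fock_scale (of_int n) (ser_pow b (Suc r) n v))"
      by (simp only: fock.scale_scale mult.commute)
    also have "\<dots> = fock_scale (1 / fact r) (Sum_any (\<lambda>k. fock_scale (of_int k) (b k (ser_pow b r (n - k) v))))"
      unfolding pow_rec fock.scale_scale by (simp del: of_nat_Suc)
    also have "\<dots> = Sum_any (\<lambda>k. ?g r k)"
      unfolding fock.scale_Sum_any b_simps by (simp add: mult.commute)
    finally show ?thesis .
  qed
  have "fock_scale (of_int n) (ser_exp b n v) = Sum_any ?f"
    unfolding ser_exp_def fock.scale_Sum_any ..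
  also have "\<dots> = sum ?f {..Suc (nat n)}"
  proof (rule Sum_any.expand_superset)
    show "{r. ?f r \<noteq> 0} \<subseteq> {..Suc (nat n)}"
      using exp_support by force
  qed simp
  also have "\<dots> = (\<Sum>r\<le>nat n. ?f (Suc r))"
    unfolding sum.atMost_Suc_shift f0 by simp
  also have "\<dots> = (\<Sum>r\<le>nat n. Sum_any (\<lambda>k. ?g r k))"
    by (simp only: fSuc)
  also have "\<dots> = Sum_any (\<lambda>r. Sum_any (\<lambda>k. ?g r k))"
  proof (rule Sum_any.expand_superset[symmetric])
    show "{r. Sum_any (\<lambda>k. ?g r k) \<noteq> 0} \<subseteq> {..nat n}"
    proof
      fix r assume "r \<in> {r. Sum_any (\<lambda>k. ?g r k) \<noteq> 0}"
      then have "?f (Suc r) \<noteq> 0" by (simp only: fSuc mem_Collect_eq simp_thms)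
      then show "r \<in> {..nat n}" using exp_support[of "Suc r" n v] by auto
    qed
  qed simp
  also have "\<dots> = Sum_any (\<lambda>k. Sum_any (\<lambda>r. ?g r k))"
  proof (rule Sum_any.swap)
    have nz: "r \<le> nat n \<and> k \<in> {0..n}" if "?g r k \<noteq> 0" for r k
    proof -
      have "b k (ser_pow b r (n - k) v) \<noteq> 0" using that by (auto simp: b_simps)
      then show ?thesis using b_pow_nonzero[of k r "n - k" v] by auto
    qed
    then show "{r. \<exists>k. ?g r k \<noteq> 0} \<times> {k. \<exists>r. ?g r k \<noteq> 0} \<subseteq> {..nat n} \<times> {0..n}"
      by blast
  qed simp
  also have "\<dots> = Sum_any (\<lambda>k. fock_scale (of_int k) (b k (ser_exp b (n - k) v)))"
    unfolding ser_exp_def fock.lin_Sum_any[OF b_lin exp_finite] fock.scale_Sum_any ..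
  finally show ?thesis .
qed

lemma exp_neg: "n < 0 \<Longrightarrow> ser_exp b n v = 0"
  unfolding ser_exp_def by (rule Sum_any_all_zero) (use pow_nonzero in force)

lemma exp_0: "ser_exp b 0 v = v"
proof -
  have "fock_scale (1 / fact r) (ser_pow b r 0 v) = 0" if "r \<noteq> 0" for r
    using that exp_support[of r 0 v] by auto
  then show ?thesis
    unfolding ser_exp_def by (subst Sum_any_supported_at[of 0]) (auto simp: ser_one_def)
qed

end

lemma exp_family_ser_exp:
  fixes e :: "'n::finite fock op_series"
  assumes e_lin: "\<And>k. lin fock_scale (e k)"
    and e_zero: "\<And>k v. even k \<or> k \<le> 0 \<Longrightarrow> e k v = 0"
    and e_comm: "\<And>k l v. e k (e l v) = e l (e k v)"
  shows "exp_family fock_scale e (ser_exp (\<lambda>k v. fock_scale (- 2 / of_int k) (e k v)))"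
proof -
  note e_simps = fock.lin_simps[OF e_lin]
  interpret op_exponent "\<lambda>k v. fock_scale (- 2 / of_int k) (e k v)"
  proof (rule op_exponent.intro)
    show "lin fock_scale (\<lambda>v. fock_scale (- 2 / of_int k) (e k v))" for k
      by (rule fock.linI) (simp_all add: e_simps fock.scale_right_distrib mult.commute)
  qed (simp_all add: e_zero e_simps e_comm mult.commute)
  have "fock_scale (of_int k) (fock_scale (- 2 / of_int k) (e k v)) = fock_scale (- 2) (e k v)" for k v
    using e_zero[of k v] by (cases "k = 0") auto
  then have rec: "fock_scale (of_int n) (ser_exp (\<lambda>k v. fock_scale (- 2 / of_int k) (e k v)) n v) =
     fock_scale (- 2) (Sum_any (\<lambda>k. e k (ser_exp (\<lambda>k v. fock_scale (- 2 / of_int k) (e k v)) (n - k) v)))" for n v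
    unfolding exp_rec fock.scale_Sum_any by (simp only:)
  show ?thesis
    by (intro exp_family.intro exp_family_axioms.intro fock.complex_vector_space_axioms)
      (rule e_lin exp_lin e_zero e_comm exp_neg exp_0 rec, assumption?)+
qed

text \<open>
  Reduces \<open>E\<^sub>-\<close>, whose exponent has negative degrees, to exponents with positive degrees.
\<close>

lemma ser_exp_mirror: "ser_exp (\<lambda>k. b (- k)) n v = ser_exp b (- n) v"
proof -
  have "ser_pow (\<lambda>k. b (- k)) r n v = ser_pow b r (- n) v" for r n
  proof (induction r arbitrary: n)
    case 0
    show ?case by (simp add: ser_one_def)
  next
    case (Suc r)
    show ?case
      unfolding ser_pow.simps ser_mult_def
      by (rule Sum_any_bij[where f = uminus and g = uminus]) (auto simp: Suc.IH)
  qed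
  then show ?thesis by (simp add: ser_exp_def)
qed

lemma ser_exp_dilate:
  assumes c: "c \<noteq> 0" and b_lin: "\<And>k. lin fock_scale (b k)"
  shows "ser_exp (\<lambda>k v. fock_scale (c powi k) (b k v)) n v = fock_scale (c powi n) (ser_exp b n v)"
proof -
  have "ser_pow (\<lambda>k v. fock_scale (c powi k) (b k v)) r n v = fock_scale (c powi n) (ser_pow b r n v)" for r n
  proof (induction r arbitrary: n)
    case 0
    show ?case by (simp add: ser_one_def)
  next
    case (Suc r)
    have "c powi k * c powi (n - k) = c powi n" for k
      using power_int_add[of c k "n - k"] c by simp
    then show ?case
      unfolding ser_pow.simps ser_mult_def Suc.IH fock.lin_simps[OF b_lin] fock.scale_Sum_any by simp
  qed
  then show ?thesis
    unfolding ser_exp_def fock.scale_Sum_any by (simp add: mult.commute)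
qed

subsection \<open>Heisenberg operators and the twisted group algebra\<close>

lemma lookup_sym_act:
  assumes "D 0 = 0"
  shows "Poly_Mapping.lookup (sym_act D v) b = D (Poly_Mapping.lookup v b)"
proof -
  have "Poly_Mapping.lookup (sym_act D v) b =
      (\<Sum>c\<in>Poly_Mapping.keys v. if c = b then D (Poly_Mapping.lookup v c) else 0)"
    unfolding sym_act_def lin_ext_def lookup_sum by (simp add: lookup_single when_def)
  also have "\<dots> = D (Poly_Mapping.lookup v b)"
    using assms by (simp add: sum.delta' in_keys_iff)
  finally show ?thesis .
qed

lemma heis_sym_linear:
  "heis_sym i n (p + q) = heis_sym i n p + heis_sym i n q"
  "heis_sym i n (pm_scale c p) = pm_scale c (heis_sym i n p)"
  "heis_sym i n 0 = 0"
proof -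
  have scale: "pm_scale c q = Poly_Mapping.single 0 c * q" for q :: "'a symalg"
    by (induction q rule: poly_mapping_add_induct) (simp_all add: pm_scale_add distrib_left mult_single)
  show "heis_sym i n (p + q) = heis_sym i n p + heis_sym i n q"
    by (simp add: heis_sym_def distrib_left sym_deriv_add pm_scale_add)
  show "heis_sym i n (pm_scale c p) = pm_scale c (heis_sym i n p)"
    by (simp add: heis_sym_def sym_deriv_scale mult.commute[of c]) (simp add: scale mult_ac)
  show "heis_sym i n 0 = 0"
    by (simp add: heis_sym_def sym_deriv_def)
qed

lemma heis_eps_vec: "heis (eps_vec i) n v = sym_act (heis_sym i n) v"
proof -
  have "heis (eps_vec i) n v = (\<Sum>j\<in>UNIV. if j = i then sym_act (heis_sym i n) v else 0)"
    unfolding heis_def by (intro sum.cong) (auto simp: eps_vec_def axis_def)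
  then show ?thesis by simp
qed

lemma heis_uminus: "heis (- \<alpha>) n v = - heis \<alpha> n v"
  by (simp add: heis_def sum_negf)

lemma lookup_heis: "Poly_Mapping.lookup (heis (eps_vec i) n v) b = heis_sym i n (Poly_Mapping.lookup v b)"
  by (simp add: heis_eps_vec lookup_sym_act heis_sym_linear)

lemma heis_lin: "lin fock_scale (heis (eps_vec i) n)"
  by (rule fock.linI; rule poly_mapping_eqI) (simp_all add: lookup_heis lookup_add heis_sym_linear)

lemma heis_commute:
  assumes "odd m" "odd n"
  shows "heis (eps_vec i) m (heis (eps_vec j) n v) = heis (eps_vec j) n (heis (eps_vec i) m v) +
    fock_scale (of_int m / 2 * of_bool (i = j \<and> m + n = 0)) v"
proof (rule poly_mapping_eqI)
  fix b
  show "Poly_Mapping.lookup (heis (eps_vec i) m (heis (eps_vec j) n v)) b =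
    Poly_Mapping.lookup (heis (eps_vec j) n (heis (eps_vec i) m v) +
      fock_scale (of_int m / 2 * of_bool (i = j \<and> m + n = 0)) v) b"
    using heis_sym_commute[OF assms, of i j "Poly_Mapping.lookup v b"]
    unfolding lookup_add lookup_fock_scale lookup_heis by (simp only: diff_eq_eq add.commute)
qed

text \<open>
  The simplifier rewrites sums of bits to exclusive disjunctions. This rule is switched off wherever the group laws
  of the lattice modulo 2 are used.
\<close>

lemma lattice2_add_self: "a + a = (0 :: 'n::finite lattice2)"
  by (simp add: vec_eq_iff del: add_bit_eq_xor)

lemma lattice2_add_cancel: "a + (a + b) = (b :: 'n::finite lattice2)"
  using lattice2_add_self[of a] by (simp add: add.assoc[symmetric] del: add_bit_eq_xor)

lemma lookup_group_act:
  "Poly_Mapping.lookup (group_act a v) c = pm_scale (cocyc2 a (a + c)) (Poly_Mapping.lookup v (a + c))"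
proof -
  have eq: "a + b = c \<longleftrightarrow> b = a + c" for b
    using lattice2_add_cancel[of a b] lattice2_add_cancel[of a c] by auto
  have "Poly_Mapping.lookup (group_act a v) c =
      (\<Sum>b\<in>Poly_Mapping.keys v. if b = a + c then pm_scale (cocyc2 a b) (Poly_Mapping.lookup v b) else 0)"
    unfolding group_act_def lin_ext_def lookup_sum by (simp add: lookup_single when_def eq)
  also have "\<dots> = pm_scale (cocyc2 a (a + c)) (Poly_Mapping.lookup v (a + c))"
    by (simp add: sum.delta' in_keys_iff)
  finally show ?thesis .
qed

lemma cocyc2_add:
  "cocyc2 (a + b) c = cocyc2 a c * cocyc2 b c" "cocyc2 c (a + b) = cocyc2 c a * cocyc2 c b"
proof -
  obtain \<alpha> \<beta> \<gamma> where "a = red2 \<alpha>" "b = red2 \<beta>" "c = red2 \<gamma>"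
    using red2_lift2 by metis
  then show "cocyc2 (a + b) c = cocyc2 a c * cocyc2 b c" "cocyc2 c (a + b) = cocyc2 c a * cocyc2 c b"
    by (simp_all add: cocyc2_red2 cocyc_add_left cocyc_add_right flip: red2_add)
qed

lemma cocyc2_square: "cocyc2 a b * cocyc2 a b = 1"
  using cocyc_range[of "lift2 a" "lift2 b"] by (auto simp: cocyc2_def)

lemma cocyc2_square_left: "cocyc2 a b * (cocyc2 a b * x) = x"
  by (simp add: cocyc2_square mult.assoc[symmetric])

lemma group_act_lin: "lin fock_scale (group_act a)"
  by (rule fock.linI; rule poly_mapping_eqI)
    (simp_all add: lookup_group_act lookup_add pm_scale_add mult.commute)

text \<open>
  Associativity of the twisted group algebra, that is, bimultiplicativity of the cocycle.
\<close>

lemma group_act_mult: "group_act a (group_act b v) = fock_scale (cocyc2 a b) (group_act (a + b) v)"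
proof (rule poly_mapping_eqI)
  fix c
  have "a + (b + (a + c)) = b + c" using lattice2_add_cancel[of a "b + c"] by (simp only: add_ac)
  then show "Poly_Mapping.lookup (group_act a (group_act b v)) c =
      Poly_Mapping.lookup (fock_scale (cocyc2 a b) (group_act (a + b) v)) c"
    unfolding lookup_fock_scale lookup_group_act pm_scale_scale
    by (simp add: cocyc2_add cocyc2_square_left add_ac mult_ac del: add_bit_eq_xor)
qed

lemma group_act_heis: "group_act a (heis (eps_vec i) n v) = heis (eps_vec i) n (group_act a v)"
  by (rule poly_mapping_eqI) (simp add: lookup_group_act lookup_heis heis_sym_linear)

definition eps_act :: "'n::{finite,linorder} \<Rightarrow> 'n fock \<Rightarrow> 'n fock" where
  "eps_act i = group_act (red2 (eps_vec i))"

lemma group_act_0: "group_act 0 v = v"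
proof -
  have "cocyc2 0 c = 1" for c :: "'a lattice2"
    using cocyc2_add(1)[of 0 0 c] cocyc2_square[of 0 c] by simp
  then show ?thesis by (intro poly_mapping_eqI) (simp add: lookup_group_act)
qed

lemma eps_act_square: "eps_act i (eps_act i v) = v"
  by (simp add: eps_act_def group_act_mult lattice2_add_self group_act_0 cocyc2_red2 cocyc_eps_vec
      del: add_bit_eq_xor)

lemma eps_act_anticommute:
  assumes "i \<noteq> j"
  shows "eps_act i (eps_act j v) = - eps_act j (eps_act i v)"
proof -
  have "cocyc2 (red2 (eps_vec i)) (red2 (eps_vec j)) = - cocyc2 (red2 (eps_vec j)) (red2 (eps_vec i))"
    using assms by (auto simp: cocyc2_red2 cocyc_eps_vec)
  then show ?thesis
    by (simp add: eps_act_def group_act_mult add.commute del: add_bit_eq_xor)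
qed

lemma red2_diff: "red2 (\<alpha> - \<beta>) = red2 \<alpha> + red2 \<beta>"
proof -
  have "red2 \<alpha> = red2 (\<alpha> - \<beta>) + red2 \<beta>" by (simp flip: red2_add)
  then show ?thesis using lattice2_add_cancel[of "red2 \<beta>" "red2 (\<alpha> - \<beta>)"] by (simp only: add.commute)
qed

lemma eps_act_eps_act:
  "eps_act i (eps_act j v) =
    fock_scale (cocyc (eps_vec i) (eps_vec j)) (group_act (red2 (eps_vec i - eps_vec j)) v)"
  by (simp add: eps_act_def group_act_mult cocyc2_red2 red2_diff)

subsection \<open>The degree filtration\<close>

text \<open>
  The degree in which the variable \<open>\<epsilon>\<^sub>i(- (2 k + 1))\<close> has weight \<open>2 k + 1\<close>.
\<close>

definition mon_deg :: "('n \<times> nat \<Rightarrow>\<^sub>0 nat) \<Rightarrow> nat" where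
  "mon_deg = lin_ext (\<lambda>(i, k) c. (2 * k + 1) * c)"

lemma mon_deg_add: "mon_deg (u + w) = mon_deg u + mon_deg w"
  unfolding mon_deg_def by (rule lin_ext_add) (auto simp: algebra_simps)

lemma mon_deg_single: "mon_deg (Poly_Mapping.single (i, k) 1) = 2 * k + 1"
  unfolding mon_deg_def by (subst lin_ext_single) auto

definition deg_le :: "int \<Rightarrow> 'n::finite fock set" where
  "deg_le d = {v. \<forall>b u. Poly_Mapping.lookup (Poly_Mapping.lookup v b) u \<noteq> 0 \<longrightarrow> int (mon_deg u) \<le> d}"

lemma deg_le_subspace: "fock.subspace (deg_le d)"
proof -
  have "x \<noteq> 0 \<or> y \<noteq> 0" if "x + y \<noteq> 0" for x y :: complex
    using that by auto
  then show ?thesis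
    unfolding fock.subspace_def deg_le_def by (simp add: lookup_add) blast
qed

lemma deg_le_neg: "d < 0 \<Longrightarrow> v \<in> deg_le d \<Longrightarrow> v = 0"
  by (intro poly_mapping_eqI) (fastforce simp: deg_le_def)

lemma deg_le_cover: "\<exists>d. v \<in> deg_le d"
proof -
  let ?S = "\<Union>b\<in>Poly_Mapping.keys v. mon_deg ` Poly_Mapping.keys (Poly_Mapping.lookup v b)"
  have "finite ?S" by simp
  then obtain d where d: "\<forall>x\<in>?S. x \<le> d" using finite_nat_set_iff_bounded_le by blast
  have "v \<in> deg_le (int d)"
    unfolding deg_le_def
  proof (intro CollectI allI impI)
    fix b u assume nz: "Poly_Mapping.lookup (Poly_Mapping.lookup v b) u \<noteq> 0"
    then have "Poly_Mapping.lookup v b \<noteq> 0" by auto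
    with nz have "mon_deg u \<in> ?S" by (intro UN_I[of b] imageI) (auto simp: in_keys_iff)
    then have "mon_deg u \<le> d" using d by (rule bspec[rotated])
    then show "int (mon_deg u) \<le> int d" by simp
  qed
  then show ?thesis by blast
qed

lemma lookup_sym_deriv:
  "Poly_Mapping.lookup (sym_deriv x p) w =
    of_nat (Poly_Mapping.lookup w x + 1) * Poly_Mapping.lookup p (w + Poly_Mapping.single x 1)"
proof (induction p rule: poly_mapping_add_induct)
  case zero
  show ?case by (simp add: sym_deriv_def)
next
  case (single u c)
  show ?case
  proof (cases "Poly_Mapping.lookup u x = 0")
    case True
    then have "u \<noteq> w + Poly_Mapping.single x 1" by (auto simp: lookup_add)
    then show ?thesis using True by (simp add: sym_deriv_single lookup_single when_def)
  next
    case False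
    have "u - Poly_Mapping.single x 1 = w \<longleftrightarrow> u = w + Poly_Mapping.single x 1"
    proof
      assume "u - Poly_Mapping.single x 1 = w"
      moreover have "u = (u - Poly_Mapping.single x 1) + Poly_Mapping.single x 1"
        using False by (intro poly_mapping_eqI) (auto simp: lookup_add lookup_minus lookup_single when_def)
      ultimately show "u = w + Poly_Mapping.single x 1" by simp
    qed simp
    then show ?thesis
      by (auto simp: sym_deriv_single lookup_single when_def lookup_add)
  qed
next
  case (add f g)
  then show ?case by (simp add: sym_deriv_add lookup_add algebra_simps)
qed

lemma heis_deg_le:
  assumes "odd k" "0 < k" "v \<in> deg_le d"
  shows "heis (eps_vec i) k v \<in> deg_le (d - k)"
  unfolding deg_le_def
proof (intro CollectI allI impI)
  fix b u
  let ?x = "(i, nat ((k - 1) div 2))"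
  assume "Poly_Mapping.lookup (Poly_Mapping.lookup (heis (eps_vec i) k v) b) u \<noteq> 0"
  then have "Poly_Mapping.lookup (Poly_Mapping.lookup v b) (u + Poly_Mapping.single ?x 1) \<noteq> 0"
    using assms(2) by (auto simp: lookup_heis heis_sym_def lookup_sym_deriv)
  then have "int (mon_deg (u + Poly_Mapping.single ?x 1)) \<le> d"
    using assms(3) unfolding deg_le_def by blast
  moreover have "2 * int (nat ((k - 1) div 2)) + 1 = k"
    using assms by (auto elim!: oddE)
  ultimately show "int (mon_deg u) \<le> d - k"
    unfolding mon_deg_add mon_deg_single by linarith
qed

subsection \<open>The vertex operators on the Fock space\<close>

lemma exp_family_E_plus:
  "exp_family fock_scale (\<lambda>k v. if odd k \<and> 0 < k then heis (eps_vec i) k v else 0) (E_plus (eps_vec i))"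
proof -
  have lin: "lin fock_scale (\<lambda>v. if odd k \<and> 0 < k then heis (eps_vec i) k v else 0)" for k
    by (rule fock.linI) (simp_all add: fock.lin_simps[OF heis_lin])
  have *: "fock_scale (- 2 / of_int k) (if odd k \<and> 0 < k then heis (eps_vec i) k v else 0) =
     (if odd k \<and> 0 < k then fock_scale (- 2 / of_int k) (heis (eps_vec i) k v) else 0)" for k v
    by simp
  have comm: "heis (eps_vec i) k (heis (eps_vec i) l v) = heis (eps_vec i) l (heis (eps_vec i) k v)"
    if "odd k" "0 < k" "odd l" "0 < l" for k l v
    using that heis_commute[of k l i i v] by simp
  show ?thesis
    unfolding E_plus_def *[symmetric]
    by (rule exp_family_ser_exp[OF lin]) (auto simp: comm fock.lin_simps[OF heis_lin])
qed

lemma exp_family_E_minus: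
  "exp_family fock_scale (\<lambda>k v. if odd k \<and> 0 < k then - heis (eps_vec i) (- k) v else 0) (\<lambda>n. E_minus (eps_vec i) (- n))"
proof -
  have lin: "lin fock_scale (\<lambda>v. if odd k \<and> 0 < k then - heis (eps_vec i) (- k) v else 0)" for k
    by (rule fock.linI) (simp_all add: fock.lin_simps[OF heis_lin])
  have *: "fock_scale (- 2 / of_int k) (if odd k \<and> 0 < k then - heis (eps_vec i) (- k) v else 0) =
     (if odd (- k) \<and> - k < 0 then fock_scale (- 2 / of_int (- k)) (heis (eps_vec i) (- k) v) else 0)" for k v
    by simp
  have "E_minus (eps_vec i) (- n) v =
      ser_exp (\<lambda>k v. fock_scale (- 2 / of_int k) (if odd k \<and> 0 < k then - heis (eps_vec i) (- k) v else 0)) n v" for n v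
    unfolding E_minus_def * by (rule ser_exp_mirror[symmetric])
  then have mirror: "(\<lambda>n. E_minus (eps_vec i) (- n)) =
      ser_exp (\<lambda>k v. fock_scale (- 2 / of_int k) (if odd k \<and> 0 < k then - heis (eps_vec i) (- k) v else 0))"
    by (intro ext)
  have comm: "heis (eps_vec i) (- k) (heis (eps_vec i) (- l) v) = heis (eps_vec i) (- l) (heis (eps_vec i) (- k) v)"
    if "odd k" "0 < k" "odd l" "0 < l" for k l v
    using that heis_commute[of "- k" "- l" i i v] by simp
  show ?thesis
    unfolding mirror by (rule exp_family_ser_exp[OF lin]) (auto simp: comm fock.lin_simps[OF heis_lin])
qed

lemma E_plus_uminus: "E_plus (- eps_vec i) n v = fock_scale ((- 1) powi n) (E_plus (eps_vec i) n v)"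
proof -
  have lin: "lin fock_scale (\<lambda>v. if odd k \<and> 0 < k then fock_scale (- 2 / of_int k) (heis (eps_vec i) k v) else 0)" for k
    by (rule fock.linI) (simp_all add: fock.lin_simps[OF heis_lin] fock.scale_right_distrib mult.commute)
  have "(if odd k \<and> 0 < k then fock_scale (- 2 / of_int k) (heis (- eps_vec i) k v) else 0) =
      fock_scale ((- 1) powi k) (if odd k \<and> 0 < k then fock_scale (- 2 / of_int k) (heis (eps_vec i) k v) else 0)" for k v
    by (simp add: heis_uminus)
  then show ?thesis
    unfolding E_plus_def by (simp only: ser_exp_dilate[OF _ lin, of "- 1"] neg_equal_0_iff_equal one_neq_zero not_False_eq_True)
qed

lemma E_minus_uminus: "E_minus (- eps_vec i) n v = fock_scale ((- 1) powi n) (E_minus (eps_vec i) n v)"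
proof -
  have lin: "lin fock_scale (\<lambda>v. if odd k \<and> k < 0 then fock_scale (- 2 / of_int k) (heis (eps_vec i) k v) else 0)" for k
    by (rule fock.linI) (simp_all add: fock.lin_simps[OF heis_lin] fock.scale_right_distrib mult.commute)
  have "(if odd k \<and> k < 0 then fock_scale (- 2 / of_int k) (heis (- eps_vec i) k v) else 0) =
      fock_scale ((- 1) powi k) (if odd k \<and> k < 0 then fock_scale (- 2 / of_int k) (heis (eps_vec i) k v) else 0)" for k v
    by (simp add: heis_uminus)
  then show ?thesis
    unfolding E_minus_def by (simp only: ser_exp_dilate[OF _ lin, of "- 1"] neg_equal_0_iff_equal one_neq_zero not_False_eq_True)
qed

text \<open>
  The operators \<open>eps_act i\<close> commute with the exponential series because the two act on different tensor factors.
  The recursion gives the effect of \<open>E\<^sub>+\<close> on the degree, as each \<open>\<epsilon>\<^sub>i(k)\<close> with \<open>k > 0\<close> lowers the degree by \<open>k\<close>.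
\<close>

interpretation fock: fermionic_vertex_operators
  "fock_scale :: complex \<Rightarrow> 'n::{finite,linorder} fock \<Rightarrow> 'n fock"
  "\<lambda>i. heis (eps_vec i)" "\<lambda>i. E_plus (eps_vec i)" "\<lambda>i. E_minus (eps_vec i)" deg_le eps_act
proof (intro fermionic_vertex_operators.intro vertex_operators.intro vertex_operators_axioms.intro
    fermionic_vertex_operators_axioms.intro fock.complex_vector_space_axioms)
  fix i j :: 'n and k m n d :: int and v :: "'n fock"
  show "lin fock_scale (heis (eps_vec i) k)"
    by (rule heis_lin)
  show "heis (eps_vec i) m (heis (eps_vec j) n v) = heis (eps_vec j) n (heis (eps_vec i) m v) +
      fock_scale (of_int m / 2 * of_bool (i = j \<and> m + n = 0)) v" if "odd m" "odd n"
    using that by (rule heis_commute)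
  interpret A: exp_family fock_scale "\<lambda>k v. if odd k \<and> 0 < k then heis (eps_vec j) k v else 0" "E_plus (eps_vec j)" for j :: 'n
    by (rule exp_family_E_plus)
  interpret B: exp_family fock_scale "\<lambda>k v. if odd k \<and> 0 < k then - heis (eps_vec j) (- k) v else 0" "\<lambda>n. E_minus (eps_vec j) (- n)" for j :: 'n
    by (rule exp_family_E_minus)
  show "exp_family fock_scale (\<lambda>k v. if odd k \<and> 0 < k then heis (eps_vec i) k v else 0) (E_plus (eps_vec i))"
    by (rule exp_family_E_plus)
  show "exp_family fock_scale (\<lambda>k v. if odd k \<and> 0 < k then - heis (eps_vec i) (- k) v else 0) (\<lambda>n. E_minus (eps_vec i) (- n))"
    by (rule exp_family_E_minus)
  show "\<exists>d. v \<in> deg_le d" by (rule deg_le_cover)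
  show "v = 0" if "d < 0" "v \<in> deg_le d" using that by (rule deg_le_neg)
  show "E_plus (eps_vec i) n v \<in> deg_le (d - n)" if "v \<in> deg_le d"
  proof (rule A.V_filtered[where F = deg_le])
    show "fock.subspace (deg_le d :: 'n fock set)" for d
      by (rule deg_le_subspace)
    show "v \<in> deg_le d" by (rule that)
    show "(if odd k \<and> 0 < k then heis (eps_vec i) k v else 0) \<in> deg_le (d - k)" if "v \<in> deg_le d" for k d v
      using that by (auto intro: heis_deg_le fock.subspace_0[OF deg_le_subspace])
  qed
  show lin: "lin fock_scale (eps_act i)" for i :: 'n
    unfolding eps_act_def by (rule group_act_lin)
  show "eps_act i (E_plus (eps_vec j) n v) = E_plus (eps_vec j) n (eps_act i v)"
  proof (rule A.commute_V[OF lin])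
    show "eps_act i (if odd k \<and> 0 < k then heis (eps_vec j) k v else 0) =
        (if odd k \<and> 0 < k then heis (eps_vec j) k (eps_act i v) else 0)" for k v
      using fock.lin_simps(3)[OF lin] by (simp add: eps_act_def group_act_heis)
  qed
  have "eps_act i (if odd k \<and> 0 < k then - heis (eps_vec j) (- k) v else 0) =
        (if odd k \<and> 0 < k then - heis (eps_vec j) (- k) (eps_act i v) else 0)" for k v
    using fock.lin_simps(3,5)[OF lin] by (simp add: eps_act_def group_act_heis)
  from B.commute_V[OF lin this, where n = "- n" and v = v]
  show "eps_act i (E_minus (eps_vec j) n v) = E_minus (eps_vec j) n (eps_act i v)" by simp
  show "eps_act i (eps_act i v) = v" by (rule eps_act_square)
  show "eps_act i (eps_act j v) = - eps_act j (eps_act i v)" if "i \<noteq> j"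
    using that by (rule eps_act_anticommute)
qed

text \<open>
  \<open>E\<^sub>\<plusminus>(- \<epsilon>\<^sub>j, a z) = E\<^sub>\<plusminus>(\<epsilon>\<^sub>j, - a z)\<close> because the exponents are odd; so the product is the normally ordered product at \<open>w = - a z\<close>.
\<close>

lemma E_prod_eq:
  fixes i j :: "'n::{finite,linorder}"
  assumes "a \<noteq> 0"
  shows "E_prod i j a n v = Sum_any (\<lambda>q. fock_scale ((- a) powi (- q)) (fock.vertex_pair i j (n - q) q v))"
proof -
  have f: "(- a) powi (- (l + r)) = (- a) powi (- l) * (- a) powi (- r)" for l r
    using power_int_add[of "- a" "- l" "- r"] assms by simp
  have "a powi (- q) * (- 1) powi q = (- a) powi (- q)" for q
    using power_int_mult_distrib[of "- 1" a "- q"] by (simp add: minus_one_powi)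
  then have dil: "ser_dilate a (E_minus (- eps_vec j)) q w = fock_scale ((- a) powi (- q)) (E_minus (eps_vec j) q w)"
      "ser_dilate a (E_plus (- eps_vec j)) q w = fock_scale ((- a) powi (- q)) (E_plus (eps_vec j) q w)" for q w
    by (simp_all add: ser_dilate_def E_minus_uminus E_plus_uminus)
  show ?thesis
    unfolding fock.vertex_pair_series[of "\<lambda>q. (- a) powi (- q)", OF f, symmetric] E_prod_def ser_mult_def dil
    by (simp only: diff_diff_eq)
qed

text \<open>
  The three cases in the definition of \<open>X\<^sub>i\<^sub>j(a, z)\<close> are one and the same normally ordered product of fermions.
\<close>

lemma x_op_eq_quad:
  assumes "a \<noteq> 0"
  shows "x_op i j a m v = fock.quad i j a m v"
proof (cases "i = j")
  case False
  then show ?thesis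
    by (simp add: x_op_def fock.quad_distinct eps_act_eps_act E_prod_eq[OF assms])
next
  case True
  then show ?thesis
    by (cases "a = 1")
      (simp_all add: x_op_def fock.quad_same_one fock.quad_same assms E_prod_eq[OF assms] ser_one_def)
qed

section \<open>The representation of the unitary Lie algebra\<close>

definition scalar_part :: "'n \<Rightarrow> 'n \<Rightarrow> complex \<Rightarrow> int \<Rightarrow> complex" where
  "scalar_part i j a m = (if m = 0 \<and> i = j \<and> a \<noteq> 1 then (1 + a) / (1 - a) else 0)"

definition unit_act :: "'n::{finite,linorder} \<Rightarrow> 'n \<Rightarrow> complex \<Rightarrow> int \<Rightarrow> 'n fock \<Rightarrow> 'n fock" where
  "unit_act i j a m v = fock.quad i j a m v + fock_scale (scalar_part i j a m) v"

definition entry_act ::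
    "('g::ab_group_add \<Rightarrow> complex) \<Rightarrow> 'n::{finite,linorder} \<Rightarrow> 'n \<Rightarrow> 'g ralg \<Rightarrow> 'n fock \<Rightarrow> 'n fock" where
  "entry_act \<sigma> i j f v = lin_ext (\<lambda>(m, \<alpha>) c. fock_scale (c / 4) (unit_act i j (\<sigma> \<alpha>) m v)) f"

text \<open>
  The factor \<open>1 / 4\<close> in \<open>entry_act\<close> is due to \<open>2 e\<^sub>i\<^sub>j(m, \<alpha>)\<close> being the sum of two terms, \<open>2 E\<^sub>i\<^sub>j t\<^sup>m e\<^sup>\<alpha>\<close> and minus twice its conjugate
  transpose, which act in the same way by lemma \<open>unit_act_skew\<close>.
  The linear map is defined on the whole general linear algebra; that it respects brackets is shown for unitary matrices.
\<close>

definition fock_rep ::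
    "('g::ab_group_add \<Rightarrow> complex) \<Rightarrow> ('g, 'n::{finite,linorder}) glhat \<Rightarrow> 'n fock \<Rightarrow> 'n fock" where
  "fock_rep \<sigma> x v = (\<Sum>i\<in>UNIV. \<Sum>j\<in>UNIV. entry_act \<sigma> i j (fst x $ i $ j) v) + fock_scale (snd x / 2) v"

lemma unit_act_lin: "lin fock_scale (unit_act i j a m)"
  by (rule fock.linI) (simp_all add: unit_act_def fock.quad_simps fock.scale_right_distrib mult.commute)

lemma unit_act_skew:
  assumes "a \<noteq> 0"
  shows "unit_act j i (inverse a) m v = - fock_scale ((- a) powi m) (unit_act i j a m v)"
proof -
  have "(- inverse a) powi (- m) = (- a) powi m"
    by (simp add: power_int_minus power_int_inverse flip: inverse_minus_eq)
  then have "fock.quad j i (inverse a) m v = - fock_scale ((- a) powi m) (fock.quad i j a m v)"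
    using assms fock.quad_skew[of "inverse a" j i m v] by (simp add: inverse_eq_divide)
  moreover have "scalar_part j i (inverse a) m = - ((- a) powi m * scalar_part i j a m)"
    using assms by (auto simp: scalar_part_def field_simps)
  ultimately show ?thesis
    by (simp add: unit_act_def fock.scale_right_distrib)
qed

lemma entry_act_add: "entry_act \<sigma> i j (f + g) v = entry_act \<sigma> i j f v + entry_act \<sigma> i j g v"
  unfolding entry_act_def by (rule lin_ext_add) (auto simp: add_divide_distrib fock.scale_left_distrib)

lemma entry_act_0 [simp]: "entry_act \<sigma> i j 0 v = 0"
  by (simp add: entry_act_def)

lemma entry_act_single:
  "entry_act \<sigma> i j (Poly_Mapping.single (m, \<alpha>) c) v = fock_scale (c / 4) (unit_act i j (\<sigma> \<alpha>) m v)"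
  unfolding entry_act_def by (subst lin_ext_single) auto

lemma entry_act_scale: "entry_act \<sigma> i j (pm_scale c f) v = fock_scale c (entry_act \<sigma> i j f v)"
proof (induction f rule: poly_mapping_add_induct)
  case (single k d)
  then show ?case by (cases k) (simp add: entry_act_single)
qed (simp_all add: pm_scale_add entry_act_add fock.scale_right_distrib)

lemma entry_act_lin: "lin fock_scale (entry_act \<sigma> i j f)"
proof -
  note simps = fock.lin_simps[OF unit_act_lin]
  have "entry_act \<sigma> i j f (x + y) = entry_act \<sigma> i j f x + entry_act \<sigma> i j f y" for x y
  proof (induction f rule: poly_mapping_add_induct)
    case (single k d)
    then show ?case by (cases k) (simp add: entry_act_single simps fock.scale_right_distrib)
  qed (simp_all add: entry_act_add algebra_simps)
  moreover have "entry_act \<sigma> i j f (fock_scale c x) = fock_scale c (entry_act \<sigma> i j f x)" for c x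
  proof (induction f rule: poly_mapping_add_induct)
    case (single k d)
    then show ?case by (cases k) (simp add: entry_act_single simps mult.commute)
  qed (simp_all add: entry_act_add fock.scale_right_distrib)
  ultimately show ?thesis by (rule fock.linI)
qed

lemma fock_rep_lin: "lin fock_scale (fock_rep \<sigma> x)"
proof -
  note simps = fock.lin_simps[OF entry_act_lin]
  show ?thesis
    by (rule fock.linI)
      (simp_all add: fock_rep_def simps sum.distrib fock.scale_right_distrib fock.scale_sum_right mult.commute)
qed

lemma fock_rep_add: "fock_rep \<sigma> (x + y) v = fock_rep \<sigma> x v + fock_rep \<sigma> y v"
  by (simp add: fock_rep_def entry_act_add sum.distrib add_divide_distrib fock.scale_left_distrib)

lemma fock_rep_scale: "fock_rep \<sigma> (gl_scale c x) v = fock_scale c (fock_rep \<sigma> x v)"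
  by (simp add: fock_rep_def gl_scale_def entry_act_scale fock.scale_right_distrib fock.scale_sum_right)

lemma fock_rep_diff: "fock_rep \<sigma> (x - y) v = fock_rep \<sigma> x v - fock_rep \<sigma> y v"
  using fock_rep_add[of \<sigma> "x - y" y v] by (simp add: eq_diff_eq)

lemma fock_rep_central: "fock_rep \<sigma> gl_central v = fock_scale (1 / 2) v"
  by (simp add: fock_rep_def gl_central_def)

lemma fock_rep_mat_unit:
  "fock_rep \<sigma> (mat_unit i j (rmon m \<alpha>), 0) v = fock_scale (1 / 4) (unit_act i j (\<sigma> \<alpha>) m v)"
proof -
  have "entry_act \<sigma> k l (mat_unit i j (rmon m \<alpha>) $ k $ l) v =
      (if k = i then if l = j then fock_scale (1 / 4) (unit_act i j (\<sigma> \<alpha>) m v) else 0 else 0)" for k l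
    by (simp add: mat_unit_def entry_act_single)
  then have "fock_rep \<sigma> (mat_unit i j (rmon m \<alpha>), 0) v =
      (\<Sum>k\<in>UNIV. \<Sum>l\<in>UNIV. if k = i then if l = j then fock_scale (1 / 4) (unit_act i j (\<sigma> \<alpha>) m v) else 0 else 0)"
    by (simp add: fock_rep_def)
  also have "\<dots> = (\<Sum>k\<in>UNIV. if k = i then fock_scale (1 / 4) (unit_act i j (\<sigma> \<alpha>) m v) else 0)"
    by (intro sum.cong) auto
  finally show ?thesis by simp
qed

lemma unitary_e_eq:
  "unitary_e \<sigma> i j m \<alpha> = (mat_unit i j (rmon m \<alpha>), 0) -
    gl_scale ((- 1) powi m * \<sigma> (- \<alpha>) powi m) (mat_unit j i (rmon m (- \<alpha>)), 0)"
  by (auto simp: unitary_e_def rbar_single gl_scale_def mat_unit_def vec_eq_iff)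

lemma fock_rep_unitary_e:
  assumes "is_character \<sigma>"
  shows "fock_rep \<sigma> (unitary_e \<sigma> i j m \<alpha>) v = fock_scale (1 / 2) (unit_act i j (\<sigma> \<alpha>) m v)"
proof -
  have nz: "\<sigma> \<alpha> \<noteq> 0" using is_character_props(1)[OF assms] .
  have "(- 1) powi m * inverse (\<sigma> \<alpha>) powi m * (- \<sigma> \<alpha>) powi m = 1"
    using nz by (simp flip: power_int_mult_distrib)
  then show ?thesis
    unfolding unitary_e_eq fock_rep_diff fock_rep_scale fock_rep_mat_unit
    using nz by (simp add: is_character_props(4)[OF assms] unit_act_skew[OF nz, of j i] mult.commute
        flip: fock.scale_left_distrib)
qed

lemma mat_scale_diff: "mat_scale c (X - Y) = mat_scale c X - mat_scale c Y"
  by (simp add: mat_scale_def vec_eq_iff pm_scale_diff)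

lemma gl_bracket_simps:
  "gl_bracket \<sigma> (x + y) z = gl_bracket \<sigma> x z + gl_bracket \<sigma> y z"
  "gl_bracket \<sigma> z (x + y) = gl_bracket \<sigma> z x + gl_bracket \<sigma> z y"
  "gl_bracket \<sigma> (x - y) z = gl_bracket \<sigma> x z - gl_bracket \<sigma> y z"
  "gl_bracket \<sigma> z (x - y) = gl_bracket \<sigma> z x - gl_bracket \<sigma> z y"
  "gl_bracket \<sigma> (gl_scale c x) z = gl_scale c (gl_bracket \<sigma> x z)"
  "gl_bracket \<sigma> z (gl_scale c x) = gl_scale c (gl_bracket \<sigma> z x)"
  by (simp_all add: gl_bracket_def gl_scale_eq mat_mult_add mat_mult_diff mat_mult_scale mat_scale_diff
      gl_cocycle_add gl_cocycle_diff gl_cocycle_scale)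

lemma gl_bracket_central: "gl_bracket \<sigma> gl_central x = 0" "gl_bracket \<sigma> x gl_central = 0"
  by (simp_all add: gl_bracket_def gl_central_def zero_prod_def mat_mult_def gl_cocycle_def vec_eq_iff)

text \<open>
  The scalars match in two different ways. If \<open>\<sigma> \<alpha> \<sigma> \<beta> \<noteq> 1\<close>, the cocycle vanishes and the scalar parts of the two diagonal terms
  give \<open>sgn_sum\<close>. If \<open>\<sigma> \<alpha> \<sigma> \<beta> = 1\<close>, these scalar parts vanish and \<open>sgn_sum\<close> is the cocycle.
\<close>

lemma fock_rep_bracket_mat_unit:
  assumes "is_character \<sigma>"
  shows "fock_rep \<sigma> (gl_bracket \<sigma> (mat_unit i j (rmon m \<alpha>), 0) (mat_unit k l (rmon n \<beta>), 0)) v =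
    fock_scale (1 / 8) (fock.quad_bracket i j (\<sigma> \<alpha>) m k l (\<sigma> \<beta>) n v)"
proof -
  define a b where "a = \<sigma> \<alpha>" and "b = \<sigma> \<beta>"
  have nz: "a \<noteq> 0" "b \<noteq> 0" and ab: "\<sigma> (\<alpha> + \<beta>) = a * b"
    using is_character_props[OF assms] by (auto simp: a_def b_def)
  let ?d = "of_bool (j = k \<and> i = l \<and> m + n = 0) :: complex"
  have const: "of_bool (j = k) * a powi n * scalar_part i l (a * b) (m + n) / 4
     - of_bool (i = l) * b powi m * scalar_part k j (a * b) (m + n) / 4
     + of_int m * of_bool (i = l) * of_bool (j = k) * of_bool (m + n = 0) * of_bool (a * b = 1) * a powi n / 2 =
     ?d * a powi n * sgn_sum (a * b) m / 4"
  proof (cases "j = k \<and> i = l \<and> m + n = 0")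
    case True
    then have jk: "j = k" "i = l" and n: "n = - m" by auto
    show ?thesis
    proof (cases "a * b = 1")
      case True
      then show ?thesis using jk n by (simp add: scalar_part_def sgn_sum_closed)
    next
      case False
      have "b powi m = a powi n * (a * b) powi m"
        using nz n by (simp add: power_int_mult_distrib power_int_minus)
      then have "a powi n * (1 - (a * b) powi m) = a powi n - b powi m"
        by (simp add: algebra_simps)
      moreover have "sgn_sum (a * b) m = (1 - (a * b) powi m) * ((1 + a * b) / (1 - a * b))"
        using nz False by (simp add: sgn_sum_closed)
      ultimately have "a powi n * sgn_sum (a * b) m = (a powi n - b powi m) * ((1 + a * b) / (1 - a * b))"
        by (metis mult.assoc)
      then show ?thesis using jk n False by (simp add: scalar_part_def left_diff_distrib diff_divide_distrib)
    qed
  next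
    case False
    then show ?thesis by (auto simp: scalar_part_def)
  qed
  have "fock_rep \<sigma> (gl_bracket \<sigma> (mat_unit i j (rmon m \<alpha>), 0) (mat_unit k l (rmon n \<beta>), 0)) v =
     fock_scale (of_bool (j = k) * a powi n / 4) (fock.quad i l (a * b) (m + n) v)
     - fock_scale (of_bool (i = l) * b powi m / 4) (fock.quad k j (a * b) (m + n) v)
     + fock_scale (of_bool (j = k) * a powi n * scalar_part i l (a * b) (m + n) / 4
     - of_bool (i = l) * b powi m * scalar_part k j (a * b) (m + n) / 4
     + of_int m * of_bool (i = l) * of_bool (j = k) * of_bool (m + n = 0) * of_bool (a * b = 1) * a powi n / 2) v"
    unfolding gl_bracket_basis[OF assms] fock_rep_add fock_rep_diff fock_rep_scale fock_rep_mat_unit fock_rep_central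
      unit_act_def ab a_def[symmetric] b_def[symmetric]
    by (simp add: fock.scale_right_distrib fock.scale_left_distrib fock.scale_left_diff_distrib)
  then show ?thesis
    unfolding const fock.quad_bracket_def a_def[symmetric] b_def[symmetric]
    by (simp add: fock.scale_right_distrib fock.scale_right_diff_distrib)
qed

lemma quad_commutator_unit_act:
  "unit_act i j a m (unit_act k l b n v) - unit_act k l b n (unit_act i j a m v) =
    fock.quad i j a m (fock.quad k l b n v) - fock.quad k l b n (fock.quad i j a m v)"
  by (simp add: unit_act_def fock.quad_simps fock.scale_right_distrib mult.commute)

text \<open>
  The bracket of two unitary generators expands into four brackets of matrix units. The two that contain \<open>E\<^sub>i\<^sub>j\<close> combine to the
  commutator \<open>C i j a\<close> by lemma \<open>quad_commutator\<close>. The two that contain \<open>E\<^sub>j\<^sub>i\<close> give \<open>C j i (inverse a)\<close>, and this is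
  proportional to \<open>C i j a\<close> by skew-symmetry.
\<close>

lemma fock_rep_bracket_unitary_e:
  assumes "is_character \<sigma>"
  shows "fock_rep \<sigma> (gl_bracket \<sigma> (unitary_e \<sigma> i j m \<alpha>) (unitary_e \<sigma> k l n \<beta>)) v =
    fock_rep \<sigma> (unitary_e \<sigma> i j m \<alpha>) (fock_rep \<sigma> (unitary_e \<sigma> k l n \<beta>) v) -
    fock_rep \<sigma> (unitary_e \<sigma> k l n \<beta>) (fock_rep \<sigma> (unitary_e \<sigma> i j m \<alpha>) v)"
proof -
  define a b where "a = \<sigma> \<alpha>" and "b = \<sigma> \<beta>"
  have nz: "a \<noteq> 0" "b \<noteq> 0" and inv: "\<sigma> (- \<alpha>) = inverse a" "\<sigma> (- \<beta>) = inverse b"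
    using is_character_props[OF assms] by (auto simp: a_def b_def)
  define C where "C i j a = fock.quad i j a m (fock.quad k l b n v) - fock.quad k l b n (fock.quad i j a m v)" for i j a
  define s where "s = (- 1) powi m * inverse a powi m"
  define t where "t = (- 1) powi n * inverse b powi n"
  let ?T = fock.quad_bracket
  have t: "t = (- 1) powi n * b powi (- n)"
    by (simp add: t_def power_int_minus power_int_inverse)
  have C: "C i j a = ?T i j a m k l b n v - fock_scale t (?T i j a m l k (inverse b) n v)" if "a \<noteq> 0" for i j a
    unfolding C_def fock.quad_commutator[OF that nz(2)] t inverse_eq_divide ..
  have "fock_rep \<sigma> (gl_bracket \<sigma> (unitary_e \<sigma> i j m \<alpha>) (unitary_e \<sigma> k l n \<beta>)) v =
    fock_scale (1 / 8) (C i j a) - fock_scale s (fock_scale (1 / 8) (C j i (inverse a)))"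
    unfolding unitary_e_eq gl_bracket_simps fock_rep_diff fock_rep_scale fock_rep_bracket_mat_unit[OF assms]
      inv a_def[symmetric] b_def[symmetric] s_def[symmetric] t_def[symmetric]
    using nz by (simp add: C fock.scale_right_diff_distrib mult.commute)
  also have "C j i (inverse a) = - fock_scale ((- a) powi m) (C i j a)"
  proof -
    have "(- inverse a) powi (- m) = (- a) powi m"
      by (simp add: power_int_minus power_int_inverse flip: inverse_minus_eq)
    then have "fock.quad j i (inverse a) m w = - fock_scale ((- a) powi m) (fock.quad i j a m w)" for w
      using nz fock.quad_skew[of "inverse a" j i m w] by (simp add: inverse_eq_divide)
    then show ?thesis
      by (simp add: C_def fock.quad_simps fock.scale_right_diff_distrib)
  qed
  also have "fock_scale s (fock_scale (1 / 8) (- fock_scale ((- a) powi m) (C i j a))) = - fock_scale (1 / 8) (C i j a)"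
  proof -
    have "s * (- a) powi m = 1"
      using nz unfolding s_def by (simp flip: power_int_mult_distrib)
    then have "s * (1 / 8 * (- a) powi m) = 1 / 8" by (simp add: mult.left_commute)
    then show ?thesis by (simp only: fock.scale_minus_right fock.scale_scale)
  qed
  also have "fock_scale (1 / 8) (C i j a) - - fock_scale (1 / 8) (C i j a) = fock_scale (1 / 4) (C i j a)"
    by (simp flip: fock.scale_left_distrib)
  also have "\<dots> = fock_rep \<sigma> (unitary_e \<sigma> i j m \<alpha>) (fock_rep \<sigma> (unitary_e \<sigma> k l n \<beta>) v) -
    fock_rep \<sigma> (unitary_e \<sigma> k l n \<beta>) (fock_rep \<sigma> (unitary_e \<sigma> i j m \<alpha>) v)"
    unfolding fock_rep_unitary_e[OF assms] fock.lin_simps[OF unit_act_lin] C_def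
      quad_commutator_unit_act[symmetric] a_def[symmetric] b_def[symmetric]
    by (simp add: fock.scale_right_diff_distrib)
  finally show ?thesis .
qed

lemma mat_unit_add: "mat_unit i j (f + g) = mat_unit i j f + mat_unit i j g"
  by (simp add: mat_unit_def vec_eq_iff)

lemma mat_unit_scale: "mat_unit i j (pm_scale c f) = mat_scale c (mat_unit i j f)"
  by (simp add: mat_unit_def mat_scale_def vec_eq_iff)

text \<open>
  The generators span: a unitary matrix \<open>X\<close> is \<open>(X - X\<^sup>*) / 2\<close>, and \<open>X - X\<^sup>*\<close> is a combination of the \<open>e\<^sub>i\<^sub>j(m, \<alpha>)\<close>.
\<close>

lemma unitary_hat_induct [consumes 1, case_names e central add scale]:
  fixes x :: "('g::ab_group_add, 'n::finite) glhat"
  assumes x: "x \<in> unitary_hat \<sigma>"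
    and e: "\<And>i j m \<alpha>. P (unitary_e \<sigma> i j m \<alpha>)" and central: "P gl_central"
    and add: "\<And>x y. P x \<Longrightarrow> P y \<Longrightarrow> P (x + y)" and scale: "\<And>c x. P x \<Longrightarrow> P (gl_scale c x)"
  shows "P x"
proof -
  have zero: "P 0"
  proof -
    have "gl_scale 0 gl_central = (0 :: ('g, 'n) glhat)"
      by (simp add: gl_scale_def gl_central_def zero_prod_def vec_eq_iff)
    then show ?thesis using scale[OF central, of 0] by simp
  qed
  have sum: "P (sum f A)" if "\<And>i. P (f i)" for f and A :: "'n set"
    using that by (induction A rule: infinite_finite_induct) (auto intro: zero add)
  define U :: "'n \<Rightarrow> 'n \<Rightarrow> 'g ralg \<Rightarrow> ('g, 'n) glhat"
    where "U i j r = (mat_unit i j r - mat_unit j i (rbar \<sigma> r), 0)" for i j r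
  have U: "P (U i j r)" for i j r
  proof (induction r rule: poly_mapping_add_induct)
    case zero
    have "U i j 0 = 0" by (simp add: U_def mat_unit_def vec_eq_iff zero_prod_def)
    then show ?case using \<open>P 0\<close> by simp
  next
    case (single k c)
    obtain m \<alpha> where k: "k = (m, \<alpha>)" by (cases k)
    have "U i j (Poly_Mapping.single k c) = gl_scale c (unitary_e \<sigma> i j m \<alpha>)"
      using mat_unit_scale[of i j c "rmon m \<alpha>"] mat_unit_scale[of j i c "rbar \<sigma> (rmon m \<alpha>)"]
      by (simp add: U_def k unitary_e_def gl_scale_eq mat_scale_diff flip: rbar_scale)
    then show ?case using scale[OF e] by simp
  next
    case (add f g)
    have "U i j (f + g) = U i j f + U i j g"
      by (simp add: U_def mat_unit_add rbar_add)
    then show ?case using assms(4)[OF add] by simp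
  qed
  obtain X c where Xc: "x = (X, c)" and X: "mat_star \<sigma> X = - X"
    using x by (auto simp: unitary_hat_def unitary_mats_def)
  have "(\<Sum>i\<in>UNIV. \<Sum>j\<in>UNIV. U i j (X $ i $ j)) = (X + X, 0)"
  proof -
    have "(\<Sum>i\<in>UNIV. \<Sum>j\<in>UNIV. if k = i \<and> l = j then X $ i $ j else 0) = X $ k $ l" for k l
    proof -
      have "(\<Sum>i\<in>UNIV. \<Sum>j\<in>UNIV. if k = i \<and> l = j then X $ i $ j else 0) = (\<Sum>i\<in>UNIV. if k = i then X $ i $ l else 0)"
        by (intro sum.cong) auto
      then show ?thesis by simp
    qed
    moreover have "(\<Sum>i\<in>UNIV. \<Sum>j\<in>UNIV. if k = j \<and> l = i then rbar \<sigma> (X $ i $ j) else 0) = - X $ k $ l" for k l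
    proof -
      have "(\<Sum>i\<in>UNIV. \<Sum>j\<in>UNIV. if k = j \<and> l = i then rbar \<sigma> (X $ i $ j) else 0) =
          (\<Sum>i\<in>UNIV. if l = i then rbar \<sigma> (X $ i $ k) else 0)"
        by (intro sum.cong) auto
      also have "\<dots> = - X $ k $ l"
        using X by (simp add: mat_star_def vec_eq_iff)
      finally show ?thesis .
    qed
    ultimately have "fst (\<Sum>i\<in>UNIV. \<Sum>j\<in>UNIV. U i j (X $ i $ j)) = X + X"
      by (simp add: U_def fst_sum vec_eq_iff mat_unit_def sum_subtractf)
    moreover have "snd (\<Sum>i\<in>UNIV. \<Sum>j\<in>UNIV. U i j (X $ i $ j)) = 0"
      by (simp add: U_def snd_sum)
    ultimately show ?thesis by (simp add: prod_eq_iff)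
  qed
  moreover have "P (\<Sum>i\<in>UNIV. \<Sum>j\<in>UNIV. U i j (X $ i $ j))"
    by (intro sum U)
  ultimately have "P (X + X, 0)" by simp
  moreover have "gl_scale (1 / 2) (X + X, 0) = (X, 0)"
  proof -
    have "pm_scale (1 / 2) (f + f) = f" for f :: "'g ralg"
      by (simp only: pm_scale_add pm_scale_add_left[symmetric]) simp
    then show ?thesis
      by (simp only: gl_scale_eq mat_scale_def fst_conv snd_conv vector_add_component vec_lambda_eta mult_zero_right)
  qed
  ultimately have "P (X, 0)" using scale[of "(X + X, 0)" "1 / 2"] by simp
  then have "P ((X, 0) + gl_scale c gl_central)"
    using add scale[OF central] by blast
  moreover have "(X, 0) + gl_scale c gl_central = x"
    by (simp add: Xc gl_scale_eq gl_central_def mat_scale_def vec_eq_iff)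
  ultimately show ?thesis by simp
qed

lemma fock_rep_bracket:
  fixes \<sigma> :: "'g::ab_group_add \<Rightarrow> complex" and x y :: "('g, 'n::{finite,linorder}) glhat"
  assumes \<sigma>: "is_character \<sigma>" and x: "x \<in> unitary_hat \<sigma>" and y: "y \<in> unitary_hat \<sigma>"
  shows "fock_rep \<sigma> (gl_bracket \<sigma> x y) v =
    fock_rep \<sigma> x (fock_rep \<sigma> y v) - fock_rep \<sigma> y (fock_rep \<sigma> x v)"
proof -
  note simps = gl_bracket_simps fock_rep_add fock_rep_scale fock.lin_simps[OF fock_rep_lin]
  have bracket_central: "fock_rep \<sigma> (gl_bracket \<sigma> gl_central y) v =
      fock_rep \<sigma> gl_central (fock_rep \<sigma> y v) - fock_rep \<sigma> y (fock_rep \<sigma> gl_central v)"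
    "fock_rep \<sigma> (gl_bracket \<sigma> y gl_central) v =
      fock_rep \<sigma> y (fock_rep \<sigma> gl_central v) - fock_rep \<sigma> gl_central (fock_rep \<sigma> y v)"
    for y :: "('g, 'n) glhat" and v
    using fock_rep_diff[of \<sigma> 0 0 v] by (simp_all add: gl_bracket_central fock_rep_central simps)
  show ?thesis using x
  proof (induction x arbitrary: v rule: unitary_hat_induct)
    case (e i j m \<alpha>)
    show ?case using y
    proof (induction y arbitrary: v rule: unitary_hat_induct)
      case (e k l n \<beta>)
      show ?case by (rule fock_rep_bracket_unitary_e[OF \<sigma>])
    next
      case central
      show ?case by (rule bracket_central(2))
    qed (simp_all add: simps fock.scale_right_diff_distrib)
  next
    case central
    show ?case by (rule bracket_central(1))
  qed (simp_all add: simps fock.scale_right_diff_distrib)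
qed

theorem theorem3p2:
  fixes \<sigma> :: "'g::ab_group_add \<Rightarrow> complex"
  assumes "CARD('n::{finite,linorder}) \<ge> 2"
    and "is_character \<sigma>"
  shows "\<exists>\<rho> :: ('g, 'n) glhat \<Rightarrow> 'n fock \<Rightarrow> 'n fock.
    lie_representation gl_scale (unitary_hat \<sigma>) (gl_bracket \<sigma>) fock_scale \<rho> \<and>
    (\<forall>i j m \<alpha> v. \<rho> (gl_scale 2 (unitary_e \<sigma> i j m \<alpha>)) v =
       x_op i j (\<sigma> \<alpha>) m v +
       fock_scale (if m = 0 \<and> i = j \<and> \<sigma> \<alpha> \<noteq> 1 then (1 + \<sigma> \<alpha>) / (1 - \<sigma> \<alpha>) else 0) v) \<and>
    (\<forall>v. \<rho> gl_central v = fock_scale (1 / 2) v)"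
proof (intro exI[of _ "fock_rep \<sigma>"] conjI allI)
  show "lie_representation gl_scale (unitary_hat \<sigma>) (gl_bracket \<sigma>) fock_scale
      (fock_rep \<sigma> :: ('g, 'n) glhat \<Rightarrow> _)"
    by (intro lie_representation.intro lie_representation_axioms.intro lie_algebra_unitary_hat
        vector_space_fock_scale fock_rep_bracket assms(2))
      (auto simp: fock_rep_lin fock_rep_add fock_rep_scale)
  fix i j :: 'n and m \<alpha> and v :: "'n fock"
  have "\<sigma> \<alpha> \<noteq> 0" using is_character_props(1)[OF assms(2)] .
  then show "fock_rep \<sigma> (gl_scale 2 (unitary_e \<sigma> i j m \<alpha>)) v = x_op i j (\<sigma> \<alpha>) m v +
      fock_scale (if m = 0 \<and> i = j \<and> \<sigma> \<alpha> \<noteq> 1 then (1 + \<sigma> \<alpha>) / (1 - \<sigma> \<alpha>) else 0) v"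
    by (simp add: fock_rep_scale fock_rep_unitary_e[OF assms(2)] unit_act_def scalar_part_def x_op_eq_quad)
qed (rule fock_rep_central)

end
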